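(* Let $p,q\ge 2$ be integers and let $H\neq 0$ be a real constant. There is exactly one hypersurface of $\mathbb{R}^{p+q}$ invariant by $O(p)\times O(q)$, with constant mean curvature $H$, whose generating (profile) curve is a global solution of $$(p+q-1)H = \frac{x'(t)y''(t)-x''(t)y'(t)}{W(t)^3}+(q-1)\frac{y'(t)}{x(t)W(t)}-(p-1)\frac{x'(t)}{y(t)W(t)},\qquad W(t)=\sqrt{x'(t)^2+y'(t)^2},$$ with one cusp point at the origin. Moreover: (i) the topological type of this hypersurface, which is singular at the origin, is $(\mathbb{R}\setminus\{0\})\times\mathbb{S}^{p-1}\times\mathbb{S}^{q-1}$; (ii) the profile curve is $W^s\cup W^u\cup\{0\}$, where the two branches $W^u$ and $W^s$ are smooth and tangent at the origin to the line $y=(\tan\alpha_0)x$, with $\tan\alpha_0=\sqrt{\frac{p-1}{q-1}}$, and the curvatures of $W^u$ and $W^s$ at the origin are given, respectively, by $$k_u=\frac{2H(p+q-1)}{3p+3q-4}\qquad\text{and}\qquad k_s=-k_u,$$ where $k_s<0$ when $H>0$.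
   Context: Write $\mathbb{R}^{p+q}=\mathbb{R}^q\times\mathbb{R}^p$ with $O(q)$ acting on the first factor and $O(p)$ on the second in the standard way. The coordinates of the orbit space are $x$ = norm of the $\mathbb{R}^q$-component and $y$ = norm of the $\mathbb{R}^p$-component, so the orbit space is $\{(x,y): x\ge 0,\ y\ge 0\}$; let $Q_1=\{(x,y): x>0,\ y>0\}$. A curve $\gamma(t)=(x(t),y(t))$ in $Q_1$ (the profile or generating curve) generates the invariant hypersurface $\{(x(t)\xi,\,y(t)\eta):\ \xi\in\mathbb{S}^{q-1},\ \eta\in\mathbb{S}^{p-1}\}$. Its principal curvatures are $\lambda_1=\frac{x'y''-x''y'}{W^3}$ (multiplicity $1$), $\lambda_2=\frac{y'}{xW}$ (multiplicity $q-1$), $\lambda_3=-\frac{x'}{yW}$ (multiplicity $p-1$). The mean curvature $H$ is normalized by $(p+q-1)H=\lambda_1+(q-1)\lambda_2+(p-1)\lambda_3$; having constant mean curvature $H$ is the displayed equation. A solution curve is called global if it is defined for $-\infty<t<\infty$ and is infinitely extendable in both directions (parametrized by arc length away from singular points). A cusp point is a singular point of the extended solution at which it reaches the boundary of $Q_1$. A global solution "with one cusp point at the origin" is a continuous curve $\gamma:\mathbb{R}\to\{x\ge0,y\ge0\}$ such that, for some $t_0$, $\gamma(t_0)=(0,0)$, $\gamma(t)\in Q_1$ for all $t\ne t_0$, and $\gamma$ is a smooth arc-length parametrized solution of the equation on $(-\infty,t_0)$ and on $(t_0,\infty)$. Curves differing by a translation of $t$ are identified. $W^u$ denotes the branch leaving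 the origin (the image of $t>t_0$) and $W^s$ the branch arriving at the origin (the image of $t<t_0$). Smoothness, tangency and curvature at the origin refer to each branch together with its endpoint $0$. The signed curvature of each branch at the origin is computed with the branch oriented outward from the origin (e.g. parametrized by the distance $r$ to the origin), positive curvature meaning turning counterclockwise. The topological type refers to the manifold parametrizing the hypersurface with the singular point at the origin removed. *)

theory Defs
  imports "HOL-Analysis.Analysis"
begin

section \<open>Smooth maps\<close>

text \<open>
  Derivatives are taken within \<open>S\<close>, so that on a half-line such as \<open>{t0..}\<close> the notion
  means smoothness up to and including the endpoint (one-sided derivatives there).  The
  definition is only used for sets on which derivatives within the set are unique:
  open sets and closed half-lines.
\<close>

primrec C_k :: "nat \<Rightarrow> 'a::real_normed_vector set \<Rightarrow> ('a \<Rightarrow> 'b::real_normed_vector) \<Rightarrow> bool" where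
  "C_k 0 S f \<longleftrightarrow> continuous_on S f"
| "C_k (Suc k) S f \<longleftrightarrow>
     (\<exists>f'. (\<forall>x\<in>S. (f has_derivative f' x) (at x within S)) \<and> (\<forall>v. C_k k S (\<lambda>x. f' x v)))"

definition smooth_on :: "'a::real_normed_vector set \<Rightarrow> ('a \<Rightarrow> 'b::real_normed_vector) \<Rightarrow> bool" where
  "smooth_on S f \<longleftrightarrow> (\<forall>k. C_k k S f)"

section \<open>Plane curves\<close>

definition velocity :: "real set \<Rightarrow> (real \<Rightarrow> real \<times> real) \<Rightarrow> real \<Rightarrow> real \<times> real" where
  "velocity S c t = vector_derivative c (at t within S)"

definition acceleration :: "real set \<Rightarrow> (real \<Rightarrow> real \<times> real) \<Rightarrow> real \<Rightarrow> real \<times> real" where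
  "acceleration S c t = vector_derivative (velocity S c) (at t within S)"

definition speed :: "real set \<Rightarrow> (real \<Rightarrow> real \<times> real) \<Rightarrow> real \<Rightarrow> real" where
  "speed S c t = sqrt ((fst (velocity S c t))\<^sup>2 + (snd (velocity S c t))\<^sup>2)"

text \<open>Positive when the curve turns counterclockwise.\<close>

definition signed_curvature :: "real set \<Rightarrow> (real \<Rightarrow> real \<times> real) \<Rightarrow> real \<Rightarrow> real" where
  "signed_curvature S c t =
     (fst (velocity S c t) * snd (acceleration S c t) - fst (acceleration S c t) * snd (velocity S c t))
       / (speed S c t) ^ 3"

section \<open>Profile curves and constant mean curvature\<close>

text \<open>
  The first coordinate of the orbit space is the norm of the component in \<open>R^q\<close>, on which
  \<open>O(q)\<close> acts; the second one is the norm of the component in \<open>R^p\<close>, on which \<open>O(p)\<close> acts.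
\<close>

definition Q1 :: "(real \<times> real) set" where
  "Q1 = {(x, y). x > 0 \<and> y > 0}"

definition cmc_equation :: "nat \<Rightarrow> nat \<Rightarrow> real \<Rightarrow> (real \<Rightarrow> real \<times> real) \<Rightarrow> real \<Rightarrow> bool" where
  "cmc_equation p q H \<gamma> t \<longleftrightarrow>
     (let x = fst (\<gamma> t); x' = fst (velocity UNIV \<gamma> t); x'' = fst (acceleration UNIV \<gamma> t);
          y = snd (\<gamma> t); y' = snd (velocity UNIV \<gamma> t); y'' = snd (acceleration UNIV \<gamma> t);
          W = sqrt (x'\<^sup>2 + y'\<^sup>2)
      in (real p + real q - 1) * H =
           (x' * y'' - x'' * y') / W ^ 3 + (real q - 1) * (y' / (x * W)) - (real p - 1) * (x' / (y * W)))"

definition principal_curvature1 :: "(real \<Rightarrow> real \<times> real) \<Rightarrow> real \<Rightarrow> real" where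
  "principal_curvature1 \<gamma> t = signed_curvature UNIV \<gamma> t"

definition principal_curvature2 :: "(real \<Rightarrow> real \<times> real) \<Rightarrow> real \<Rightarrow> real" where
  "principal_curvature2 \<gamma> t = snd (velocity UNIV \<gamma> t) / (fst (\<gamma> t) * speed UNIV \<gamma> t)"

definition principal_curvature3 :: "(real \<Rightarrow> real \<times> real) \<Rightarrow> real \<Rightarrow> real" where
  "principal_curvature3 \<gamma> t = - fst (velocity UNIV \<gamma> t) / (snd (\<gamma> t) * speed UNIV \<gamma> t)"

text \<open>
  Mean curvature of the generated hypersurface along the orbit over \<open>\<gamma> t\<close>; the principal
  curvatures have multiplicities \<open>1\<close>, \<open>q - 1\<close> and \<open>p - 1\<close>.
\<close>

definition mean_curvature :: "nat \<Rightarrow> nat \<Rightarrow> (real \<Rightarrow> real \<times> real) \<Rightarrow> real \<Rightarrow> real" where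
  "mean_curvature p q \<gamma> t =
     (principal_curvature1 \<gamma> t + (real q - 1) * principal_curvature2 \<gamma> t
        + (real p - 1) * principal_curvature3 \<gamma> t) / (real p + real q - 1)"

lemma cmc_equation_iff_mean_curvature:
  assumes "p + q \<ge> 2"
  shows "cmc_equation p q H \<gamma> t \<longleftrightarrow> mean_curvature p q \<gamma> t = H"
proof -
  have "real p + real q - 1 \<noteq> 0" using assms by linarith
  then show ?thesis
    unfolding cmc_equation_def mean_curvature_def principal_curvature1_def principal_curvature2_def
      principal_curvature3_def signed_curvature_def speed_def Let_def
    by (simp add: divide_eq_eq mult.commute) (auto simp: algebra_simps)
qed

definition arclength_cmc_solution_on ::
    "nat \<Rightarrow> nat \<Rightarrow> real \<Rightarrow> (real \<Rightarrow> real \<times> real) \<Rightarrow> real set \<Rightarrow> bool" where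
  "arclength_cmc_solution_on p q H \<gamma> I \<longleftrightarrow>
     smooth_on I \<gamma> \<and> (\<forall>t\<in>I. speed UNIV \<gamma> t = 1 \<and> cmc_equation p q H \<gamma> t)"

definition global_solution_cusp_at_origin ::
    "nat \<Rightarrow> nat \<Rightarrow> real \<Rightarrow> (real \<Rightarrow> real \<times> real) \<Rightarrow> real \<Rightarrow> bool" where
  "global_solution_cusp_at_origin p q H \<gamma> t0 \<longleftrightarrow>
     continuous_on UNIV \<gamma> \<and> \<gamma> t0 = (0, 0) \<and> (\<forall>t. t \<noteq> t0 \<longrightarrow> \<gamma> t \<in> Q1) \<and>
     arclength_cmc_solution_on p q H \<gamma> {..<t0} \<and>
     arclength_cmc_solution_on p q H \<gamma> {t0<..}"

section \<open>Invariant hypersurfaces\<close>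

definition orbit_map ::
    "(real \<Rightarrow> real \<times> real) \<Rightarrow> real \<times> (real^'q) \<times> (real^'p) \<Rightarrow> (real^'q) \<times> (real^'p)" where
  "orbit_map \<gamma> = (\<lambda>(t, u, v). (fst (\<gamma> t) *\<^sub>R u, snd (\<gamma> t) *\<^sub>R v))"

definition generated_hypersurface ::
    "(real \<Rightarrow> real \<times> real) \<Rightarrow> ((real^'q) \<times> (real^'p)) set" where
  "generated_hypersurface \<gamma> = orbit_map \<gamma> ` (UNIV \<times> sphere 0 1 \<times> sphere 0 1)"

definition orthogonally_invariant :: "((real^'q) \<times> (real^'p)) set \<Rightarrow> bool" where
  "orthogonally_invariant M \<longleftrightarrow>
     (\<forall>A B. orthogonal_transformation A \<longrightarrow> orthogonal_transformation B \<longrightarrow>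
        (\<lambda>(u, v). (A u, B v)) ` M = M)"

text \<open>
  Immersions of the manifold \<open>I \<times> S^(q-1) \<times> S^(p-1)\<close>, with \<open>I\<close> open, for maps given on a
  neighbourhood of it: the tangent space at \<open>(t, \<xi>, \<eta>)\<close> consists of the \<open>(s, w, z)\<close> with \<open>w\<close>
  orthogonal to \<open>\<xi>\<close> and \<open>z\<close> orthogonal to \<open>\<eta>\<close>.
\<close>

definition immersion_on_spheres ::
    "real set \<Rightarrow> (real \<times> (real^'q) \<times> (real^'p) \<Rightarrow> (real^'q) \<times> (real^'p)) \<Rightarrow> bool" where
  "immersion_on_spheres I \<Phi> \<longleftrightarrow>
     smooth_on (I \<times> UNIV \<times> UNIV) \<Phi> \<and>
     (\<forall>t\<in>I. \<forall>\<xi>\<in>sphere 0 1. \<forall>\<eta>\<in>sphere 0 1.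
        \<exists>D. (\<Phi> has_derivative D) (at (t, \<xi>, \<eta>)) \<and>
            inj_on D {(s, w, z). \<xi> \<bullet> w = 0 \<and> \<eta> \<bullet> z = 0})"

text \<open>
  \<open>M\<close> is, near its point \<open>a\<close>, an embedded smooth hypersurface (the zero set of a function with
  nonzero differential); a point of \<open>M\<close> is singular if this fails.
\<close>

definition smooth_hypersurface_at :: "'a::euclidean_space set \<Rightarrow> 'a \<Rightarrow> bool" where
  "smooth_hypersurface_at M a \<longleftrightarrow>
     (\<exists>U (f :: 'a \<Rightarrow> real). open U \<and> a \<in> U \<and> smooth_on U f \<and> frechet_derivative f (at a) \<noteq> (\<lambda>v. 0) \<and>
        M \<inter> U = {z \<in> U. f z = 0})"

definition singular_at :: "'a::euclidean_space set \<Rightarrow> 'a \<Rightarrow> bool" where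
  "singular_at M a \<longleftrightarrow> a \<in> M \<and> \<not> smooth_hypersurface_at M a"

section \<open>The two branches at the cusp\<close>

definition W_u :: "(real \<Rightarrow> real \<times> real) \<Rightarrow> real \<Rightarrow> (real \<times> real) set" where
  "W_u \<gamma> t0 = \<gamma> ` {t0<..}"

definition W_s :: "(real \<Rightarrow> real \<times> real) \<Rightarrow> real \<Rightarrow> (real \<times> real) set" where
  "W_s \<gamma> t0 = \<gamma> ` {..<t0}"

text \<open>
  The branches together with their endpoint, as curves on \<open>{0..}\<close> parametrized by arc length
  and oriented outward from the origin; for \<open>W_s\<close> this reverses the orientation of \<open>\<gamma>\<close>.
\<close>

definition outward_u :: "(real \<Rightarrow> real \<times> real) \<Rightarrow> real \<Rightarrow> real \<Rightarrow> real \<times> real" where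
  "outward_u \<gamma> t0 s = \<gamma> (t0 + s)"

definition outward_s :: "(real \<Rightarrow> real \<times> real) \<Rightarrow> real \<Rightarrow> real \<Rightarrow> real \<times> real" where
  "outward_s \<gamma> t0 s = \<gamma> (t0 - s)"

definition tangent_at_endpoint :: "(real \<Rightarrow> real \<times> real) \<Rightarrow> (real \<times> real) set \<Rightarrow> bool" where
  "tangent_at_endpoint c L \<longleftrightarrow>
     c 0 \<in> L \<and> velocity {0..} c 0 \<noteq> 0 \<and> c 0 + velocity {0..} c 0 \<in> L"

end

theory Submission
  imports Defs
begin

text \<open>
  Put \<open>a = q - 1\<close>, \<open>b = p - 1\<close>, \<open>h = (p + q - 1) H\<close>, and let \<open>(C, S)\<close> be the unit velocity of a
  profile curve \<open>(x, y)\<close>.  Reversing the orientation replaces \<open>h\<close> by \<open>- h\<close>, so it suffices to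
  show that for every \<open>h\<close> exactly one solution leaves the origin and stays in \<open>Q1\<close> forever.

  Existence near the origin: in suitable quotients the equation becomes a quadratic system with a
  singular point of the first kind at \<open>s = 0\<close>, and the formal power series solution converges.
  It is thus smooth up to the origin, and its first coefficient is the curvature there.

  Continuation: \<open>x^a (S - h x / (a + 1))\<close> and \<open>y^b (C + h y / (b + 1))\<close> are nondecreasing along a
  solution and positive near the origin, which keeps \<open>x\<close> and \<open>y\<close> away from \<open>0\<close>.

  Uniqueness: along any solution leaving the origin, the function
  \<open>1 - cos \<delta> + a G (x / (s C0)) + b G (y / (s S0))\<close> with \<open>G t = t - 1 - ln t\<close> and \<open>\<delta>\<close> the angle
  between \<open>(C, S)\<close> and \<open>(C0, S0) = (cos \<alpha>, sin \<alpha>)\<close>, \<open>\<alpha>\<close> the angle of the minimal cone, is a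
  strict Lyapunov function up to an error \<open>O(s)\<close>.  Going backwards to \<open>s = 0\<close> it would blow up
  unless it tends to \<open>0\<close>; so all solutions are asymptotic to the same line, and near it two
  solutions are compared by a quadratic form that decreases away from the origin but vanishes there.
\<close>

section \<open>Calculus of \<open>C_k\<close> maps\<close>

text \<open>The equation is singular at the cusp, so neither existence nor uniqueness there follows
  from the Picard theorem. Uniqueness has to cover every curve that is merely continuous at the
  origin: no tangent and no rate of approach is given, so both must be extracted from the equation.
  In the variables x/s, y/s, C, S the right-hand side is of order 1/s, and a plain Gronwall estimate
  diverges at s = 0; two branches can be compared only because the linearization at the cone
  direction is contracting as s grows. The same fact rules out resonances in the formal power
  series: the divisors of its coefficients are n, n + 1 and n + (a + b) + (a + b)/(n + 1), none of
  which vanishes for n > 0. The weights in the Lyapunov function are forced by a/C0^2 = b/S0^2 = a +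
  b, which makes the terms without a sign cancel in its derivative.\<close>

lemma C_k_cong:
  assumes "\<And>x. x \<in> S \<Longrightarrow> f x = g x" "C_k k S f"
  shows "C_k k S g"
proof (cases k)
  case 0
  then show ?thesis using assms by (simp cong: continuous_on_cong)
next
  case (Suc j)
  with assms(2) obtain f' where f': "\<forall>x\<in>S. (f has_derivative f' x) (at x within S)"
    "\<And>v. C_k j S (\<lambda>x. f' x v)" by auto
  have "\<forall>x\<in>S. (g has_derivative f' x) (at x within S)"
    using f'(1) assms(1) by (metis has_derivative_transform)
  then show ?thesis using f'(2) Suc by auto
qed

lemma C_k_SucD: "C_k (Suc k) S f \<Longrightarrow> C_k k S f"
proof (induction k arbitrary: f)
  case 0
  then show ?case by (auto intro: has_derivative_continuous_on)
next
  case (Suc k)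
  from Suc.prems obtain f' where f': "\<forall>x\<in>S. (f has_derivative f' x) (at x within S)"
    "\<And>v. C_k (Suc k) S (\<lambda>x. f' x v)" by auto
  from Suc.IH[OF f'(2)] f'(1) show ?case by auto
qed

lemma C_k_subset:
  assumes "C_k k S f" "T \<subseteq> S"
  shows "C_k k T f"
  using assms
proof (induction k arbitrary: f)
  case 0
  then show ?case by (auto intro: continuous_on_subset)
next
  case (Suc k)
  from Suc.prems obtain f' where f': "\<forall>x\<in>S. (f has_derivative f' x) (at x within S)"
    "\<And>v. C_k k S (\<lambda>x. f' x v)" by auto
  then have "\<forall>x\<in>T. (f has_derivative f' x) (at x within T)"
    using Suc.prems(2) by (meson has_derivative_subset subset_iff)
  moreover have "C_k k T (\<lambda>x. f' x v)" for v using Suc.IH[OF f'(2)] Suc.prems(2) .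
  ultimately show ?case by auto
qed

lemma C_k_const: "C_k k S (\<lambda>x. c)"
proof (induction k arbitrary: c)
  case (Suc k)
  have "\<forall>x\<in>S. ((\<lambda>x. c) has_derivative (\<lambda>v. 0)) (at x within S)" by auto
  then show ?case using Suc[of 0] by (auto intro!: exI[of _ "\<lambda>x v. 0"])
qed auto

lemma C_k_linear:
  assumes "bounded_linear L"
  shows "C_k k S L"
proof (cases k)
  case 0
  then show ?thesis using assms by (simp add: linear_continuous_on)
next
  case (Suc k)
  have "\<forall>x\<in>S. (L has_derivative L) (at x within S)"
    using assms by (simp add: bounded_linear_imp_has_derivative)
  then show ?thesis using Suc C_k_const by (auto intro!: exI[of _ "\<lambda>x. L"])
qed

lemma C_k_add:
  assumes "C_k k S f" "C_k k S g"
  shows "C_k k S (\<lambda>x. f x + g x)"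
  using assms
proof (induction k arbitrary: f g)
  case 0
  then show ?case by (auto intro: continuous_intros)
next
  case (Suc k)
  from Suc.prems obtain f' g' where f': "\<forall>x\<in>S. (f has_derivative f' x) (at x within S)"
    "\<And>v. C_k k S (\<lambda>x. f' x v)"
    and g': "\<forall>x\<in>S. (g has_derivative g' x) (at x within S)"
    "\<And>v. C_k k S (\<lambda>x. g' x v)" by auto
  have "\<forall>x\<in>S. ((\<lambda>x. f x + g x) has_derivative (\<lambda>v. f' x v + g' x v)) (at x within S)"
    using f'(1) g'(1) by (auto intro: has_derivative_add)
  then show ?case using Suc.IH[OF f'(2) g'(2)]
    by (auto intro!: exI[of _ "\<lambda>x v. f' x v + g' x v"])
qed

lemma C_k_linear_compose:
  assumes "bounded_linear L" "C_k k S f"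
  shows "C_k k S (\<lambda>x. L (f x))"
  using assms(2)
proof (induction k arbitrary: f)
  case 0
  then show ?case using assms(1) by (auto intro: bounded_linear.continuous_on)
next
  case (Suc k)
  from Suc.prems obtain f' where f': "\<forall>x\<in>S. (f has_derivative f' x) (at x within S)"
    "\<And>v. C_k k S (\<lambda>x. f' x v)" by auto
  have "\<forall>x\<in>S. ((\<lambda>x. L (f x)) has_derivative (\<lambda>v. L (f' x v))) (at x within S)"
    using f'(1) assms(1) by (auto intro: bounded_linear.has_derivative)
  then show ?case using Suc.IH[OF f'(2)]
    by (auto intro!: exI[of _ "\<lambda>x v. L (f' x v)"])
qed

lemma C_k_compose_linear:
  assumes "bounded_linear L" "L ` T \<subseteq> S" "C_k k S f"
  shows "C_k k T (\<lambda>x. f (L x))"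
  using assms(3)
proof (induction k arbitrary: f)
  case 0
  then have "continuous_on (L ` T) f" using assms(2) by (auto intro: continuous_on_subset)
  then show ?case using assms(1) by (auto intro: continuous_on_compose2 linear_continuous_on)
next
  case (Suc k)
  from Suc.prems obtain f' where f': "\<forall>x\<in>S. (f has_derivative f' x) (at x within S)"
    "\<And>v. C_k k S (\<lambda>x. f' x v)" by auto
  have "((\<lambda>x. f (L x)) has_derivative (\<lambda>v. f' (L x) (L v))) (at x within T)" if "x \<in> T" for x
  proof (rule has_derivative_in_compose[where g = f and f = L])
    show "(L has_derivative L) (at x within T)"
      using assms(1) by (simp add: bounded_linear_imp_has_derivative)
  qed (use f'(1) assms(2) that in \<open>auto intro: has_derivative_subset\<close>)
  then show ?case using Suc.IH[OF f'(2)]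
    by (auto intro!: exI[of _ "\<lambda>x v. f' (L x) (L v)"])
qed

lemma C_k_bilinear:
  assumes "bounded_bilinear B" "C_k k S f" "C_k k S g"
  shows "C_k k S (\<lambda>x. B (f x) (g x))"
  using assms(2,3)
proof (induction k arbitrary: f g)
  case 0
  then show ?case using assms(1) by (auto intro: bounded_bilinear.continuous_on)
next
  case (Suc k)
  from Suc.prems obtain f' g' where f': "\<forall>x\<in>S. (f has_derivative f' x) (at x within S)"
    "\<And>v. C_k k S (\<lambda>x. f' x v)"
    and g': "\<forall>x\<in>S. (g has_derivative g' x) (at x within S)"
    "\<And>v. C_k k S (\<lambda>x. g' x v)" by auto
  have "\<forall>x\<in>S. ((\<lambda>x. B (f x) (g x)) has_derivative
      (\<lambda>v. B (f x) (g' x v) + B (f' x v) (g x))) (at x within S)"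
    using f'(1) g'(1) assms(1) by (auto intro: bounded_bilinear.FDERIV)
  moreover have "C_k k S (\<lambda>x. B (f x) (g' x v) + B (f' x v) (g x))" for v
    by (intro C_k_add Suc.IH f'(2) g'(2) Suc.prems C_k_SucD)
  ultimately show ?case
    by (auto intro!: exI[of _ "\<lambda>x v. B (f x) (g' x v) + B (f' x v) (g x)"])
qed

lemma C_k_mult: "C_k k S f \<Longrightarrow> C_k k S g \<Longrightarrow> C_k k S (\<lambda>x. f x * g x :: 'a::real_normed_algebra)"
  by (rule C_k_bilinear[OF bounded_bilinear_mult])

lemma C_k_minus: "C_k k S f \<Longrightarrow> C_k k S (\<lambda>x. - f x)"
  by (rule C_k_linear_compose[OF bounded_linear_minus[OF bounded_linear_ident]])

lemma C_k_diff: "C_k k S f \<Longrightarrow> C_k k S g \<Longrightarrow> C_k k S (\<lambda>x. f x - g x)"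
  using C_k_add[OF _ C_k_minus, of k S f g] by simp

lemma C_k_Pair:
  assumes "C_k k S f" "C_k k S g"
  shows "C_k k S (\<lambda>x. (f x, g x))"
proof -
  have "C_k k S (\<lambda>x. (f x, 0) + (0, g x))"
    using assms
    by (intro C_k_add C_k_linear_compose[where L = "\<lambda>u. (u, 0)"] C_k_linear_compose[where L = "\<lambda>u. (0, u)"]
        bounded_linear_Pair bounded_linear_ident bounded_linear_zero)
  then show ?thesis by simp
qed

text \<open>On the line every directional derivative is a multiple of the one in direction 1, so the
  clause of \<open>C_k\<close> that quantifies over all directions reduces to a single derivative
  function.\<close>

lemma C_k_SucI_vector:
  assumes "\<And>x. x \<in> S \<Longrightarrow> (f has_vector_derivative f' x) (at x within S)" "C_k k S f'"
  shows "C_k (Suc k) S f"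
proof -
  have "C_k k S (\<lambda>x. v *\<^sub>R f' x)" for v
    by (rule C_k_linear_compose[OF bounded_linear_scaleR_right assms(2)])
  then show ?thesis using assms(1)
    by (auto simp: has_vector_derivative_def intro!: exI[of _ "\<lambda>x v. v *\<^sub>R f' x"])
qed

lemma C_k_SucE_vector:
  assumes "C_k (Suc k) S f"
  obtains f' where "\<And>x. x \<in> S \<Longrightarrow> (f has_vector_derivative f' x) (at x within S)" "C_k k S f'"
proof -
  from assms obtain f' where f': "\<forall>x\<in>S. (f has_derivative f' x) (at x within S)"
    "\<And>v. C_k k S (\<lambda>x. f' x v)" by auto
  have "(f has_vector_derivative f' x 1) (at x within S)" if "x \<in> S" for x
  proof -
    from f'(1) that have d: "(f has_derivative f' x) (at x within S)" by auto
    have "f' x v = v *\<^sub>R f' x 1" for v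
      using linear_scale[OF has_derivative_linear[OF d], of v 1] by simp
    then have "f' x = (\<lambda>v. v *\<^sub>R f' x 1)" by (rule ext)
    with d show ?thesis unfolding has_vector_derivative_def by metis
  qed
  then show ?thesis using f'(2) by (rule that)
qed

text \<open>Derivatives found on different neighbourhoods could a priori disagree; the first
  assumption makes the derivative within \<open>S\<close> unique, so they all coincide with
  \<open>vector_derivative\<close> and patch together.\<close>

lemma C_k_local:
  fixes S :: "real set"
  assumes "\<And>x. x \<in> S \<Longrightarrow> at x within S \<noteq> bot"
    and "\<And>x. x \<in> S \<Longrightarrow> \<exists>U. open U \<and> x \<in> U \<and> C_k k (S \<inter> U) f"
  shows "C_k k S f"
  using assms(2)
proof (induction k arbitrary: f)
  case 0
  have "continuous (at x within S) f" if x: "x \<in> S" for x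
  proof -
    from 0 x obtain U where U: "open U" "x \<in> U" "continuous_on (S \<inter> U) f" by force
    then have "continuous (at x within (S \<inter> U)) f" using x
      by (simp add: continuous_on_eq_continuous_within)
    moreover have "at x within (S \<inter> U) = at x within S"
      using U by (intro at_within_nhd[of x U]) auto
    ultimately show ?thesis by simp
  qed
  then show ?case by (simp add: continuous_on_eq_continuous_within)
next
  case (Suc k)
  define f' where "f' x = vector_derivative f (at x within S)" for x
  have *: "\<exists>U. open U \<and> x \<in> U \<and> C_k k (S \<inter> U) f' \<and> (f has_vector_derivative f' x) (at x within S)"
    if x: "x \<in> S" for x
  proof -
    obtain U where U: "open U" "x \<in> U" "C_k (Suc k) (S \<inter> U) f"
      using Suc.prems[OF x] by (elim exE conjE)
    obtain g where g: "\<And>y. y \<in> S \<inter> U \<Longrightarrow> (f has_vector_derivative g y) (at y within (S \<inter> U))"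
      "C_k k (S \<inter> U) g"
      by (rule C_k_SucE_vector[OF U(3)]) blast
    have d: "(f has_vector_derivative g y) (at y within S)" if y: "y \<in> S \<inter> U" for y
    proof -
      have "at y within (S \<inter> U) = at y within S"
        using U y by (intro at_within_nhd[of y U]) auto
      then show ?thesis using g(1)[OF y] by simp
    qed
    have e: "g y = f' y" if y: "y \<in> S \<inter> U" for y
      unfolding f'_def using d[OF y] assms(1) y by (metis IntE vector_derivative_within)
    have "C_k k (S \<inter> U) f'" by (rule C_k_cong[OF e g(2)])
    moreover have "(f has_vector_derivative f' x) (at x within S)"
      using d[of x] e[of x] x U(2) by simp
    ultimately show ?thesis using U(1,2) by blast
  qed
  show ?case
  proof (rule C_k_SucI_vector)
    show "(f has_vector_derivative f' x) (at x within S)" if "x \<in> S" for x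
      using *[OF that] by blast
    show "C_k k S f'"
      by (rule Suc.IH) (use * in blast)
  qed
qed

lemma C_k_eval_fps:
  fixes f :: "real fps"
  assumes "S \<subseteq> eball 0 r" "r \<le> fps_conv_radius f"
  shows "C_k k S (eval_fps f)"
  using assms(2)
proof (induction k arbitrary: f)
  case 0
  have "S \<subseteq> eball 0 (fps_conv_radius f)" using assms(1) 0 eball_mono by blast
  then show ?case using continuous_on_subset[OF continuous_on_eval_fps] by simp
next
  case (Suc k)
  have sub: "S \<subseteq> eball 0 (fps_conv_radius f)" using assms(1) Suc.prems eball_mono by blast
  show ?case
  proof (rule C_k_SucI_vector)
    show "C_k k S (eval_fps (fps_deriv f))"
      by (rule Suc.IH[OF order_trans[OF Suc.prems fps_conv_radius_deriv]])
    show "(eval_fps f has_vector_derivative eval_fps (fps_deriv f) x) (at x within S)" if "x \<in> S" for x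
      unfolding has_real_derivative_iff_has_vector_derivative[symmetric]
      using that sub by (intro has_field_derivative_eval_fps) (auto simp: subset_iff)
  qed
qed

lemma C_k_exp:
  fixes f :: "real \<Rightarrow> real"
  assumes "C_k k S f"
  shows "C_k k S (\<lambda>x. exp (f x))"
  using assms
proof (induction k)
  case 0
  then show ?case by (auto intro: continuous_intros)
next
  case (Suc k)
  from Suc.prems obtain f' where f': "\<And>x. x \<in> S \<Longrightarrow> (f has_vector_derivative f' x) (at x within S)"
    "C_k k S f'" by (rule C_k_SucE_vector) blast
  show ?case
  proof (rule C_k_SucI_vector)
    show "C_k k S (\<lambda>x. exp (f x) * f' x)"
      using Suc.IH[OF C_k_SucD[OF Suc.prems]] f'(2) by (rule C_k_mult)
    show "((\<lambda>x. exp (f x)) has_vector_derivative exp (f x) * f' x) (at x within S)" if "x \<in> S" for x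
      using f'(1)[OF that] unfolding has_real_derivative_iff_has_vector_derivative[symmetric]
      by (auto intro!: derivative_eq_intros)
  qed
qed

section \<open>Globally Lipschitz differential equations\<close>

lemma integral_has_vector_derivative_atLeast:
  fixes g :: "real \<Rightarrow> 'a::banach"
  assumes "continuous_on {a..} g" "a \<le> r"
  shows "((\<lambda>u. integral {a..u} g) has_vector_derivative g r) (at r within {a..})"
proof -
  have "((\<lambda>u. integral {a..u} g) has_vector_derivative g r) (at r within {a..r+1})"
    using assms by (intro integral_has_vector_derivative) (auto intro: continuous_on_subset)
  moreover have "at r within {a..r+1} = at r within {a..}"
    by (rule at_within_nhd[of r "{..<r+1}"]) auto
  ultimately show ?thesis by simp
qed

text \<open>Integrating the weight gains the factor 1/\<open>\<mu>\<close>, and this gain turns a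
  Lipschitz constant into a contraction constant.\<close>

lemma norm_integral_le_exp:
  fixes g :: "real \<Rightarrow> 'a::banach"
  assumes "continuous_on {0..r} g" "\<mu> > 0" "K \<ge> 0" "r \<ge> 0"
    and "\<And>t. t \<in> {0..r} \<Longrightarrow> norm (g t) \<le> K * exp (\<mu> * t)"
  shows "norm (integral {0..r} g) \<le> K / \<mu> * exp (\<mu> * r)"
proof -
  have i: "((\<lambda>t. K * exp (\<mu> * t)) has_integral (K / \<mu> * exp (\<mu> * r) - K / \<mu> * exp (\<mu> * 0))) {0..r}"
    using assms(2,4)
    by (intro fundamental_theorem_of_calculus)
      (auto simp: has_real_derivative_iff_has_vector_derivative[symmetric] intro!: derivative_eq_intros)
  have "norm (integral {0..r} g) \<le> integral {0..r} (\<lambda>t. K * exp (\<mu> * t))"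
    using assms i by (intro integral_norm_bound_integral)
      (auto intro: integrable_continuous_real)
  also have "\<dots> = K / \<mu> * exp (\<mu> * r) - K / \<mu>"
    using integral_unique[OF i] by simp
  also have "\<dots> \<le> K / \<mu> * exp (\<mu> * r)" using assms by simp
  finally show ?thesis .
qed

text \<open>
  The weight \<open>exp (- \<mu> t)\<close> with \<open>\<mu>\<close> larger than the Lipschitz constant makes the integral operator
  a contraction on the whole half-line.
\<close>

theorem lipschitz_ode_global:
  fixes f :: "'a::banach \<Rightarrow> 'a"
  assumes "L \<ge> 0" and L: "\<And>u v. norm (f u - f v) \<le> L * norm (u - v)"
  obtains u where "u 0 = x0" "\<And>s. s \<ge> 0 \<Longrightarrow> (u has_vector_derivative f (u s)) (at s within {0..})"
proof -
  \<comment> \<open>A weight of at least 2 L gives the contraction constant 1/2; the summand 1 keeps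
    \<open>\<mu>\<close> positive when L = 0.\<close>
  define \<mu> where "\<mu> = 2 * L + 1"
  have lam: "\<mu> > 0" "L / \<mu> \<le> 1 / 2" using \<open>L \<ge> 0\<close> by (auto simp: \<mu>_def field_simps)
  have cf: "continuous_on S f" for S
    using L \<open>L \<ge> 0\<close> by (intro lipschitz_on_continuous_on[of L] lipschitz_onI) (auto simp: dist_norm)
  \<comment> \<open>\<open>v\<close> stands for the solution divided by exp(\<open>\<mu>\<close> t).
    The weight is multiplied back before the field is applied, and \<open>I\<close> below is the
    Picard operator rewritten for \<open>v\<close>.\<close>
  define g where "g v t = f (exp (\<mu> * t) *\<^sub>R apply_bcontfun v t)" for v :: "real \<Rightarrow>\<^sub>C 'a" and t
  have cg: "continuous_on S (g v)" for S v
    unfolding g_def by (intro continuous_on_compose2[OF cf[of UNIV]] continuous_intros) auto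
  define I where "I v r = exp (- \<mu> * r) *\<^sub>R (x0 + integral {0..r} (g v))" for v r
  have dI: "((\<lambda>u. integral {0..u} (g v)) has_vector_derivative g v r) (at r within {0..})" if "r \<ge> 0" for v r
    by (rule integral_has_vector_derivative_atLeast) (use cg that in auto)
  then have "continuous_on {0..} (\<lambda>u. integral {0..u} (g v))" for v
    by (auto simp: continuous_on_eq_continuous_within intro: has_vector_derivative_continuous)
  then have cI: "continuous_on {0..} (I v)" for v
    unfolding I_def by (intro continuous_intros)
  have sc: "norm (exp (- \<mu> * r) *\<^sub>R w) \<le> K" if "norm w \<le> K * exp (\<mu> * r)" for K r and w :: 'a
  proof -
    have "norm w / exp (\<mu> * r) \<le> K" using that by (simp add: pos_divide_le_eq)
    then show ?thesis by (simp add: exp_minus divide_inverse mult.commute)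
  qed
  have bI: "norm (I v r) \<le> norm x0 + (norm (f 0) + L * dist v 0) / \<mu>" if "r \<ge> 0" for v r
  proof -
    have e: "norm (g v t) \<le> (norm (f 0) + L * dist v 0) * exp (\<mu> * t)" if "t \<in> {0..r}" for t
    proof -
      have "norm (g v t) \<le> norm (f 0) + norm (g v t - f 0)"
        using norm_triangle_sub[of "g v t" "f 0"] by simp
      also have "norm (g v t - f 0) \<le> L * (exp (\<mu> * t) * norm (apply_bcontfun v t))"
        unfolding g_def using L[of "exp (\<mu> * t) *\<^sub>R apply_bcontfun v t" 0] by simp
      also have "\<dots> \<le> L * (exp (\<mu> * t) * dist v 0)"
        using dist_bounded[of v t 0] \<open>L \<ge> 0\<close> by (intro mult_left_mono) (auto simp: dist_norm)
      also have "norm (f 0) \<le> norm (f 0) * exp (\<mu> * t)"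
        using that lam by (simp add: mult_le_cancel_left1)
      finally show ?thesis by (simp add: algebra_simps)
    qed
    have "norm (integral {0..r} (g v)) \<le> (norm (f 0) + L * dist v 0) / \<mu> * exp (\<mu> * r)"
      using that lam e \<open>L \<ge> 0\<close> cg by (intro norm_integral_le_exp) auto
    moreover have "norm x0 \<le> norm x0 * exp (\<mu> * r)"
      using that lam by (simp add: mult_le_cancel_left1)
    ultimately have "norm (x0 + integral {0..r} (g v)) \<le>
        (norm x0 + (norm (f 0) + L * dist v 0) / \<mu>) * exp (\<mu> * r)"
      using norm_triangle_ineq[of x0 "integral {0..r} (g v)"] by (simp add: ring_distribs)
    then show ?thesis unfolding I_def by (rule sc)
  qed
  \<comment> \<open>Bounded continuous functions live on the whole line, so the half-line operator
    is extended to negative times by its value at 0; the integrals only see t \<ge> 0.\<close>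
  define T where "T v = Bcontfun (\<lambda>s. I v (max 0 s))" for v
  have T: "apply_bcontfun (T v) s = I v (max 0 s)" for v s
  proof -
    have "bounded (range (\<lambda>s. I v (max 0 s)))"
      using bI[of _ v] by (intro boundedI[of _ "norm x0 + (norm (f 0) + L * dist v 0) / \<mu>"]) auto
    moreover have "continuous_on UNIV (\<lambda>s. I v (max 0 s))"
      by (auto intro!: continuous_on_compose2[OF cI] continuous_intros)
    ultimately have "(\<lambda>s. I v (max 0 s)) \<in> bcontfun" by (simp add: bcontfun_def)
    then show ?thesis unfolding T_def by (simp add: Bcontfun_inverse)
  qed
  have "dist (T v) (T w) \<le> 1 / 2 * dist v w" for v w
  proof (rule dist_bound)
    fix s :: real
    define r where "r = max 0 s"
    have r: "r \<ge> 0" by (simp add: r_def)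
    have "norm (integral {0..r} (\<lambda>t. g v t - g w t)) \<le> (L * dist v w) / \<mu> * exp (\<mu> * r)"
    proof (intro norm_integral_le_exp)
      show "norm (g v t - g w t) \<le> L * dist v w * exp (\<mu> * t)" for t
      proof -
        have "norm (g v t - g w t) \<le> L * (exp (\<mu> * t) * dist (apply_bcontfun v t) (apply_bcontfun w t))"
          unfolding g_def
          using L[of "exp (\<mu> * t) *\<^sub>R apply_bcontfun v t" "exp (\<mu> * t) *\<^sub>R apply_bcontfun w t"]
          by (simp add: dist_norm scaleR_diff_right[symmetric])
        also have "\<dots> \<le> L * (exp (\<mu> * t) * dist v w)"
          using \<open>L \<ge> 0\<close> by (intro mult_left_mono dist_bounded) auto
        finally show ?thesis by (simp add: algebra_simps)
      qed
    qed (use r lam \<open>L \<ge> 0\<close> cg in \<open>auto intro: continuous_on_diff\<close>)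
    moreover have "integral {0..r} (\<lambda>t. g v t - g w t) = integral {0..r} (g v) - integral {0..r} (g w)"
      using cg by (intro integral_diff integrable_continuous_real)
    ultimately have "norm (integral {0..r} (g v) - integral {0..r} (g w)) \<le> (L * dist v w) / \<mu> * exp (\<mu> * r)"
      by simp
    then have "dist (I v r) (I w r) \<le> L / \<mu> * dist v w"
      unfolding I_def dist_norm scaleR_diff_right[symmetric]
      by (intro sc) simp
    also have "\<dots> \<le> 1 / 2 * dist v w" using lam by (intro mult_right_mono) auto
    finally show "dist (apply_bcontfun (T v) s) (apply_bcontfun (T w) s) \<le> 1 / 2 * dist v w"
      unfolding T r_def .
  qed
  then have "\<exists>!v. T v = v" by (intro banach_fix_type[of "1/2"]) auto
  then obtain v where v: "T v = v" by auto
  define u where "u s = exp (\<mu> * s) *\<^sub>R apply_bcontfun v s" for s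
  have u: "u s = x0 + integral {0..s} (g v)" if "s \<ge> 0" for s
  proof -
    have "apply_bcontfun v s = I v s" using T[of v s] v that by simp
    then show ?thesis by (simp add: u_def I_def exp_minus)
  qed
  have "(u has_vector_derivative f (u s)) (at s within {0..})" if "s \<ge> 0" for s
  proof -
    have "((\<lambda>s. x0 + integral {0..s} (g v)) has_vector_derivative g v s) (at s within {0..})"
      using dI[OF that] by (auto intro!: derivative_eq_intros)
    moreover have "g v s = f (u s)" by (simp add: g_def u_def)
    ultimately show ?thesis using u that
      by (metis (no_types, lifting) atLeast_iff has_vector_derivative_transform)
  qed
  moreover have "u 0 = x0" using u[of 0] by simp
  ultimately show ?thesis using that by blast
qed

section \<open>The analytic branch at the cusp\<close>

text \<open>The functional sees the whole sequence, but its value at n depends only on entries below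
  n; hence the truncation built into \<open>wfrec\<close> does not change it.\<close>

lemma course_of_values_recursion:
  fixes G :: "(nat \<Rightarrow> 'a) \<Rightarrow> nat \<Rightarrow> 'a"
  assumes "\<And>f g n. (\<And>i. i < n \<Longrightarrow> f i = g i) \<Longrightarrow> G f n = G g n"
  shows "\<exists>c. \<forall>n. c n = G c n"
proof (intro exI allI)
  fix n
  show "wfrec less_than G n = G (wfrec less_than G) n"
    by (subst wfrec[OF wf_less_than]) (rule assms, simp add: cut_apply)
qed

text \<open>Cauchy product of two sequences with vanishing constant terms. The end terms i = 0 and i
  = n are left out, so that \<open>conv p q n\<close> involves only indices below n and can stand on
  the right of a recursion for the n-th coefficients.\<close>

definition conv :: "(nat \<Rightarrow> real) \<Rightarrow> (nat \<Rightarrow> real) \<Rightarrow> nat \<Rightarrow> real" where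
  "conv p q n = (\<Sum>i\<in>{1..<n}. p i * q (n - i))"

lemma conv_cong:
  "(\<And>i. i < n \<Longrightarrow> p i = p' i) \<Longrightarrow> (\<And>i. i < n \<Longrightarrow> q i = q' i) \<Longrightarrow> conv p q n = conv p' q' n"
  unfolding conv_def by (intro sum.cong) auto

text \<open>The number of summands costs a factor n, which the division by about n in the recursion
  will absorb.\<close>

lemma conv_bound:
  assumes "\<And>i. i < n \<Longrightarrow> \<bar>p i\<bar> \<le> A * R ^ i" "\<And>i. i < n \<Longrightarrow> \<bar>q i\<bar> \<le> A * R ^ i" "A \<ge> 0" "R \<ge> 0"
  shows "\<bar>conv p q n\<bar> \<le> real n * (A\<^sup>2 * R ^ n)"
proof -
  have "\<bar>conv p q n\<bar> \<le> (\<Sum>i\<in>{1..<n}. A\<^sup>2 * R ^ n)"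
    unfolding conv_def
  proof (rule order_trans[OF sum_abs sum_mono])
    fix i assume i: "i \<in> {1..<n}"
    then have "\<bar>p i * q (n - i)\<bar> \<le> (A * R ^ i) * (A * R ^ (n - i))"
      unfolding abs_mult using assms by (intro mult_mono) auto
    also have "\<dots> = A\<^sup>2 * (R ^ i * R ^ (n - i))" by (simp add: power2_eq_square)
    also have "R ^ i * R ^ (n - i) = R ^ n" using i by (simp flip: power_add)
    finally show "\<bar>p i * q (n - i)\<bar> \<le> A\<^sup>2 * R ^ n" .
  qed
  also have "\<dots> \<le> real n * (A\<^sup>2 * R ^ n)"
    using assms(3,4) by (simp add: mult_right_mono)
  finally show ?thesis .
qed

section \<open>Power series with a common lower bound for the radius of convergence\<close>

lemma fps_mult_nth_conv:
  assumes "p 0 = 0" "q 0 = 0"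
  shows "fps_nth (Abs_fps p * Abs_fps q) n = conv p q n"
proof -
  have "(\<Sum>i\<in>{0..n}. p i * q (n - i)) = (\<Sum>i\<in>{1..<n}. p i * q (n - i))"
    using assms by (intro sum.mono_neutral_right) (auto simp: Suc_le_eq intro: le_neq_implies_less)
  then show ?thesis by (simp add: fps_mult_nth conv_def)
qed

lemma fps_conv_radius_ge_geometric:
  fixes c :: "nat \<Rightarrow> real"
  assumes "\<And>n. \<bar>c n\<bar> \<le> A * R ^ n" "R > 0"
  shows "ereal (1 / R) \<le> fps_conv_radius (Abs_fps c)"
  unfolding fps_conv_radius_def
proof (rule conv_radius_geI_ex')
  fix r :: real assume r: "r > 0" "ereal r < ereal (1 / R)"
  then have "R * r < 1" using assms(2) by (simp add: field_simps)
  then have "summable (\<lambda>n. A * (R * r) ^ n)"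
    using r assms(2) by (intro summable_mult summable_geometric) auto
  then show "summable (\<lambda>n. fps_nth (Abs_fps c) n * of_real r ^ n)"
  proof (rule summable_comparison_test'[of _ 0])
    show "norm (fps_nth (Abs_fps c) n * of_real r ^ n) \<le> A * (R * r) ^ n" for n
      using assms(1)[of n] r
      by (simp add: abs_mult power_mult_distrib mult_right_mono flip: mult.assoc)
  qed
qed

definition fps_converges_upto :: "real \<Rightarrow> real fps \<Rightarrow> bool" where
  "fps_converges_upto \<rho> f \<longleftrightarrow> ereal \<rho> \<le> fps_conv_radius f"

lemma fps_converges_upto_intros:
  assumes "fps_converges_upto \<rho> f" "fps_converges_upto \<rho> g"
  shows "fps_converges_upto \<rho> (f + g)" "fps_converges_upto \<rho> (f - g)" "fps_converges_upto \<rho> (f * g)"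
    "fps_converges_upto \<rho> (- f)" "fps_converges_upto \<rho> (fps_deriv f)"
    "fps_converges_upto \<rho> (fps_const c)" "fps_converges_upto \<rho> fps_X"
proof -
  have *: "ereal \<rho> \<le> min (fps_conv_radius f) (fps_conv_radius g)"
    using assms by (simp add: fps_converges_upto_def)
  show "fps_converges_upto \<rho> (f + g)" "fps_converges_upto \<rho> (f - g)" "fps_converges_upto \<rho> (f * g)"
    unfolding fps_converges_upto_def
    by (rule order_trans[OF * fps_conv_radius_add] order_trans[OF * fps_conv_radius_diff]
        order_trans[OF * fps_conv_radius_mult])+
  show "fps_converges_upto \<rho> (fps_deriv f)"
    using assms(1) order_trans[OF _ fps_conv_radius_deriv] unfolding fps_converges_upto_def by blast
  show "fps_converges_upto \<rho> (- f)" "fps_converges_upto \<rho> (fps_const c)" "fps_converges_upto \<rho> fps_X"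
    using assms(1) by (simp_all add: fps_converges_upto_def)
qed

lemma eval_fps_upto:
  assumes "fps_converges_upto \<rho> f" "fps_converges_upto \<rho> g" "\<bar>s\<bar> < \<rho>"
  shows "eval_fps (f + g) s = eval_fps f s + eval_fps g s"
    "eval_fps (f - g) s = eval_fps f s - eval_fps g s"
    "eval_fps (f * g) s = eval_fps f s * eval_fps g s"
    "eval_fps (- f) s = - eval_fps f s"
    "DERIV (eval_fps f) s :> eval_fps (fps_deriv f) s"
proof -
  have "ereal (norm s) < fps_conv_radius f" "ereal (norm s) < fps_conv_radius g"
    using assms less_le_trans[of "ereal (norm s)" "ereal \<rho>"] by (auto simp: fps_converges_upto_def)
  then show "eval_fps (f + g) s = eval_fps f s + eval_fps g s"
    "eval_fps (f - g) s = eval_fps f s - eval_fps g s"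
    "eval_fps (f * g) s = eval_fps f s * eval_fps g s"
    "eval_fps (- f) s = - eval_fps f s"
    "DERIV (eval_fps f) s :> eval_fps (fps_deriv f) s"
    by (simp_all add: eval_fps_add eval_fps_diff eval_fps_mult eval_fps_minus has_field_derivative_eval_fps)
qed

text \<open>\<open>a\<close> and \<open>b\<close> stand for q - 1 and p - 1. The sign of
  \<open>h\<close> is left open so that the branch arriving at the cusp is covered by interpreting
  the locale at \<open>- h\<close>.\<close>

locale cone =
  fixes a b h :: real
  assumes a: "a \<ge> 1" and b: "b \<ge> 1"
begin

definition m :: real where "m = sqrt (b / a)"
definition C0 :: real where "C0 = sqrt (a / (a + b))"
definition S0 :: real where "S0 = sqrt (b / (a + b))"
text \<open>Insert x = C0 s - S0 k s^2/2, y = S0 s + C0 k s^2/2 and the velocity (C0 - S0 k s, S0 +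
  C0 k s) into h - a S/x + b C/y: the terms of order 1/s cancel, and the limit is h - (3/2)(a + b)
  k. Equating it with the curvature k gives this value.\<close>

definition k0 :: real where "k0 = 2 * h / (3 * (a + b) + 2)"

text \<open>\<open>m_sq\<close> means a S0/C0 = b C0/S0: the two singular curvature terms cancel
  exactly along this direction, so its half-line generates the minimal cone.\<close>

lemma m_pos: "m > 0" and m_sq: "a * m = b / m" and C0_pos: "C0 > 0" and S0_pos: "S0 > 0"
  and C0_sq: "C0\<^sup>2 = a / (a + b)" and S0_sq: "S0\<^sup>2 = b / (a + b)" and S0_eq: "S0 = m * C0"
  and C0_S0: "C0\<^sup>2 + S0\<^sup>2 = 1"
proof -
  show m: "m > 0" "C0 > 0" "S0 > 0" using a b by (auto simp: m_def C0_def S0_def)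
  have "m\<^sup>2 = b / a" using a b by (simp add: m_def)
  then show "a * m = b / m" using m a by (simp add: field_simps power2_eq_square)
  show C: "C0\<^sup>2 = a / (a + b)" and S: "S0\<^sup>2 = b / (a + b)" using a b by (simp_all add: C0_def S0_def)
  then show "C0\<^sup>2 + S0\<^sup>2 = 1" using a b by (simp flip: add_divide_distrib)
  have "S0\<^sup>2 = (m * C0)\<^sup>2"
    unfolding power_mult_distrib C S \<open>m\<^sup>2 = b / a\<close> using a b by (simp add: field_simps)
  then show "S0 = m * C0" using m by (simp add: power2_eq_iff_nonneg)
qed

text \<open>
  With \<open>M = s x' / x\<close>, \<open>U = s y' / x\<close>, \<open>V = s x' / y\<close>, \<open>N = s y' / y\<close> and \<open>K = s \<kappa>\<close>, the profile
  equation becomes the quadratic system \<open>s M' = M - M\<^sup>2 - U K\<close>, \<open>s U' = U - U M + M K\<close>,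
  \<open>s V' = V - V N - N K\<close>, \<open>s N' = N - N\<^sup>2 + V K\<close>, \<open>K = h s + b V - a U\<close>.  Below,
  \<open>e\<close>, \<open>u\<close>, \<open>v\<close>, \<open>w\<close> are the Taylor coefficients of the deviations of \<open>M\<close>, \<open>U\<close>, \<open>V\<close>, \<open>N\<close> from
  \<open>1\<close>, \<open>m\<close>, \<open>1 / m\<close>, \<open>1\<close>, and \<open>k\<close> those of \<open>K\<close>; eliminating the linear terms gives the
  formula for \<open>k\<close>.
\<close>

definition taylor_coefficients ::
    "(nat \<Rightarrow> real) \<Rightarrow> (nat \<Rightarrow> real) \<Rightarrow> (nat \<Rightarrow> real) \<Rightarrow> (nat \<Rightarrow> real) \<Rightarrow> (nat \<Rightarrow> real) \<Rightarrow> bool" where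
  "taylor_coefficients k e u v w \<longleftrightarrow> (\<forall>n.
     k n = (b * - (conv v w n + conv w k n) - a * (conv e k n - conv u e n)
        + (a * m * - (conv e e n + conv u k n) - b / m * (conv v k n - conv w w n)) / (real n + 1)
        + (if n = 1 then h else 0)) / (real n + (a + b) + (a + b) / (real n + 1)) \<and>
     e n = (- m * k n - (conv e e n + conv u k n)) / (real n + 1) \<and>
     w n = (k n / m + (conv v k n - conv w w n)) / (real n + 1) \<and>
     u n = (k n - m * e n + (conv e k n - conv u e n)) / real n \<and>
     v n = (- k n - w n / m - (conv v w n + conv w k n)) / real n)"

text \<open>The five sequences are packed into one sequence of quintuples. The n-th \<open>k\<close>
  uses only lower coefficients, through \<open>conv\<close>; the n-th \<open>e\<close> and
  \<open>w\<close> are then computed from it, and finally \<open>u\<close> and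
  \<open>v\<close>.\<close>

lemma taylor_coefficients_exist: "\<exists>k e u v w. taylor_coefficients k e u v w"
proof -
  define G where "G c n = (let k = (\<lambda>i. fst (c i)); e = (\<lambda>i. fst (snd (c i)));
      u = (\<lambda>i. fst (snd (snd (c i)))); v = (\<lambda>i. fst (snd (snd (snd (c i)))));
      w = (\<lambda>i. snd (snd (snd (snd (c i)))));
      k' = (b * - (conv v w n + conv w k n) - a * (conv e k n - conv u e n)
        + (a * m * - (conv e e n + conv u k n) - b / m * (conv v k n - conv w w n)) / (real n + 1)
        + (if n = 1 then h else 0)) / (real n + (a + b) + (a + b) / (real n + 1));
      e' = (- m * k' - (conv e e n + conv u k n)) / (real n + 1);
      w' = (k' / m + (conv v k n - conv w w n)) / (real n + 1);
      u' = (k' - m * e' + (conv e k n - conv u e n)) / real n;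
      v' = (- k' - w' / m - (conv v w n + conv w k n)) / real n
    in (k', e', u', v', w'))" for c :: "nat \<Rightarrow> real \<times> real \<times> real \<times> real \<times> real" and n
  have "G f n = G g n" if "\<And>i. i < n \<Longrightarrow> f i = g i" for f g n
  proof -
    have *: "conv (\<lambda>i. p (f i)) (\<lambda>i. q (f i)) n = conv (\<lambda>i. p (g i)) (\<lambda>i. q (g i)) n"
      for p q :: "real \<times> real \<times> real \<times> real \<times> real \<Rightarrow> real"
      using that by (intro conv_cong) auto
    show ?thesis unfolding G_def Let_def
      by (simp only: *[of "\<lambda>z. fst (snd (snd (snd z)))" "\<lambda>z. snd (snd (snd (snd z)))"]
        *[of "\<lambda>z. snd (snd (snd (snd z)))" fst] *[of "\<lambda>z. fst (snd z)" fst]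
        *[of "\<lambda>z. fst (snd (snd z))" "\<lambda>z. fst (snd z)"] *[of "\<lambda>z. fst (snd z)" "\<lambda>z. fst (snd z)"]
        *[of "\<lambda>z. fst (snd (snd z))" fst] *[of "\<lambda>z. fst (snd (snd (snd z)))" fst]
        *[of "\<lambda>z. snd (snd (snd (snd z)))" "\<lambda>z. snd (snd (snd (snd z)))"])
  qed
  then have "\<exists>c. \<forall>n. c n = G c n" by (rule course_of_values_recursion)
  then obtain c where c: "\<And>n. c n = G c n" by blast
  define k e u v w where d: "k = (\<lambda>i. fst (c i))" "e = (\<lambda>i. fst (snd (c i)))"
    "u = (\<lambda>i. fst (snd (snd (c i))))" "v = (\<lambda>i. fst (snd (snd (snd (c i)))))"
    "w = (\<lambda>i. snd (snd (snd (snd (c i)))))"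
  have e: "(k n, e n, u n, v n, w n) = G c n" for n
    unfolding c[of n, symmetric] by (simp add: d)
  note e = e[unfolded G_def Let_def, folded d, unfolded prod.inject]
  have "taylor_coefficients k e u v w"
    unfolding taylor_coefficients_def by (intro allI conjI; use e in \<open>simp only:\<close>)
  then show ?thesis by blast
qed

text \<open>Majorant argument with the bound A R^n. The recursion is quadratic, so it reproduces the
  bound with an extra factor K A, and A = 1/K closes the induction. The inhomogeneous term h occurs
  only at n = 1, where a large R pays for it.\<close>

lemma taylor_coefficients_bound:
  assumes T: "taylor_coefficients k e u v w"
  obtains A R where "R > 0" "\<And>n. \<bar>k n\<bar> \<le> A * R ^ n" "\<And>n. \<bar>e n\<bar> \<le> A * R ^ n"
    "\<And>n. \<bar>u n\<bar> \<le> A * R ^ n" "\<And>n. \<bar>v n\<bar> \<le> A * R ^ n" "\<And>n. \<bar>w n\<bar> \<le> A * R ^ n"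
proof -
  note T = T[unfolded taylor_coefficients_def, rule_format]
  note k = T[THEN conjunct1] and mu = T[THEN conjunct2, THEN conjunct1]
    and nu = T[THEN conjunct2, THEN conjunct2, THEN conjunct1]
    and up = T[THEN conjunct2, THEN conjunct2, THEN conjunct2, THEN conjunct1]
    and v = T[THEN conjunct2, THEN conjunct2, THEN conjunct2, THEN conjunct2]
  \<comment> \<open>\<open>K1\<close> to \<open>K5\<close> follow the recursion formulas: if each of
    the four quadratic expressions is at most 2 n A^2 R^n, then the n-th terms of \<open>k\<close>,
    \<open>e\<close>, \<open>w\<close>, \<open>u\<close>, \<open>v\<close> are at most A^2 R^n times
    \<open>K1\<close>, \<open>K2\<close>, \<open>K3\<close>, \<open>K4\<close>,
    \<open>K5\<close>.\<close>
  define K1 where "K1 = 2 * (a + b + a * m + b / m)"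
  define K2 where "K2 = m * K1 + 2"
  define K3 where "K3 = K1 / m + 2"
  define K4 where "K4 = K1 + m * K2 + 2"
  define K5 where "K5 = K1 + K3 / m + 2"
  define K where "K = K1 + K2 + K3 + K4 + K5"
  have K1: "K1 \<ge> 0" unfolding K1_def using a b m_pos by auto
  have K2: "K2 \<ge> 2" unfolding K2_def using K1 m_pos by auto
  have K3: "K3 \<ge> 2" unfolding K3_def using K1 m_pos by auto
  have K4: "K4 \<ge> 2" unfolding K4_def using K1 K2 m_pos by auto
  have K5: "K5 \<ge> 2" unfolding K5_def using K1 K3 m_pos by auto
  have Kpos: "K > 0" using K1 K2 K3 K4 K5 by (simp add: K_def)
  define A where "A = 1 / K"
  define R where "R = 1 + K * (\<bar>k 1\<bar> + \<bar>e 1\<bar> + \<bar>u 1\<bar> + \<bar>v 1\<bar> + \<bar>w 1\<bar>)"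
  have A: "A > 0" using Kpos by (simp add: A_def)
  have R: "R > 0" using Kpos unfolding R_def by (intro add_pos_nonneg mult_nonneg_nonneg) auto
  have AR: "A * R = 1 / K + (\<bar>k 1\<bar> + \<bar>e 1\<bar> + \<bar>u 1\<bar> + \<bar>v 1\<bar> + \<bar>w 1\<bar>)"
    using Kpos by (simp add: A_def R_def field_simps)
  have "\<bar>k n\<bar> \<le> A * R ^ n \<and> \<bar>e n\<bar> \<le> A * R ^ n \<and> \<bar>u n\<bar> \<le> A * R ^ n \<and> \<bar>v n\<bar> \<le> A * R ^ n
      \<and> \<bar>w n\<bar> \<le> A * R ^ n" for n
  proof (induction n rule: less_induct)
    case (less n)
    consider "n = 0" | "n = 1" | "n \<ge> 2" by linarith
    then show ?case
    proof cases
      case 1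
      have c: "conv p q 0 = 0" for p q by (simp add: conv_def)
      have k0: "k 0 = 0" unfolding k[of 0] c by simp
      have mu0: "e 0 = 0" unfolding mu[of 0] c k0 by simp
      have nu0: "w 0 = 0" unfolding nu[of 0] c k0 by simp
      \<comment> \<open>Division by \<open>real 0\<close> yields 0, which is the constant term
        wanted for a deviation.\<close>
      have up0: "u 0 = 0" unfolding up[of 0] by simp
      have v0: "v 0 = 0" unfolding v[of 0] by simp
      show ?thesis using A by (simp add: 1 k0 mu0 nu0 up0 v0)
    next
      case 2
      have "1 / K > 0" using Kpos by simp
      then show ?thesis using AR unfolding 2 power_one_right by linarith
    next
      case 3
      define T where "T = A\<^sup>2 * R ^ n"
      have T: "T \<ge> 0" using R by (simp add: T_def)
      have KT: "x * T \<le> A * R ^ n" if "x \<le> K" for x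
      proof -
        have "x * T \<le> K * T" using that T by (rule mult_right_mono)
        also have "\<dots> = A * R ^ n" using Kpos by (simp add: T_def A_def power2_eq_square)
        finally show ?thesis .
      qed
      have cb: "\<bar>conv p q n\<bar> \<le> real n * T"
        if "\<And>i. i < n \<Longrightarrow> \<bar>p i\<bar> \<le> A * R ^ i" "\<And>i. i < n \<Longrightarrow> \<bar>q i\<bar> \<le> A * R ^ i" for p q
        unfolding T_def using that A R by (intro conv_bound) auto
      have r1: "\<bar>conv e e n + conv u k n\<bar> \<le> 2 * (real n * T)"
        using cb[of e e] cb[of u k] less by auto
      have r2: "\<bar>conv e k n - conv u e n\<bar> \<le> 2 * (real n * T)"
        using cb[of e k] cb[of u e] less by auto
      have r3: "\<bar>conv v w n + conv w k n\<bar> \<le> 2 * (real n * T)"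
        using cb[of v w] cb[of w k] less by auto
      have r4: "\<bar>conv v k n - conv w w n\<bar> \<le> 2 * (real n * T)"
        using cb[of v k] cb[of w w] less by auto
      have div: "\<bar>x / d\<bar> \<le> c * T" if "\<bar>x\<bar> \<le> real n * (c * T)" "d \<ge> real n" for x c d
      proof -
        have "real n * \<bar>x / d\<bar> \<le> d * \<bar>x / d\<bar>" using that(2) by (intro mult_right_mono) auto
        also have "d * \<bar>x / d\<bar> = \<bar>x\<bar>" using that(2) 3 by (simp add: abs_divide)
        also have "\<dots> \<le> real n * (c * T)" by (rule that(1))
        finally have "real n * \<bar>x / d\<bar> \<le> real n * (c * T)" .
        then show ?thesis using 3 by (simp only: mult_le_cancel_left_pos)
      qed
      have mulb: "\<bar>c * x\<bar> \<le> c * y" if "\<bar>x\<bar> \<le> y" "c \<ge> 0" for c x y :: real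
        using that by (simp add: abs_mult mult_left_mono)
      have leN: "\<bar>x / (real n + 1)\<bar> \<le> \<bar>x\<bar>" for x
        by (simp add: abs_divide divide_le_eq mult_le_cancel_left1)
      have kb: "\<bar>k n\<bar> \<le> K1 * T"
      proof -
        have sum_le: "\<bar>b * - x - a * y + z + w\<bar> \<le> B"
          if "\<bar>z\<bar> \<le> Z" "\<bar>b * x\<bar> \<le> X" "\<bar>a * y\<bar> \<le> Y" "X + Y + Z = B" "w = 0"
          for x y z w X Y Z B :: real
          using that by (simp only: mult_minus_right)
        have "\<bar>(a * m * - (conv e e n + conv u k n) - b / m * (conv v k n - conv w w n)) / (real n + 1)\<bar>
          \<le> (a * m) * (2 * (real n * T)) + (b / m) * (2 * (real n * T))"
        proof (rule order_trans[OF leN])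
          have "\<bar>a * m * (conv e e n + conv u k n)\<bar> \<le> (a * m) * (2 * (real n * T))"
            "\<bar>b / m * (conv v k n - conv w w n)\<bar> \<le> (b / m) * (2 * (real n * T))"
            using a b m_pos mulb[OF r1, of "a * m"] mulb[OF r4, of "b / m"] by simp_all
          then show "\<bar>a * m * - (conv e e n + conv u k n) - b / m * (conv v k n - conv w w n)\<bar>
            \<le> (a * m) * (2 * (real n * T)) + (b / m) * (2 * (real n * T))"
            by (simp only: mult_minus_right)
        qed
        moreover have "\<bar>b * (conv v w n + conv w k n)\<bar> \<le> b * (2 * (real n * T))"
          "\<bar>a * (conv e k n - conv u e n)\<bar> \<le> a * (2 * (real n * T))"
          using a b mulb[OF r3] mulb[OF r2] by auto
        moreover have "b * (2 * (real n * T)) + a * (2 * (real n * T)) + ((a * m) * (2 * (real n * T))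
            + (b / m) * (2 * (real n * T))) = real n * (K1 * T)"
          by (simp add: K1_def algebra_simps)
        ultimately have "\<bar>b * - (conv v w n + conv w k n) - a * (conv e k n - conv u e n)
          + (a * m * - (conv e e n + conv u k n) - b / m * (conv v k n - conv w w n)) / (real n + 1)
          + (if n = 1 then h else 0)\<bar> \<le> real n * (K1 * T)"
          using 3 by (intro sum_le) (assumption | simp)+
        then show ?thesis
          unfolding k[of n] by (rule div) (use a b in simp)
      qed
      have kb': "\<bar>k n\<bar> \<le> real n * (K1 * T)"
        using kb K1 T 3 mult_right_mono[of 1 "real n" "K1 * T"] by simp
      have lift: "\<bar>x\<bar> \<le> real n * (c * T)" if "\<bar>x\<bar> \<le> c * T" for x c
        using that 3 mult_right_mono[of 1 "real n" "c * T"] abs_ge_zero[of x] by simp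
      have div2: "\<bar>(x + z) / d\<bar> \<le> (c + 2) * T" "\<bar>(x - z) / d\<bar> \<le> (c + 2) * T"
        if "\<bar>x\<bar> \<le> real n * (c * T)" "\<bar>z\<bar> \<le> 2 * (real n * T)" "d \<ge> real n" for x z c d
      proof -
        have "real n * ((c + 2) * T) = real n * (c * T) + 2 * (real n * T)" by (simp add: algebra_simps)
        then have "\<bar>x + z\<bar> \<le> real n * ((c + 2) * T)" "\<bar>x - z\<bar> \<le> real n * ((c + 2) * T)"
          using that(1,2) by linarith+
        then show "\<bar>(x + z) / d\<bar> \<le> (c + 2) * T" "\<bar>(x - z) / d\<bar> \<le> (c + 2) * T"
          using div that(3) by blast+
      qed
      have add: "\<bar>x - y\<bar> \<le> real n * ((c + c') * T)"
        if "\<bar>x\<bar> \<le> real n * (c * T)" "\<bar>y\<bar> \<le> real n * (c' * T)" for x y c c'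
        using that by (simp add: ring_distribs)
      have mulm: "\<bar>m * x\<bar> \<le> real n * (m * c * T)" "\<bar>x / m\<bar> \<le> real n * (c / m * T)"
        if "\<bar>x\<bar> \<le> real n * (c * T)" for x c
        using mulb[OF that, of m] mulb[OF that, of "1 / m"] m_pos by (simp_all add: mult_ac)
      have mub: "\<bar>e n\<bar> \<le> K2 * T"
        unfolding mu[of n] K2_def by (intro div2 r1) (use mulm(1)[OF kb'] in simp_all)
      have nub: "\<bar>w n\<bar> \<le> K3 * T"
        unfolding nu[of n] K3_def by (intro div2 r4 mulm(2) kb') simp
      have upb: "\<bar>u n\<bar> \<le> K4 * T"
        unfolding up[of n] K4_def by (intro div2 r2 add mulm(1) kb' lift[OF mub]) simp
      have vb: "\<bar>v n\<bar> \<le> K5 * T"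
        unfolding v[of n] K5_def by (intro div2 r3 add mulm(2) lift[OF nub]) (use kb' in simp_all)
      have "K1 \<le> K" "K2 \<le> K" "K3 \<le> K" "K4 \<le> K" "K5 \<le> K"
        using K1 K2 K3 K4 K5 by (auto simp: K_def)
      then show ?thesis using kb mub upb vb nub KT by (meson order_trans)
    qed
  qed
  then show ?thesis using R that by blast
qed


text \<open>The bracket is the curvature, obtained by solving the profile equation for it. Keeping
  the velocity as a separate unit vector (C, S) gives a first-order system without the choice of an
  angle.\<close>

definition branch_on :: "real set \<Rightarrow> (real \<Rightarrow> real) \<Rightarrow> (real \<Rightarrow> real) \<Rightarrow> (real \<Rightarrow> real) \<Rightarrow> (real \<Rightarrow> real) \<Rightarrow> bool" where
  "branch_on I x y C S \<longleftrightarrow> (\<forall>s\<in>I. x s > 0 \<and> y s > 0 \<and> (C s)\<^sup>2 + (S s)\<^sup>2 = 1 \<and>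
     (DERIV x s :> C s) \<and> (DERIV y s :> S s) \<and>
     (DERIV C s :> - S s * (h - a * S s / x s + b * C s / y s)) \<and>
     (DERIV S s :> C s * (h - a * S s / x s + b * C s / y s)))"

text \<open>\<open>Fp\<close> and \<open>Fq\<close> will be the logarithms of x/(s C0) and y/(s S0):
  s times the derivative of ln (x/s) is s x'/x - 1, which is why their coefficients are those of
  \<open>Fm\<close> and \<open>Fn\<close> divided by n.\<close>

lemma power_series_solution:
  obtains r and Fk Fm Fu Fv Fn Fp Fq :: "real fps" where "r > 0"
    "fps_converges_upto r Fk" "fps_converges_upto r Fm" "fps_converges_upto r Fu"
    "fps_converges_upto r Fv" "fps_converges_upto r Fn"
    "fps_converges_upto r Fp" "fps_converges_upto r Fq"
    "fps_nth Fp 0 = 0" "fps_nth Fq 0 = 0" "fps_nth Fp 1 = - m * k0 / 2" "fps_nth Fq 1 = fps_nth Fn 1"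
    "fps_X * fps_deriv Fp = Fm" "fps_X * fps_deriv Fq = Fn"
    "fps_nth Fk 0 = 0" "fps_nth Fm 0 = 0" "fps_nth Fu 0 = 0" "fps_nth Fv 0 = 0" "fps_nth Fn 0 = 0"
    "fps_nth Fk 1 = k0" "fps_nth Fm 1 = - m * k0 / 2" "fps_nth Fn 1 = k0 / m / 2"
    "fps_X * fps_deriv Fm = - Fm - Fm * Fm - (fps_const m + Fu) * Fk"
    "fps_X * fps_deriv Fn = - Fn - Fn * Fn + (fps_const (1 / m) + Fv) * Fk"
    "fps_X * fps_deriv Fu = Fk + Fm * Fk - (fps_const m + Fu) * Fm"
    "fps_X * fps_deriv Fv = - Fk - Fn * Fk - (fps_const (1 / m) + Fv) * Fn"
    "Fk = fps_const h * fps_X + fps_const b * Fv - fps_const a * Fu"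
proof -
  obtain k e u v w where T: "taylor_coefficients k e u v w" using taylor_coefficients_exist by blast
  obtain A R where R: "R > 0" and bounds: "\<And>n. \<bar>k n\<bar> \<le> A * R ^ n" "\<And>n. \<bar>e n\<bar> \<le> A * R ^ n"
    "\<And>n. \<bar>u n\<bar> \<le> A * R ^ n" "\<And>n. \<bar>v n\<bar> \<le> A * R ^ n" "\<And>n. \<bar>w n\<bar> \<le> A * R ^ n"
    by (rule taylor_coefficients_bound[OF T]) (rule that)
  note T = T[unfolded taylor_coefficients_def, rule_format]
  note k = T[THEN conjunct1] and mu = T[THEN conjunct2, THEN conjunct1]
    and nu = T[THEN conjunct2, THEN conjunct2, THEN conjunct1]
    and up = T[THEN conjunct2, THEN conjunct2, THEN conjunct2, THEN conjunct1]
    and v = T[THEN conjunct2, THEN conjunct2, THEN conjunct2, THEN conjunct2]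
  have c: "conv p q 0 = 0" "conv p q 1 = 0" for p q by (simp_all add: conv_def)
  have z: "k 0 = 0" "e 0 = 0" "w 0 = 0" "u 0 = 0" "v 0 = 0"
  proof -
    show k0: "k 0 = 0" unfolding k[of 0] c by simp
    show "e 0 = 0" "w 0 = 0" unfolding mu[of 0] nu[of 0] c k0 by simp_all
    show "u 0 = 0" "v 0 = 0" unfolding up[of 0] v[of 0] by simp_all
  qed
  have k1: "k 1 = k0"
    unfolding k[of 1] c k0_def using a b by (simp add: field_simps)
  have mu1: "e 1 = - m * k0 / 2"
    unfolding mu[of 1] c k1 by simp
  have nu1: "w 1 = k0 / m / 2"
    unfolding nu[of 1] c k1 by simp
  have bd: "\<bar>p n / real n\<bar> \<le> A * R ^ n" if "\<And>n. \<bar>p n\<bar> \<le> A * R ^ n" for p n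
  proof (rule order_trans[OF _ that])
    show "\<bar>p n / real n\<bar> \<le> \<bar>p n\<bar>"
      by (cases "n = 0") (simp_all add: abs_divide divide_le_eq mult_le_cancel_left1)
  qed
  have Xd: "fps_nth (fps_X * fps_deriv (Abs_fps p)) n = real n * p n" for p :: "nat \<Rightarrow> real" and n
    by (cases n) auto
  note conv = fps_mult_nth_conv[of e e, unfolded z, OF refl refl]
    fps_mult_nth_conv[of u k, unfolded z, OF refl refl]
    fps_mult_nth_conv[of w w, unfolded z, OF refl refl]
    fps_mult_nth_conv[of v k, unfolded z, OF refl refl]
    fps_mult_nth_conv[of e k, unfolded z, OF refl refl]
    fps_mult_nth_conv[of u e, unfolded z, OF refl refl]
    fps_mult_nth_conv[of w k, unfolded z, OF refl refl]
    fps_mult_nth_conv[of v w, unfolded z, OF refl refl]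
  have sd: "real n * x = y - x" if "x = y / (real n + 1)" for n x y
  proof -
    have "x * (real n + 1) = y" unfolding that by (rule nonzero_eq_divide_eq[THEN iffD1]) simp_all
    then show ?thesis by (simp add: algebra_simps)
  qed
  have mu': "real n * e n = - e n - m * k n - (conv e e n + conv u k n)" for n
    using sd[OF mu[of n]] by simp
  have nu': "real n * w n = - w n + k n / m + (conv v k n - conv w w n)" for n
    using sd[OF nu[of n]] by simp
  have up': "real n * u n = k n - m * e n + (conv e k n - conv u e n)" for n
    using up[of n] by (cases "n = 0") (simp_all add: z c)
  have v': "real n * v n = - k n - w n / m - (conv v w n + conv w k n)" for n
    using v[of n] by (cases "n = 0") (simp_all add: z c)
  \<comment> \<open>The recursion for \<open>k\<close> came from eliminating the other unknowns;
    here the elimination is undone, so that \<open>k\<close> really is the coefficient sequence of h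
    s + b V - a U.\<close>
  have kv: "k n = (if n = 1 then h else 0) + b * v n - a * u n" for n
  proof (cases "n = 0")
    case False
    define r1 r2 r3 r4 d where "r1 = conv e e n + conv u k n" "r2 = conv e k n - conv u e n"
      "r3 = conv v w n + conv w k n" "r4 = conv v k n - conv w w n" "d = (if n = 1 then h else 0)"
    note r = this
    have n: "real n + (a + b) + (a + b) / (real n + 1) > 0"
      using a b False by (intro add_pos_nonneg) auto
    have "k n * (real n + (a + b) + (a + b) / (real n + 1)) =
        b * - r3 - a * r2 + (a * m * - r1 - b / m * r4) / (real n + 1) + d"
      using k[of n] n unfolding r[symmetric] by (simp only: eq_divide_eq)
    moreover have "(a * m * - r1 - b / m * r4) / (real n + 1) - k n * ((a + b) / (real n + 1)) =
        (- a * m * r1 - b / m * r4 - (a + b) * k n) / (real n + 1)"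
      by (simp add: diff_divide_distrib[symmetric] mult.commute)
    ultimately have e: "real n * k n = - b * r3 - a * r2 - (a + b) * k n
        + (- a * m * r1 - b / m * r4 - (a + b) * k n) / (real n + 1) + d"
      by (simp add: ring_distribs) (simp add: mult.commute)
    have mm: "a * m * m = b" "b / m / m = a" using m_sq m_pos by (simp_all add: field_simps)
    have f: "(- a * m * r1 - b / m * r4 - (a + b) * k n) / (real n + 1) = a * m * e n - b / m * w n"
    proof -
      have e12: "a * m * (- m * k n - r1) = - (a * m * m) * k n - a * m * r1"
        "b / m * (k n / m + r4) = (b / m / m) * k n + b / m * r4"
        by (simp_all add: algebra_simps)
      have "a * m * (- m * k n - r1) - b / m * (k n / m + r4) = - a * m * r1 - b / m * r4 - (a + b) * k n"
        unfolding e12 mm by (simp add: algebra_simps)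
      moreover have "a * m * e n - b / m * w n = (a * m * (- m * k n - r1) - b / m * (k n / m + r4)) / (real n + 1)"
        unfolding mu[of n] nu[of n] r[symmetric] by (simp add: diff_divide_distrib right_diff_distrib)
      ultimately show ?thesis by simp
    qed
    \<comment> \<open>The inhomogeneous term lives at n = 1 only, so multiplying by n leaves it
      unchanged.\<close>
    have nd: "real n * d = d" by (simp add: r)
    have g: "real n * (b * v n - a * u n) = b * (- k n - w n / m - r3) - a * (k n - m * e n + r2)"
    proof -
      have "real n * (b * v n - a * u n) = b * (real n * v n) - a * (real n * u n)"
        by (simp add: algebra_simps)
      then show ?thesis unfolding up'[of n] v'[of n] r[symmetric] .
    qed
    have "real n * (d + b * v n - a * u n) = real n * d + real n * (b * v n - a * u n)"
      by (simp add: algebra_simps)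
    also have "\<dots> = real n * k n"
      unfolding nd g e f by (simp add: algebra_simps)
    finally have "d + b * v n - a * u n = k n" using False by simp
    then show ?thesis by (simp add: r)
  qed (simp add: z)
  show ?thesis
  proof (rule that[of "1 / R" "Abs_fps k" "Abs_fps e" "Abs_fps u" "Abs_fps v" "Abs_fps w"
        "Abs_fps (\<lambda>n. e n / real n)" "Abs_fps (\<lambda>n. w n / real n)"])
    show "fps_converges_upto (1 / R) (Abs_fps k)" "fps_converges_upto (1 / R) (Abs_fps e)"
      "fps_converges_upto (1 / R) (Abs_fps u)" "fps_converges_upto (1 / R) (Abs_fps v)"
      "fps_converges_upto (1 / R) (Abs_fps w)" "fps_converges_upto (1 / R) (Abs_fps (\<lambda>n. e n / real n))"
      "fps_converges_upto (1 / R) (Abs_fps (\<lambda>n. w n / real n))"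
      unfolding fps_converges_upto_def by (rule fps_conv_radius_ge_geometric[OF _ R], rule bounds bd[OF bounds(2)] bd[OF bounds(5)])+
    show "fps_X * fps_deriv (Abs_fps (\<lambda>n. e n / real n)) = Abs_fps e"
      "fps_X * fps_deriv (Abs_fps (\<lambda>n. w n / real n)) = Abs_fps w"
      unfolding fps_eq_iff Xd using z by (auto simp: mult.commute[of "real _"])
    show "fps_X * fps_deriv (Abs_fps e) = - Abs_fps e - Abs_fps e * Abs_fps e - (fps_const m + Abs_fps u) * Abs_fps k"
      "fps_X * fps_deriv (Abs_fps w) = - Abs_fps w - Abs_fps w * Abs_fps w + (fps_const (1 / m) + Abs_fps v) * Abs_fps k"
      "fps_X * fps_deriv (Abs_fps u) = Abs_fps k + Abs_fps e * Abs_fps k - (fps_const m + Abs_fps u) * Abs_fps e"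
      "fps_X * fps_deriv (Abs_fps v) = - Abs_fps k - Abs_fps w * Abs_fps k - (fps_const (1 / m) + Abs_fps v) * Abs_fps w"
      unfolding fps_eq_iff Xd
      by (simp_all only: fps_nth_Abs_fps mu' nu' up' v' ring_distribs fps_sub_nth fps_add_nth fps_neg_nth
          fps_mult_left_const_nth conv) simp_all
    show "Abs_fps k = fps_const h * fps_X + fps_const b * Abs_fps v - fps_const a * Abs_fps u"
      by (rule fps_ext) (simp add: kv fps_X_def)
  qed (use R z k1 mu1 nu1 in auto)
qed

text \<open>The quadratic system treats s y'/x and s x'/y as independent of s x'/x and s y'/y, so
  its solution yields two candidates for each velocity component: \<open>C\<close> and
  \<open>C2\<close>, \<open>S\<close> and \<open>S2\<close>. Their agreement has to be proved before
  the curve equation can be read off.\<close>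

theorem analytic_branch:
  obtains r x y C S where "r > 0" "branch_on {0<..<r} x y C S" "x 0 = 0" "y 0 = 0" "C 0 = C0" "S 0 = S0"
    "\<And>s. \<bar>s\<bar> < r \<Longrightarrow> (DERIV x s :> C s)"
    "\<And>s. \<bar>s\<bar> < r \<Longrightarrow> (DERIV y s :> S s)"
    "DERIV C 0 :> - S0 * k0" "DERIV S 0 :> C0 * k0"
    "\<And>k. C_k k {-r<..<r} x" "\<And>k. C_k k {-r<..<r} y"
proof -
  obtain r and Fk Fm Fu Fv Fn Fp Fq :: "real fps" where r: "r > 0"
    and conv: "fps_converges_upto r Fk" "fps_converges_upto r Fm" "fps_converges_upto r Fu"
    "fps_converges_upto r Fv" "fps_converges_upto r Fn" "fps_converges_upto r Fp" "fps_converges_upto r Fq"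
    and p: "fps_nth Fp 0 = 0" "fps_nth Fq 0 = 0" "fps_nth Fp 1 = - m * k0 / 2" "fps_nth Fq 1 = fps_nth Fn 1"
    "fps_X * fps_deriv Fp = Fm" "fps_X * fps_deriv Fq = Fn"
    and n0: "fps_nth Fk 0 = 0" "fps_nth Fm 0 = 0" "fps_nth Fu 0 = 0" "fps_nth Fv 0 = 0" "fps_nth Fn 0 = 0"
    and n1: "fps_nth Fk 1 = k0" "fps_nth Fm 1 = - m * k0 / 2" "fps_nth Fn 1 = k0 / m / 2"
    and eqs: "fps_X * fps_deriv Fm = - Fm - Fm * Fm - (fps_const m + Fu) * Fk"
    "fps_X * fps_deriv Fn = - Fn - Fn * Fn + (fps_const (1 / m) + Fv) * Fk"
    "fps_X * fps_deriv Fu = Fk + Fm * Fk - (fps_const m + Fu) * Fm"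
    "fps_X * fps_deriv Fv = - Fk - Fn * Fk - (fps_const (1 / m) + Fv) * Fn"
    "Fk = fps_const h * fps_X + fps_const b * Fv - fps_const a * Fu"
  proof (rule power_series_solution, goal_cases)
    case 1
    from 1(2-) show ?case by (rule 1(1))
  qed
  note ci = fps_converges_upto_intros[where \<rho> = r] conv
  define e where "e F s = eval_fps F s" for F :: "real fps" and s
  define d where "d F s = eval_fps (fps_deriv F) s" for F :: "real fps" and s
  have e0: "e F 0 = fps_nth F 0" "d F 0 = fps_nth F 1" for F
    by (simp_all add: e_def d_def eval_fps_at_0)
  have ev: "e (F + G) s = e F s + e G s" "e (F - G) s = e F s - e G s" "e (F * G) s = e F s * e G s"
    "e (- F) s = - e F s"
    if "fps_converges_upto r F" "fps_converges_upto r G" "\<bar>s\<bar> < r" for F G s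
    unfolding e_def by (rule eval_fps_upto[OF that])+
  have der: "DERIV (e F) s :> d F s" if "fps_converges_upto r F" "\<bar>s\<bar> < r" for F s
    unfolding e_def[abs_def] d_def using eval_fps_upto(5)[OF that(1) that] .
  have ec: "e (fps_const c) s = c" "e fps_X s = s" for c s by (simp_all add: e_def)
  have sd: "e (fps_X * fps_deriv F) s = s * d F s" if "fps_converges_upto r F" "\<bar>s\<bar> < r" for F s
    using ev(3)[of fps_X "fps_deriv F" s] ci that by (simp add: ec d_def) (simp add: e_def)
  note E = arg_cong[where f = "\<lambda>F. e F s" for s]
  have ode: "s * d Fp s = e Fm s" "s * d Fq s = e Fn s"
    "s * d Fm s = - e Fm s - e Fm s * e Fm s - (m + e Fu s) * e Fk s"
    "s * d Fn s = - e Fn s - e Fn s * e Fn s + (1 / m + e Fv s) * e Fk s"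
    "s * d Fu s = e Fk s + e Fm s * e Fk s - (m + e Fu s) * e Fm s"
    "s * d Fv s = - e Fk s - e Fn s * e Fk s - (1 / m + e Fv s) * e Fn s"
    "e Fk s = h * s + b * e Fv s - a * e Fu s"
    if s: "\<bar>s\<bar> < r" for s
  proof -
    note I = fps_converges_upto_intros[where \<rho> = r]
    note Im = I(4)[OF _ conv(1)] and evm = ev(4)[OF _ conv(1)]
    show "s * d Fp s = e Fm s" "s * d Fq s = e Fn s"
      using E[OF p(5), of s] E[OF p(6), of s] sd[OF _ s] conv by simp_all
    have g: "fps_converges_upto r (fps_const c)" "fps_converges_upto r fps_X" for c
      using I[OF conv(1) conv(1)] by simp_all
    show "s * d Fm s = - e Fm s - e Fm s * e Fm s - (m + e Fu s) * e Fk s"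
      using E[OF eqs(1), of s] sd[OF conv(2) s] by (simp add: ev(1-3) evm I(1-3) Im conv g s ec)
    show "s * d Fn s = - e Fn s - e Fn s * e Fn s + (1 / m + e Fv s) * e Fk s"
      using E[OF eqs(2), of s] sd[OF conv(5) s] by (simp add: ev(1-3) evm I(1-3) Im conv g s ec)
    show "s * d Fu s = e Fk s + e Fm s * e Fk s - (m + e Fu s) * e Fm s"
      using E[OF eqs(3), of s] sd[OF conv(3) s] by (simp add: ev(1-3) evm I(1-3) Im conv g s ec)
    show "s * d Fv s = - e Fk s - e Fn s * e Fk s - (1 / m + e Fv s) * e Fn s"
      using E[OF eqs(4), of s] sd[OF conv(4) s] by (simp add: ev(1-3) evm I(1-3) Im conv g s ec)
    show "e Fk s = h * s + b * e Fv s - a * e Fu s"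
      using E[OF eqs(5), of s] by (simp add: ev(1-3) evm I(1-3) Im conv g s ec)
  qed
  \<comment> \<open>x/s and y/s are recovered from their logarithms. The exponential makes them
    positive, and the integration constants \<open>C0\<close>, \<open>S0\<close> make the two
    candidates for each velocity component agree at s = 0.\<close>
  define X where "X s = C0 * exp (e Fp s)" for s
  define Y where "Y s = S0 * exp (e Fq s)" for s
  define x where "x s = s * X s" for s
  define y where "y s = s * Y s" for s
  define C where "C s = X s * (1 + e Fm s)" for s
  define S where "S s = Y s * (1 + e Fn s)" for s
  define C2 where "C2 s = Y s * (1 / m + e Fv s)" for s
  define S2 where "S2 s = X s * (m + e Fu s)" for s
  define kap where "kap s = e Fk s / s" for s
  have dX: "DERIV X s :> X s * d Fp s"
    and dY: "DERIV Y s :> Y s * d Fq s" if "\<bar>s\<bar> < r" for s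
    unfolding X_def[abs_def] Y_def[abs_def]
    using der[OF conv(6) that] der[OF conv(7) that] by (auto intro!: derivative_eq_intros)
  have dx: "DERIV x s :> C s" and dy: "DERIV y s :> S s"
    if "\<bar>s\<bar> < r" for s
  proof -
    have "C s = X s + s * (X s * d Fp s)" "S s = Y s + s * (Y s * d Fq s)"
      using ode(1,2)[OF that] by (simp_all add: C_def S_def algebra_simps)
    then show "DERIV x s :> C s" "DERIV y s :> S s"
      unfolding x_def[abs_def] y_def[abs_def]
      using dX[OF that] dY[OF that] by (auto intro!: derivative_eq_intros)
  qed
  have dC0: "DERIV C s :> X s * d Fp s * (1 + e Fm s) + X s * d Fm s"
    and dS0: "DERIV S s :> Y s * d Fq s * (1 + e Fn s) + Y s * d Fn s"
    and dC20: "DERIV C2 s :> Y s * d Fq s * (1 / m + e Fv s) + Y s * d Fv s"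
    and dS20: "DERIV S2 s :> X s * d Fp s * (m + e Fu s) + X s * d Fu s"
    if s: "\<bar>s\<bar> < r" for s
    unfolding C_def[abs_def] S_def[abs_def] C2_def[abs_def] S2_def[abs_def]
    using dX[OF s] dY[OF s] der[OF conv(2) s] der[OF conv(3) s] der[OF conv(4) s] der[OF conv(5) s]
    by (auto intro!: derivative_eq_intros)
  have sc: "p = q" if "s * p = s * q" "s > 0" for p q s :: real using that by simp
  have dC: "DERIV C s :> - S2 s * kap s"
    and dS: "DERIV S s :> C2 s * kap s"
    and dC2: "DERIV C2 s :> - S s * kap s"
    and dS2: "DERIV S2 s :> C s * kap s"
    if s: "0 < s" "s < r" for s
  proof -
    have s': "\<bar>s\<bar> < r" using s by simp
    have kap: "s * kap s = e Fk s" using s by (simp add: kap_def)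
    have "s * (X s * d Fp s * (1 + e Fm s) + X s * d Fm s) =
        X s * ((s * d Fp s) * (1 + e Fm s) + s * d Fm s)" by (simp add: algebra_simps)
    also have "\<dots> = - S2 s * (s * kap s)"
      unfolding ode(1,3)[OF s'] kap S2_def by (simp add: algebra_simps)
    finally have 1: "s * (X s * d Fp s * (1 + e Fm s) + X s * d Fm s) = s * (- S2 s * kap s)"
      by simp
    have "s * (Y s * d Fq s * (1 + e Fn s) + Y s * d Fn s) =
        Y s * ((s * d Fq s) * (1 + e Fn s) + s * d Fn s)" by (simp add: algebra_simps)
    also have "\<dots> = C2 s * (s * kap s)"
      unfolding ode(2,4)[OF s'] kap C2_def by (simp add: algebra_simps)
    finally have 2: "s * (Y s * d Fq s * (1 + e Fn s) + Y s * d Fn s) = s * (C2 s * kap s)"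
      by simp
    have "s * (Y s * d Fq s * (1 / m + e Fv s) + Y s * d Fv s) =
        Y s * ((s * d Fq s) * (1 / m + e Fv s) + s * d Fv s)" by (simp add: algebra_simps)
    also have "\<dots> = - S s * (s * kap s)"
      unfolding ode(2,6)[OF s'] kap S_def by (simp add: algebra_simps)
    finally have 3: "s * (Y s * d Fq s * (1 / m + e Fv s) + Y s * d Fv s) = s * (- S s * kap s)"
      by simp
    have "s * (X s * d Fp s * (m + e Fu s) + X s * d Fu s) =
        X s * ((s * d Fp s) * (m + e Fu s) + s * d Fu s)" by (simp add: algebra_simps)
    also have "\<dots> = C s * (s * kap s)"
      unfolding ode(1,5)[OF s'] kap C_def by (simp add: algebra_simps)
    finally have 4: "s * (X s * d Fp s * (m + e Fu s) + X s * d Fu s) = s * (C s * kap s)"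
      by simp
    show "DERIV C s :> - S2 s * kap s" "DERIV S s :> C2 s * kap s"
      "DERIV C2 s :> - S s * kap s" "DERIV S2 s :> C s * kap s"
      using dC0[OF s'] dS0[OF s'] dC20[OF s'] dS20[OF s']
      unfolding sc[OF 1 s(1)] sc[OF 2 s(1)] sc[OF 3 s(1)] sc[OF 4 s(1)] .
  qed
  have XY0: "X 0 = C0" "Y 0 = S0" "C 0 = C0" "S 0 = S0" "C2 0 = C0" "S2 0 = S0"
    using S0_eq m_pos by (simp_all add: X_def Y_def C_def S_def C2_def S2_def e0 n0 p)
  have const: "f s = f 0" if d0: "\<And>s. 0 < s \<Longrightarrow> s < r \<Longrightarrow> (DERIV f s :> 0)"
    and "\<And>s. \<bar>s\<bar> < r \<Longrightarrow> isCont f s" and s: "0 < s" "s < r" for f and s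
    using s that(2) d0 by (intro DERIV_isconst2[of 0 s f s]) (auto intro!: continuous_at_imp_continuous_on)
  have cont: "isCont C s" "isCont S s" "isCont C2 s" "isCont S2 s" if "\<bar>s\<bar> < r" for s
    using dC0[OF that] dS0[OF that] dC20[OF that] dS20[OF that] by (blast dest: DERIV_isCont)+
  \<comment> \<open>The vector (C - C2, S - S2) is rotated with angular speed - \<open>kap\<close>.
    Its length is therefore constant, and it is 0 at s = 0.\<close>
  have same: "C s = C2 s \<and> S s = S2 s" if s: "0 < s" "s < r" for s
  proof -
    have "(C s - C2 s)\<^sup>2 + (S s - S2 s)\<^sup>2 = (C 0 - C2 0)\<^sup>2 + (S 0 - S2 0)\<^sup>2"
    proof (rule const[OF _ _ s, where f = "\<lambda>s. (C s - C2 s)\<^sup>2 + (S s - S2 s)\<^sup>2"])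
      show "DERIV (\<lambda>s. (C s - C2 s)\<^sup>2 + (S s - S2 s)\<^sup>2) s :> 0" if "0 < s" "s < r" for s
        using dC[OF that] dS[OF that] dC2[OF that] dS2[OF that]
        by (auto intro!: derivative_eq_intros simp: algebra_simps)
    qed (intro continuous_intros cont)
    then have "(C s - C2 s)\<^sup>2 + (S s - S2 s)\<^sup>2 = 0" by (simp add: XY0)
    then show ?thesis by (simp add: sum_power2_eq_zero_iff)
  qed
  have unit: "(C s)\<^sup>2 + (S s)\<^sup>2 = 1" if s: "0 < s" "s < r" for s
  proof -
    have "(C s)\<^sup>2 + (S s)\<^sup>2 = (C 0)\<^sup>2 + (S 0)\<^sup>2"
    proof (rule const[OF _ _ s, where f = "\<lambda>s. (C s)\<^sup>2 + (S s)\<^sup>2"])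
      show "DERIV (\<lambda>s. (C s)\<^sup>2 + (S s)\<^sup>2) s :> 0" if "0 < s" "s < r" for s
        using dC[OF that] dS[OF that] same[OF that]
        by (auto intro!: derivative_eq_intros simp: algebra_simps)
    qed (intro continuous_intros cont)
    then show ?thesis using C0_S0 by (simp add: XY0)
  qed
  have XYpos: "X s > 0" "Y s > 0" for s using C0_pos S0_pos by (simp_all add: X_def Y_def)
  \<comment> \<open>By \<open>m_sq\<close> the constant terms of a U and b V cancel, which removes
    the 1/s singularity of the curvature.\<close>
  have kap: "kap s = h - a * S s / x s + b * C s / y s" if s: "0 < s" "s < r" for s
  proof -
    have "b * C s / y s = b * (1 / m + e Fv s) / s" "a * S s / x s = a * (m + e Fu s) / s"
      using same[OF s] XYpos[of s] by (simp_all add: x_def y_def C2_def S2_def)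
    then have "h - a * S s / x s + b * C s / y s = (h * s + b * (1 / m + e Fv s) - a * (m + e Fu s)) / s"
      using s by (simp add: diff_divide_distrib add_divide_distrib)
    also have "h * s + b * (1 / m + e Fv s) - a * (m + e Fu s) = e Fk s"
      using ode(7)[of s] s m_sq by (simp add: algebra_simps)
    finally show ?thesis by (simp add: kap_def)
  qed
  show ?thesis
  proof (rule that[of r x y C S])
    show "branch_on {0<..<r} x y C S"
      unfolding branch_on_def
    proof (intro ballI conjI)
      fix s assume "s \<in> {0<..<r}"
      then have s: "0 < s" "s < r" by auto
      show "0 < x s" "0 < y s" using s XYpos by (simp_all add: x_def y_def)
      show "(C s)\<^sup>2 + (S s)\<^sup>2 = 1" using unit[OF s] .
      show "DERIV x s :> C s" "DERIV y s :> S s"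
        using dx dy s by auto
      show "DERIV C s :> - S s * (h - a * S s / x s + b * C s / y s)"
        "DERIV S s :> C s * (h - a * S s / x s + b * C s / y s)"
        using dC[OF s] dS[OF s] same[OF s] unfolding kap[OF s] by simp_all
    qed
    show "DERIV C 0 :> - S0 * k0"
      using dC0[of 0] r by (simp del: One_nat_def add: XY0 e0 p n0 n1 S0_eq mult_ac)
    show "DERIV S 0 :> C0 * k0"
      using dS0[of 0] r m_pos by (simp del: One_nat_def add: XY0 e0 p n0 n1 S0_eq mult_ac)
    have sub: "{-r<..<r} \<subseteq> eball 0 (ereal r)" by auto
    have ce: "C_k k {-r<..<r} (e F)" if "fps_converges_upto r F" for k F
      unfolding e_def[abs_def] using that by (intro C_k_eval_fps[OF sub]) (simp add: fps_converges_upto_def)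
    show "C_k k {-r<..<r} x" for k
      unfolding x_def[abs_def] X_def
      by (intro C_k_mult C_k_exp C_k_const C_k_linear[OF bounded_linear_ident] ce conv)
    show "C_k k {-r<..<r} y" for k
      unfolding y_def[abs_def] Y_def
      by (intro C_k_mult C_k_exp C_k_const C_k_linear[OF bounded_linear_ident] ce conv)
  qed (use r dx dy XY0 in \<open>auto simp: x_def y_def\<close>)
qed

end

section \<open>Differential inequalities near an endpoint\<close>

lemma le_limit_at_right_if_deriv_nonpos:
  fixes f :: "real \<Rightarrow> real"
  assumes d: "\<And>s. 0 < s \<Longrightarrow> s < r \<Longrightarrow> (DERIV f s :> f' s)"
    and neg: "\<And>s. 0 < s \<Longrightarrow> s < r \<Longrightarrow> f' s \<le> 0"
    and lim: "(f \<longlongrightarrow> l) (at_right 0)" and s: "0 < s" "s < r"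
  shows "f s \<le> l"
proof (rule tendsto_lowerbound[OF lim])
  have "f s \<le> f t" if t: "0 < t" "t < s" for t
  proof (rule DERIV_nonpos_imp_nonincreasing[of t s f])
    fix u assume "t \<le> u" "u \<le> s"
    then show "\<exists>y. (DERIV f u :> y) \<and> y \<le> 0"
      using d[of u] neg[of u] s t by auto
  qed (use t in simp)
  then show "\<forall>\<^sub>F t in at_right 0. f s \<le> f t" using s by (intro eventually_at_rightI[of 0 s]) auto
qed simp

text \<open>\<open>f\<close> can cross 0 only upwards. If f were positive at t, the first point of
  [t, s] with f \<le> 0 would be a zero with positive derivative, so f would be negative just before
  it.\<close>

lemma nonpos_before_if_deriv_pos_at_zeros:
  fixes f :: "real \<Rightarrow> real"
  assumes d: "\<And>s. 0 < s \<Longrightarrow> s < r \<Longrightarrow> (DERIV f s :> f' s)"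
    and pos: "\<And>s. 0 < s \<Longrightarrow> s < r \<Longrightarrow> f s = 0 \<Longrightarrow> f' s > 0"
    and s: "0 < t" "t \<le> s" "s < r" and fs: "f s \<le> 0"
  shows "f t \<le> 0"
proof (rule ccontr)
  assume "\<not> f t \<le> 0"
  then have ft: "f t > 0" by simp
  have c: "continuous_on {t..s} f"
    using d s by (intro DERIV_continuous_on[of _ _ f']) (auto intro: has_field_derivative_at_within)
  define A where "A = {z \<in> {t..s}. f z \<le> 0}"
  have "closed A" unfolding A_def using c by (intro continuous_on_closed_Collect_le) auto
  then have "compact A" using compact_Int_closed[OF compact_Icc[of t s] \<open>closed A\<close>]
    by (metis (no_types, lifting) A_def inf.absorb2 mem_Collect_eq subsetI)
  moreover have "s \<in> A" using s fs by (simp add: A_def)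
  ultimately obtain z where z: "z \<in> A" "\<And>u. u \<in> A \<Longrightarrow> z \<le> u"
    using compact_attains_inf[of A] by blast
  then have zt: "t \<le> z" "z \<le> s" "f z \<le> 0" by (auto simp: A_def)
  have "\<exists>u\<ge>t. u \<le> z \<and> f u = 0"
    using IVT2'[of f z 0 t] zt ft continuous_on_subset[OF c, of "{t..z}"] by auto
  then obtain u where u: "t \<le> u" "u \<le> z" "f u = 0" by blast
  then have "u \<in> A" using zt by (simp add: A_def)
  with z(2) u have "f z = 0" by force
  with zt ft have tz: "t < z" by (cases "t = z") auto
  have "f' z > 0" "DERIV f z :> f' z"
    using pos d \<open>f z = 0\<close> zt s by auto
  then obtain e where e: "e > 0" "\<And>h. 0 < h \<Longrightarrow> h < e \<Longrightarrow> f (z - h) < f z"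
    using DERIV_pos_inc_left by blast
  define k where "k = min (e / 2) (z - t)"
  have k: "0 < k" "k < e" "k \<le> z - t" using e tz by (auto simp: k_def)
  have "f (z - k) < 0" using e(2)[OF k(1,2)] \<open>f z = 0\<close> by simp
  then have "z - k \<in> A" using k zt by (simp add: A_def)
  with z(2) k show False by force
qed

text \<open>Were f \<le> 0 at some s, it would be so at all earlier times by the preceding lemma,
  and g would decrease from its limit 0, against g > 0.\<close>

lemma deriv_pos_near_zero:
  fixes f g :: "real \<Rightarrow> real"
  assumes g: "\<And>s. 0 < s \<Longrightarrow> s < r \<Longrightarrow> (DERIV g s :> f s)" "(g \<longlongrightarrow> 0) (at_right 0)"
    and gpos: "\<And>s. 0 < s \<Longrightarrow> s < r \<Longrightarrow> g s > 0"
    and f: "\<And>s. 0 < s \<Longrightarrow> s < r \<Longrightarrow> (DERIV f s :> f' s)"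
      "\<And>s. 0 < s \<Longrightarrow> s < r \<Longrightarrow> f s = 0 \<Longrightarrow> f' s > 0"
    and s: "0 < s" "s < r"
  shows "f s > 0"
proof (rule ccontr)
  assume "\<not> f s > 0"
  then have "f t \<le> 0" if "0 < t" "t \<le> s" for t
    using nonpos_before_if_deriv_pos_at_zeros[of r f f' t s] f s that by auto
  then have "g (s / 2) \<le> 0"
    using g s by (intro le_limit_at_right_if_deriv_nonpos[of s g f]) auto
  then show False using gpos[of "s / 2"] s by simp
qed

text \<open>A solution of \<open>s E' \<le> K - c E\<^sup>2\<close> that gets too large at some time blows up at an earlier
  positive time.\<close>

lemma bounded_if_quadratic_damping:
  fixes E :: "real \<Rightarrow> real"
  assumes d: "\<And>s. 0 < s \<Longrightarrow> s < r \<Longrightarrow> (DERIV E s :> E' s)"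
    and le: "\<And>s. 0 < s \<Longrightarrow> s < r \<Longrightarrow> s * E' s \<le> K - c * (E s)\<^sup>2"
    and "c > 0" "K \<ge> 0" and s: "0 < s" "s < r"
  shows "E s \<le> sqrt (2 * K / c) + 1"
proof (rule ccontr)
  define M where "M = sqrt (2 * K / c) + 1"
  have M: "M > 0" using \<open>c > 0\<close> \<open>K \<ge> 0\<close> by (simp add: M_def add_nonneg_pos)
  assume "\<not> E s \<le> sqrt (2 * K / c) + 1"
  then have sM: "E s \<ge> M" by (simp add: M_def)
  have big: "t * E' t \<le> - (c / 2) * (E t)\<^sup>2" if "0 < t" "t < r" "E t \<ge> M" for t
  proof -
    have "2 * K / c = (sqrt (2 * K / c))\<^sup>2" using \<open>c > 0\<close> \<open>K \<ge> 0\<close> by simp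
    also have "\<dots> \<le> (E t)\<^sup>2"
      using that(3) \<open>c > 0\<close> \<open>K \<ge> 0\<close> by (intro power_mono) (auto simp: M_def)
    finally have "K \<le> c / 2 * (E t)\<^sup>2" using \<open>c > 0\<close> by (simp add: field_simps)
    then show ?thesis using le[OF that(1,2)] by (simp add: algebra_simps)
  qed
  have stay: "E t \<ge> M" if t: "0 < t" "t \<le> s" for t
  proof -
    have "M - E t \<le> 0"
    proof (rule nonpos_before_if_deriv_pos_at_zeros[of r "\<lambda>t. M - E t" "\<lambda>t. - E' t" t s])
      show "0 < - E' u" if u: "0 < u" "u < r" "M - E u = 0" for u
      proof -
        have "c * (E u)\<^sup>2 > 0" using u M \<open>c > 0\<close> by simp
        then have "u * E' u < 0" using big[of u] u by simp
        then show ?thesis using u by (simp add: mult_less_0_iff)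
      qed
    qed (use d t s sM in \<open>auto intro!: derivative_eq_intros\<close>)
    then show ?thesis by simp
  qed
  \<comment> \<open>From s E' \<le> - (c/2) E^2 it follows that this function is nondecreasing.
    Going back to t = 0 its logarithmic part tends to infinity while 1/E stays positive, which is
    impossible below \<open>g s\<close>.\<close>
  define g where "g t = 1 / E t - c / 2 * ln t" for t
  have g: "g t \<le> g s" if t: "0 < t" "t \<le> s" for t
  proof (rule DERIV_nonneg_imp_nondecreasing[OF t(2)])
    fix u assume u: "t \<le> u" "u \<le> s"
    then have u': "0 < u" "u < r" "E u \<ge> M" using t s stay by auto
    then have E: "E u > 0" using M by simp
    have "DERIV g u :> - E' u / (E u)\<^sup>2 - c / 2 * (1 / u)"
      unfolding g_def[abs_def] using d[OF u'(1,2)] E u'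
      by (auto intro!: derivative_eq_intros simp: power2_eq_square)
    moreover have "- E' u / (E u)\<^sup>2 - c / 2 * (1 / u) \<ge> 0"
      using big[OF u'] u'(1) E by (simp add: field_simps)
    ultimately show "\<exists>y. (DERIV g u :> y) \<and> 0 \<le> y" by blast
  qed
  \<comment> \<open>Early enough for - (c/2) ln t to exceed \<open>g s\<close>.\<close>
  define t where "t = min s (exp (- (2 / c) * (g s + 1)))"
  have t: "0 < t" "t \<le> s" using s by (auto simp: t_def)
  have "t \<le> exp (- (2 / c) * (g s + 1))" by (simp add: t_def)
  then have "ln t \<le> - (2 / c) * (g s + 1)" using t(1) by (metis ln_exp ln_le_cancel_iff exp_gt_zero)
  then have "c / 2 * ln t \<le> c / 2 * (- (2 / c) * (g s + 1))"
    using \<open>c > 0\<close> by (intro mult_left_mono) auto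
  also have "\<dots> = - (g s + 1)" using \<open>c > 0\<close> by (simp add: field_simps)
  finally have "c / 2 * ln t \<le> - (g s + 1)" .
  moreover have "1 / E t > 0" using stay[OF t] M by simp
  ultimately have "g t > g s" unfolding g_def[of t] by linarith
  with g[OF t] show False by simp
qed

text \<open>With G t = t - 1 - ln t one has G t + G (1/t) = t - 2 + 1/t, so both bounds express that
  G is nonnegative.\<close>

lemma log_deviation_bounds:
  fixes t :: real
  assumes "t > 0"
  shows "t - 1 - ln t \<ge> 0" "t - 1 - ln t \<le> t - 2 + 1 / t"
proof -
  show "t - 1 - ln t \<ge> 0" using ln_le_minus_one[OF assms] by simp
  have "ln (1 / t) \<le> 1 / t - 1" using assms by (intro ln_le_minus_one) simp
  then show "t - 1 - ln t \<le> t - 2 + 1 / t" using assms by (simp add: ln_div)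
qed

text \<open>- ln t is at most 2/sqrt t, so its square is controlled by 1/t, while t itself is at
  most T. This lets the square of the Lyapunov function be dominated by its dissipation.\<close>

lemma log_deviation_square_le:
  fixes t T :: real
  assumes "0 < t" "t \<le> T"
  shows "(t - 1 - ln t)\<^sup>2 \<le> 2 * T\<^sup>2 + 16 + 8 * (t - 2 + 1 / t)"
proof -
  define z where "z = 1 / sqrt t"
  have z: "z > 0" "z\<^sup>2 = 1 / t" using assms by (simp_all add: z_def power_divide)
  have "- ln t = 2 * ln z" using assms by (simp add: z_def ln_div ln_sqrt)
  also have "\<dots> \<le> 2 * z" using ln_le_minus_one[OF z(1)] by simp
  finally have "t - 1 - ln t \<le> T + 2 * z" using assms by simp
  then have "(t - 1 - ln t)\<^sup>2 \<le> (T + 2 * z)\<^sup>2"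
    using log_deviation_bounds(1)[OF assms(1)] by (intro power_mono) auto
  also have "\<dots> \<le> 2 * T\<^sup>2 + 8 * z\<^sup>2"
    using zero_le_power2[of "T - 2 * z"] by (simp add: power2_eq_square algebra_simps)
  also have "\<dots> \<le> 2 * T\<^sup>2 + 16 + 8 * (t - 2 + 1 / t)" using assms z by simp
  finally show ?thesis .
qed

section \<open>Uniqueness of the branch leaving the cusp\<close>

context cone
begin

text \<open>Nothing is assumed on the velocity at 0, since the definition has to admit every
  solution that is just continuous at the cusp. The finite \<open>r\<close> allows local and global
  branches to be compared.\<close>

definition cusp_branch ::
    "real \<Rightarrow> (real \<Rightarrow> real) \<Rightarrow> (real \<Rightarrow> real) \<Rightarrow> (real \<Rightarrow> real) \<Rightarrow> (real \<Rightarrow> real) \<Rightarrow> bool" where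
  "cusp_branch r x y C S \<longleftrightarrow> r > 0 \<and> branch_on {0<..<r} x y C S \<and>
     (x \<longlongrightarrow> 0) (at_right 0) \<and> (y \<longlongrightarrow> 0) (at_right 0)"

lemma cusp_branchD:
  assumes "cusp_branch r x y C S"
  shows "r > 0" "(x \<longlongrightarrow> 0) (at_right 0)" "(y \<longlongrightarrow> 0) (at_right 0)"
    and "0 < s \<Longrightarrow> s < r \<Longrightarrow> x s > 0" "0 < s \<Longrightarrow> s < r \<Longrightarrow> y s > 0"
    "0 < s \<Longrightarrow> s < r \<Longrightarrow> (C s)\<^sup>2 + (S s)\<^sup>2 = 1"
    "0 < s \<Longrightarrow> s < r \<Longrightarrow> (DERIV x s :> C s)"
    "0 < s \<Longrightarrow> s < r \<Longrightarrow> (DERIV y s :> S s)"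
    "0 < s \<Longrightarrow> s < r \<Longrightarrow> (DERIV C s :> - S s * (h - a * S s / x s + b * C s / y s))"
    "0 < s \<Longrightarrow> s < r \<Longrightarrow> (DERIV S s :> C s * (h - a * S s / x s + b * C s / y s))"
  using assms by (auto simp: cusp_branch_def branch_on_def)

lemma cusp_branch_subset:
  assumes "cusp_branch r x y C S" "0 < \<rho>" "\<rho> \<le> r"
  shows "cusp_branch \<rho> x y C S"
  using assms by (auto simp: cusp_branch_def branch_on_def)

text \<open>Where C = 0 one has C' = a/x - S h with S = 1 or S = -1, and this is positive once x <
  1/(|h| + 1), because a \<ge> 1. So C changes sign only upwards, and
  \<open>deriv_pos_near_zero\<close> applied to x excludes C \<le> 0; likewise for S and y.\<close>

lemma cusp_branch_velocity_pos:
  assumes B: "cusp_branch r x y C S"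
  obtains \<rho> where "0 < \<rho>" "\<rho> \<le> r" "\<And>s. 0 < s \<Longrightarrow> s < \<rho> \<Longrightarrow> C s > 0" "\<And>s. 0 < s \<Longrightarrow> s < \<rho> \<Longrightarrow> S s > 0"
proof -
  note D = cusp_branchD[OF B]
  define \<epsilon> where "\<epsilon> = 1 / (\<bar>h\<bar> + 1)"
  have "\<epsilon> > 0" by (simp add: \<epsilon>_def add_nonneg_pos)
  then have "\<forall>\<^sub>F s in at_right 0. x s < \<epsilon> \<and> y s < \<epsilon>"
    using D(2,3) by (intro eventually_conj order_tendstoD(2)) auto
  then obtain \<rho>0 where \<rho>0: "\<rho>0 > 0" "\<And>s. 0 < s \<Longrightarrow> s < \<rho>0 \<Longrightarrow> x s < \<epsilon> \<and> y s < \<epsilon>"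
    unfolding eventually_at_right_field by blast
  define \<rho> where "\<rho> = min r \<rho>0"
  have \<rho>: "0 < \<rho>" "\<rho> \<le> r" using \<rho>0 D(1) by (auto simp: \<rho>_def)
  have big: "\<bar>h\<bar> < 1 / z" if "0 < z" "z < \<epsilon>" for z
  proof -
    have "\<bar>h\<bar> + 1 < 1 / z" using that by (simp add: \<epsilon>_def field_simps)
    then show ?thesis by simp
  qed
  have xy: "\<bar>h\<bar> < a / x s" "\<bar>h\<bar> < b / y s" if s: "0 < s" "s < \<rho>" for s
  proof -
    have "0 < x s" "x s < \<epsilon>" "0 < y s" "y s < \<epsilon>" using s \<rho> \<rho>0(2)[of s] D(4,5)[of s] by (auto simp: \<rho>_def)
    then have "1 / x s \<le> a / x s" "1 / y s \<le> b / y s" "\<bar>h\<bar> < 1 / x s" "\<bar>h\<bar> < 1 / y s"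
      using a b big by (auto intro: divide_right_mono)
    then show "\<bar>h\<bar> < a / x s" "\<bar>h\<bar> < b / y s" by linarith+
  qed
  have C: "C s > 0" if s: "0 < s" "s < \<rho>" for s
  proof (rule deriv_pos_near_zero[of \<rho> x C "\<lambda>s. - S s * (h - a * S s / x s + b * C s / y s)" s])
    fix t assume t: "0 < t" "t < \<rho>" "C t = 0"
    then have S2: "S t * S t = 1" using D(6)[of t] \<rho> by (simp add: power2_eq_square)
    then have "\<bar>S t\<bar> = 1" by (metis abs_1 abs_mult_self_eq abs_square_eq_1 power2_eq_square)
    then have "\<bar>S t * h\<bar> = \<bar>h\<bar>" by (simp add: abs_mult)
    moreover have "- S t * (h - a * S t / x t + b * C t / y t) = a * (S t * S t) / x t - S t * h"
      using t(3) by (simp add: algebra_simps)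
    ultimately show "0 < - S t * (h - a * S t / x t + b * C t / y t)"
      using xy(1)[OF t(1,2)] S2 abs_ge_self[of "S t * h"] by simp
  qed (use D \<rho> s in auto)
  have S: "S s > 0" if s: "0 < s" "s < \<rho>" for s
  proof (rule deriv_pos_near_zero[of \<rho> y S "\<lambda>s. C s * (h - a * S s / x s + b * C s / y s)" s])
    fix t assume t: "0 < t" "t < \<rho>" "S t = 0"
    then have C2: "C t * C t = 1" using D(6)[of t] \<rho> by (simp add: power2_eq_square)
    then have "\<bar>C t\<bar> = 1" by (metis abs_1 abs_mult_self_eq abs_square_eq_1 power2_eq_square)
    then have "\<bar>C t * h\<bar> = \<bar>h\<bar>" by (simp add: abs_mult)
    moreover have "C t * (h - a * S t / x t + b * C t / y t) = b * (C t * C t) / y t + C t * h"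
      using t(3) by (simp add: algebra_simps)
    ultimately show "0 < C t * (h - a * S t / x t + b * C t / y t)"
      using xy(2)[OF t(1,2)] C2 abs_ge_minus_self[of "C t * h"] by simp
  qed (use D \<rho> s in auto)
  show ?thesis using that \<rho> C S by blast
qed

text \<open>With \<open>X = x / s\<close>, \<open>Y = y / s\<close>, \<open>u = 1 / X\<close>, \<open>v = 1 / Y\<close> and \<open>\<delta>\<close> the angle between the
  velocity and the direction \<open>(C0, S0)\<close>, the left-hand side is \<open>s\<close> times the derivative of the
  Lyapunov function \<open>1 - cos \<delta> + a G (X / C0) + b G (Y / S0)\<close>, where \<open>G t = t - 1 - ln t\<close>.\<close>

lemma lyapunov_identity:
  fixes X Y u v C S k :: real
  assumes "u * X = 1" "v * Y = 1" "C\<^sup>2 + S\<^sup>2 = 1"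
  shows "(S * C0 - C * S0) * (k - a * S * u + b * C * v) + a * (1 / C0 - u) * (C - X) + b * (1 / S0 - v) * (S - Y)
    = k * (S * C0 - C * S0) - (1 - (C * C0 + S * S0)) * (a * C * u + b * S * v + (a + b))
      - a * (X / C0 - 2 + C0 * u) - b * (Y / S0 - 2 + S0 * v)"
proof -
  define n where "n = a + b"
  \<comment> \<open>With the weights expressed through the direction and every quotient replaced by
    its defining equation, the claim becomes a consequence of polynomial identities.\<close>
  have a': "a = n * C0\<^sup>2" and b': "b = n * S0\<^sup>2" using C0_sq S0_sq a b by (auto simp: n_def)
  define c d where "c = 1 / C0" and "d = 1 / S0"
  have cd: "c * C0 = 1" "d * S0 = 1" using C0_pos S0_pos by (simp_all add: c_def d_def)
  have "(S * C0 - C * S0) * (k - a * S * u + b * C * v) + a * (c - u) * (C - X) + b * (d - v) * (S - Y)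
    = k * (S * C0 - C * S0) - (1 - (C * C0 + S * S0)) * (a * C * u + b * S * v + n)
      - a * (X * c - 2 + C0 * u) - b * (Y * d - 2 + S0 * v)"
    using assms cd C0_S0 a' b' by algebra
  then show ?thesis by (simp add: c_def d_def n_def)
qed


lemma cusp_branch_le:
  assumes B: "cusp_branch r x y C S" and s: "0 < s" "s < r"
  shows "x s \<le> s" "y s \<le> s"
proof -
  note D = cusp_branchD[OF B]
  have CS: "C t \<le> 1" "S t \<le> 1" if "0 < t" "t < r" for t
  proof -
    have "(C t)\<^sup>2 \<le> 1\<^sup>2" "(S t)\<^sup>2 \<le> 1\<^sup>2" using D(6)[OF that] by (simp_all add: power2_eq_square) (smt (verit) zero_le_square)+
    then show "C t \<le> 1" "S t \<le> 1" by (auto intro: power2_le_imp_le)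
  qed
  have "x s - s \<le> 0 - 0"
    by (rule le_limit_at_right_if_deriv_nonpos[of r "\<lambda>t. x t - t" "\<lambda>t. C t - 1"])
      (use D CS s tendsto_diff[OF D(2) tendsto_ident_at] in \<open>auto intro!: derivative_eq_intros\<close>)
  moreover have "y s - s \<le> 0 - 0"
    by (rule le_limit_at_right_if_deriv_nonpos[of r "\<lambda>t. y t - t" "\<lambda>t. S t - 1"])
      (use D CS s tendsto_diff[OF D(3) tendsto_ident_at] in \<open>auto intro!: derivative_eq_intros\<close>)
  ultimately show "x s \<le> s" "y s \<le> s" by auto
qed

text \<open>Let E be the Lyapunov function and D its dissipation, so that s E' \<le> |h| s - D. For
  large E the dissipation is at least of order E^2, hence by backward blow-up E is bounded and s E
  tends to 0. Since also D \<ge> E, the function s E - |h| s^2/2 is nonincreasing with limit 0. This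
  gives E \<le> |h| s/2, and the squared distance of the velocity from (C0, S0) is at most 2
  E.\<close>

lemma cusp_branch_velocity_tendsto:
  assumes B: "cusp_branch r x y C S"
  shows "(C \<longlongrightarrow> C0) (at_right 0)" "(S \<longlongrightarrow> S0) (at_right 0)"
proof -
  obtain \<rho> where \<rho>: "0 < \<rho>" "\<rho> \<le> r" and pos: "\<And>s. 0 < s \<Longrightarrow> s < \<rho> \<Longrightarrow> C s > 0" "\<And>s. 0 < s \<Longrightarrow> s < \<rho> \<Longrightarrow> S s > 0"
    using cusp_branch_velocity_pos[OF B] by metis
  note B' = cusp_branch_subset[OF B \<rho>]
  note D = cusp_branchD[OF B'] and le = cusp_branch_le[OF B']
  define X where "X s = x s / s" for s
  define Y where "Y s = y s / s" for s
  define G where "G t = t - 1 - ln t" for t :: real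
  define P where "P t = t - 2 + 1 / t" for t :: real
  define E where "E s = (1 - (C s * C0 + S s * S0)) + a * G (X s / C0) + b * G (Y s / S0)" for s
  define sd where "sd s = S s * C0 - C s * S0" for s
  define cd where "cd s = C s * C0 + S s * S0" for s
  define E' where "E' s = sd s * (h - a * S s / x s + b * C s / y s)
      + a * (1 / C0 - 1 / X s) * ((C s - X s) / s) + b * (1 / S0 - 1 / Y s) * ((S s - Y s) / s)" for s
  have XY: "X s > 0" "Y s > 0" "X s \<le> 1" "Y s \<le> 1" if "0 < s" "s < \<rho>" for s
    using D(4,5)[OF that] le[OF that] that by (auto simp: X_def Y_def)
  have sc: "cd s \<le> 1" "cd s \<ge> -1" "\<bar>sd s\<bar> \<le> 1" if "0 < s" "s < \<rho>" for s
  proof -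
    have "(cd s)\<^sup>2 + (sd s)\<^sup>2 = ((C s)\<^sup>2 + (S s)\<^sup>2) * (C0\<^sup>2 + S0\<^sup>2)"
      by (simp add: cd_def sd_def power2_eq_square algebra_simps)
    then have "(cd s)\<^sup>2 + (sd s)\<^sup>2 = 1" using D(6)[OF that] C0_S0 by simp
    then have "(cd s)\<^sup>2 \<le> 1" "(sd s)\<^sup>2 \<le> 1" using zero_le_power2[of "cd s"] zero_le_power2[of "sd s"] by linarith+
    then have "\<bar>cd s\<bar> \<le> 1" "\<bar>sd s\<bar> \<le> 1" by (simp_all add: abs_square_le_1)
    then show "cd s \<le> 1" "cd s \<ge> -1" "\<bar>sd s\<bar> \<le> 1" by auto
  qed
  have dE: "DERIV E s :> E' s" if s: "0 < s" "s < \<rho>" for s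
  proof -
    have dX: "DERIV X s :> (C s - X s) / s"
      unfolding X_def[abs_def] using D(7)[OF s] s
      by (auto intro!: derivative_eq_intros simp: power2_eq_square field_simps)
    have dY: "DERIV Y s :> (S s - Y s) / s"
      unfolding Y_def[abs_def] using D(8)[OF s] s
      by (auto intro!: derivative_eq_intros simp: power2_eq_square field_simps)
    have dG: "DERIV (\<lambda>t. G (Z t / c)) s :> (1 / c - 1 / Z s) * z"
      if "DERIV Z s :> z" "Z s > 0" "c > 0" for Z z c
      unfolding G_def using that by (auto intro!: derivative_eq_intros simp: field_simps)
    have dc: "DERIV (\<lambda>t. 1 - (C t * C0 + S t * S0)) s :> sd s * (h - a * S s / x s + b * C s / y s)"
      using D(9,10)[OF s] by (auto intro!: derivative_eq_intros simp: sd_def algebra_simps)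
    show ?thesis
      unfolding E_def[abs_def] E'_def
      by (intro DERIV_add dc)
        (use DERIV_cmult[OF dG[OF dX XY(1)[OF s] C0_pos], of a] DERIV_cmult[OF dG[OF dY XY(2)[OF s] S0_pos], of b]
          in \<open>simp_all add: mult.assoc\<close>)
  qed
  define DD where "DD s = (1 - cd s) * (a + b) + a * P (X s / C0) + b * P (Y s / S0)" for s
  have sE': "s * E' s \<le> \<bar>h\<bar> * s - DD s" if s: "0 < s" "s < \<rho>" for s
  proof -
    have k: "s * (h - a * S s / x s + b * C s / y s) = h * s - a * S s * (1 / X s) + b * C s * (1 / Y s)"
      using s by (simp add: X_def Y_def algebra_simps)
    have "s * E' s = sd s * (s * (h - a * S s / x s + b * C s / y s))
      + a * (1 / C0 - 1 / X s) * (C s - X s) + b * (1 / S0 - 1 / Y s) * (S s - Y s)"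
      using s by (simp add: E'_def distrib_left)
    also have "\<dots> = h * s * sd s - (1 - cd s) * (a * C s * (1 / X s) + b * S s * (1 / Y s) + (a + b))
      - a * (X s / C0 - 2 + C0 * (1 / X s)) - b * (Y s / S0 - 2 + S0 * (1 / Y s))"
      unfolding k sd_def cd_def using XY[OF s] D(6)[OF s] by (intro lyapunov_identity) auto
    also have "\<dots> = h * s * sd s - (1 - cd s) * (a * C s * (1 / X s) + b * S s * (1 / Y s)) - DD s"
      by (simp add: DD_def P_def algebra_simps)
    also have "\<dots> \<le> \<bar>h\<bar> * s - 0 - DD s"
    proof (intro diff_mono order_refl)
      have "h * s * sd s \<le> \<bar>h * s * sd s\<bar>" by simp
      also have "\<dots> \<le> \<bar>h\<bar> * s * 1"
        unfolding abs_mult using s sc[OF s] by (intro mult_mono) auto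
      finally show "h * s * sd s \<le> \<bar>h\<bar> * s" by simp
      \<comment> \<open>The discarded term has a sign because both velocity components are positive
        near the cusp.\<close>
      show "0 \<le> (1 - cd s) * (a * C s * (1 / X s) + b * S s * (1 / Y s))"
        using sc[OF s] XY[OF s] pos[OF s] a b
        by (intro mult_nonneg_nonneg add_nonneg_nonneg) auto
    qed
    finally show ?thesis by simp
  qed
  have GP: "0 \<le> G t" "G t \<le> P t" if "t > 0" for t
    using log_deviation_bounds[OF that] by (auto simp: G_def P_def)
  have pos': "X s / C0 > 0" "Y s / S0 > 0" if "0 < s" "s < \<rho>" for s
    using XY[OF that] C0_pos S0_pos by auto
  have E0: "E s \<ge> 1 - cd s" and ED: "E s \<le> DD s" if s: "0 < s" "s < \<rho>" for s
  proof -
    have "1 - cd s \<le> (1 - cd s) * (a + b)" using sc[OF s] a b by (simp add: mult_le_cancel_left1)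
    moreover have "a * G (X s / C0) \<le> a * P (X s / C0)" "b * G (Y s / S0) \<le> b * P (Y s / S0)"
      "0 \<le> a * G (X s / C0)" "0 \<le> b * G (Y s / S0)"
      using GP[OF pos'(1)[OF s]] GP[OF pos'(2)[OF s]] a b by auto
    ultimately show "E s \<ge> 1 - cd s" "E s \<le> DD s"
      unfolding E_def DD_def cd_def by linarith+
  qed
  \<comment> \<open>Unit speed gives X, Y \<le> 1, so \<open>T\<close> bounds both arguments of
    \<open>G\<close>. The factor 24 in \<open>E2\<close> is 3, from squaring a sum of three terms,
    times the 8 of \<open>log_deviation_square_le\<close>.\<close>
  define T where "T = 1 / C0 + 1 / S0"
  define K where "K = 12 + 3 * a\<^sup>2 * (2 * T\<^sup>2 + 16) + 3 * b\<^sup>2 * (2 * T\<^sup>2 + 16)"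
  have K: "K \<ge> 0" by (simp add: K_def)
  have E2: "(E s)\<^sup>2 \<le> K + 24 * (a + b) * DD s" if s: "0 < s" "s < \<rho>" for s
  proof -
    have "X s / C0 \<le> 1 / C0" "Y s / S0 \<le> 1 / S0"
      using XY[OF s] C0_pos S0_pos by (auto intro: divide_right_mono)
    then have T: "X s / C0 \<le> T" "Y s / S0 \<le> T"
      using C0_pos S0_pos by (auto simp: T_def intro: add_increasing add_increasing2)
    have GX: "(G (X s / C0))\<^sup>2 \<le> 2 * T\<^sup>2 + 16 + 8 * P (X s / C0)"
      and GY: "(G (Y s / S0))\<^sup>2 \<le> 2 * T\<^sup>2 + 16 + 8 * P (Y s / S0)"
      unfolding G_def P_def using pos'[OF s] T by (intro log_deviation_square_le; simp)+
    have PX: "P (X s / C0) \<ge> 0" "P (Y s / S0) \<ge> 0"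
      using GP pos'[OF s] by (meson order_trans)+
    have four: "(1 - cd s)\<^sup>2 \<le> 2\<^sup>2" using sc[OF s] by (intro power_mono) auto
    have tri: "(p + q + r)\<^sup>2 \<le> 3 * p\<^sup>2 + 3 * q\<^sup>2 + 3 * r\<^sup>2" for p q r :: real
      using zero_le_power2[of "p - q"] zero_le_power2[of "p - r"] zero_le_power2[of "q - r"]
      by (simp add: power2_eq_square algebra_simps)
    have "(E s)\<^sup>2 \<le> 3 * (1 - cd s)\<^sup>2 + 3 * (a * G (X s / C0))\<^sup>2 + 3 * (b * G (Y s / S0))\<^sup>2"
      unfolding E_def cd_def by (rule tri)
    also have "\<dots> \<le> 3 * 4 + 3 * (a * G (X s / C0))\<^sup>2 + 3 * (b * G (Y s / S0))\<^sup>2"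
      using four by simp
    also have "\<dots> \<le> 3 * 4 + 3 * (a\<^sup>2 * (2 * T\<^sup>2 + 16 + 8 * P (X s / C0))) + 3 * (b\<^sup>2 * (2 * T\<^sup>2 + 16 + 8 * P (Y s / S0)))"
      unfolding power_mult_distrib using GX GY by (intro add_mono mult_left_mono order_refl) auto
    also have "\<dots> = K + 24 * (a * (a * P (X s / C0)) + b * (b * P (Y s / S0)))"
      by (simp add: K_def algebra_simps power2_eq_square)
    also have "\<dots> \<le> K + 24 * ((a + b) * (a * P (X s / C0)) + (a + b) * (b * P (Y s / S0)))"
      using a b PX by (intro add_mono mult_left_mono mult_right_mono order_refl) auto
    also have "\<dots> \<le> K + 24 * ((a + b) * DD s)"
      using a b sc[OF s] by (simp add: DD_def distrib_left)
    finally show ?thesis by (simp only: mult.assoc)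
  qed
  \<comment> \<open>Reciprocal of the coefficient of the dissipation in \<open>E2\<close>, so that c
    E^2 \<le> c K + \<open>DD\<close>.\<close>
  define c where "c = 1 / (24 * (a + b))"
  have c: "c > 0" using a b by (simp add: c_def)
  define Bd where "Bd = sqrt (2 * (\<bar>h\<bar> * \<rho> + c * K) / c) + 1"
  have bounded: "E s \<le> Bd" if s: "0 < s" "s < \<rho>" for s
    unfolding Bd_def
  proof (rule bounded_if_quadratic_damping[OF dE _ c _ s])
    show "t * E' t \<le> \<bar>h\<bar> * \<rho> + c * K - c * (E t)\<^sup>2" if t: "0 < t" "t < \<rho>" for t
    proof -
      have "c * (E t)\<^sup>2 \<le> c * (K + 24 * (a + b) * DD t)" using E2[OF t] c by (intro mult_left_mono) auto
      also have "\<dots> = c * K + DD t" using a b by (simp add: c_def distrib_left)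
      finally have "c * (E t)\<^sup>2 \<le> c * K + DD t" .
      moreover have "\<bar>h\<bar> * t \<le> \<bar>h\<bar> * \<rho>" using t by (intro mult_left_mono) auto
      ultimately show ?thesis using sE'[OF t] by linarith
    qed
    show "0 \<le> \<bar>h\<bar> * \<rho> + c * K" using \<rho> c K by simp
  qed
  have "((\<lambda>s. s * E s) \<longlongrightarrow> 0) (at_right 0)"
  proof (rule Lim_null_comparison)
    show "\<forall>\<^sub>F s in at_right 0. norm (s * E s) \<le> s * Bd"
    proof (rule eventually_at_rightI[OF _ \<rho>(1)])
      fix s assume "s \<in> {0<..<\<rho>}"
      then have s: "0 < s" "s < \<rho>" by auto
      have "0 \<le> E s" using E0[OF s] sc[OF s] by linarith
      then show "norm (s * E s) \<le> s * Bd" using s bounded[OF s] by (simp add: abs_mult mult_left_mono)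
    qed
    show "((\<lambda>s. s * Bd) \<longlongrightarrow> 0) (at_right 0)" by (auto intro!: tendsto_eq_intros)
  qed
  moreover have "((\<lambda>s. \<bar>h\<bar> * s\<^sup>2 / 2) \<longlongrightarrow> 0) (at_right 0)"
    by (auto intro!: tendsto_eq_intros)
  ultimately have lim: "((\<lambda>s. s * E s - \<bar>h\<bar> * s\<^sup>2 / 2) \<longlongrightarrow> 0) (at_right 0)"
    using tendsto_diff by fastforce
  have small: "1 - cd s \<le> \<bar>h\<bar> * s / 2" if s: "0 < s" "s < \<rho>" for s
  proof -
    have "s * E s - \<bar>h\<bar> * s\<^sup>2 / 2 \<le> 0"
    proof (rule le_limit_at_right_if_deriv_nonpos[OF _ _ lim s, of "\<lambda>s. E s + s * E' s - \<bar>h\<bar> * s"])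
      show "DERIV (\<lambda>s. s * E s - \<bar>h\<bar> * s\<^sup>2 / 2) t :> E t + t * E' t - \<bar>h\<bar> * t"
        if "0 < t" "t < \<rho>" for t
        using dE[OF that] by (auto intro!: derivative_eq_intros)
      show "E t + t * E' t - \<bar>h\<bar> * t \<le> 0" if "0 < t" "t < \<rho>" for t
        using sE'[OF that] ED[OF that] by linarith
    qed
    then have "s * E s \<le> s * (\<bar>h\<bar> * s / 2)" by (simp add: power2_eq_square mult.left_commute)
    then have "E s \<le> \<bar>h\<bar> * s / 2" using s by (simp only: mult_le_cancel_left_pos)
    then show ?thesis using E0[OF s] by linarith
  qed
  have dist: "(C s - C0)\<^sup>2 + (S s - S0)\<^sup>2 \<le> \<bar>h\<bar> * s" if s: "0 < s" "s < \<rho>" for s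
  proof -
    have "(C s - C0)\<^sup>2 + (S s - S0)\<^sup>2 = ((C s)\<^sup>2 + (S s)\<^sup>2) + (C0\<^sup>2 + S0\<^sup>2) - 2 * cd s"
      by (simp add: cd_def power2_eq_square algebra_simps)
    then show ?thesis using small[OF s] D(6)[OF s] C0_S0 by simp
  qed
  have null: "(f \<longlongrightarrow> l) (at_right 0)" if "\<And>s. 0 < s \<Longrightarrow> s < \<rho> \<Longrightarrow> (f s - l)\<^sup>2 \<le> \<bar>h\<bar> * s" for f l
  proof (rule LIM_zero_cancel, rule Lim_null_comparison)
    show "\<forall>\<^sub>F s in at_right 0. norm (f s - l) \<le> sqrt (\<bar>h\<bar> * s)"
      by (rule eventually_at_rightI[OF _ \<rho>(1)]) (use that in \<open>auto intro!: real_le_rsqrt\<close>)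
    show "((\<lambda>s. sqrt (\<bar>h\<bar> * s)) \<longlongrightarrow> 0) (at_right 0)" by (auto intro!: tendsto_eq_intros)
  qed
  show "(C \<longlongrightarrow> C0) (at_right 0)"
    by (rule null, rule order_trans[OF _ dist]) auto
  show "(S \<longlongrightarrow> S0) (at_right 0)"
    by (rule null, rule order_trans[OF _ dist]) auto
qed

lemma cusp_branch_ratio_tendsto:
  assumes B: "cusp_branch r x y C S"
  shows "((\<lambda>s. x s / s) \<longlongrightarrow> C0) (at_right 0)" "((\<lambda>s. y s / s) \<longlongrightarrow> S0) (at_right 0)"
proof -
  note D = cusp_branchD[OF B] and T = cusp_branch_velocity_tendsto[OF B]
  have ev: "\<forall>\<^sub>F s::real in at_right 0. s \<noteq> 0" "\<forall>\<^sub>F s::real in at_right 0. (1::real) \<noteq> 0"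
    "\<forall>\<^sub>F s::real in at_right 0. (DERIV (\<lambda>s. s) s :> 1)"
    by (auto simp: eventually_at_right_field intro: exI[of _ 1])
  have evx: "\<forall>\<^sub>F s in at_right 0. (DERIV x s :> C s)"
    "\<forall>\<^sub>F s in at_right 0. (DERIV y s :> S s)"
    by (rule eventually_at_rightI[OF _ D(1)]; use D(7,8) in auto)+
  show "((\<lambda>s. x s / s) \<longlongrightarrow> C0) (at_right 0)"
    using T(1) by (intro lhopital_right_0[OF D(2) tendsto_ident_at ev(1,2) evx(1) ev(3)]) simp
  show "((\<lambda>s. y s / s) \<longlongrightarrow> S0) (at_right 0)"
    using T(2) by (intro lhopital_right_0[OF D(3) tendsto_ident_at ev(1,2) evx(2) ev(3)]) simp
qed

text \<open>The squared distance \<open>Q\<close> of two branches in the variables \<open>x / s\<close>, \<open>y / s\<close>, \<open>C\<close>, \<open>S\<close> (the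
  first two weighted with \<open>a + b\<close>) tends to \<open>0\<close> at the cusp and is nonincreasing near it, because at
  the common limit point its derivative is a negative definite form.\<close>

lemma cusp_branch_unique_near_zero:
  assumes B1: "cusp_branch r x1 y1 C1 S1" and B2: "cusp_branch r x2 y2 C2 S2"
  obtains \<rho> where "0 < \<rho>" "\<rho> \<le> r"
    "\<And>s. 0 < s \<Longrightarrow> s < \<rho> \<Longrightarrow> x1 s = x2 s \<and> y1 s = y2 s \<and> C1 s = C2 s \<and> S1 s = S2 s"
proof -
  note D1 = cusp_branchD[OF B1] and D2 = cusp_branchD[OF B2]
  \<comment> \<open>Weighting the position differences with n makes the mixed coefficients
    \<open>e1\<close> and \<open>e2\<close> tend to 0, since a/C0^2 = b/S0^2 = n.\<close>
  define n where "n = a + b"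
  have n: "n \<ge> 2" using a b by (simp add: n_def)
  have "a / C0\<^sup>2 = n" "b / S0\<^sup>2 = n" using a b by (simp_all add: C0_sq S0_sq n_def)
  then have n': "a * S0 / (C0 * C0) = n * S0" "b * C0 / (S0 * S0) = n * C0"
    by (metis power2_eq_square times_divide_eq_left)+
  define X1 Y1 X2 Y2 where "X1 s = x1 s / s" and "Y1 s = y1 s / s" and "X2 s = x2 s / s" and "Y2 s = y2 s / s" for s
  note XY_def = X1_def Y1_def X2_def Y2_def
  \<comment> \<open>Both velocities are unit vectors, so their difference is orthogonal to their
    mean; it is w times the mean turned by a right angle, for a single scalar w. In s Q'/2 the
    coefficient of w^2 will be - \<open>g\<close>, and \<open>e1\<close>, \<open>e2\<close> are the
    coefficients of w times the position differences.\<close>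
  define \<beta>1 \<beta>2 where "\<beta>1 s = (C1 s + C2 s) / 2" and "\<beta>2 s = (S1 s + S2 s) / 2" for s
  define J where "J s = C2 s * \<beta>1 s + S2 s * \<beta>2 s" for s
  define g where "g s = J s * (a / X1 s * \<beta>1 s + b / Y1 s * \<beta>2 s)" for s
  define e1 where "e1 s = J s * (a * S2 s / (X1 s * X2 s)) - n * \<beta>2 s" for s
  define e2 where "e2 s = n * \<beta>1 s - J s * (b * C2 s / (Y1 s * Y2 s))" for s
  note T = cusp_branch_velocity_tendsto[OF B1] cusp_branch_velocity_tendsto[OF B2]
    cusp_branch_ratio_tendsto[OF B1] cusp_branch_ratio_tendsto[OF B2]
  note T = T[folded X1_def Y1_def X2_def Y2_def]
  have nz: "C0 \<noteq> 0" "S0 \<noteq> 0" using C0_pos S0_pos by auto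
  have T\<beta>: "(\<beta>1 \<longlongrightarrow> C0) (at_right 0)" "(\<beta>2 \<longlongrightarrow> S0) (at_right 0)"
    unfolding \<beta>1_def[abs_def] \<beta>2_def[abs_def] using T by (auto intro!: tendsto_eq_intros)
  have TJ: "(J \<longlongrightarrow> 1) (at_right 0)"
    unfolding J_def[abs_def]
    using tendsto_add[OF tendsto_mult[OF T(3) T\<beta>(1)] tendsto_mult[OF T(4) T\<beta>(2)]] C0_S0
    by (simp add: power2_eq_square)
  have "(g \<longlongrightarrow> 1 * (a / C0 * C0 + b / S0 * S0)) (at_right 0)"
    unfolding g_def[abs_def] by (intro tendsto_intros TJ T T\<beta> nz)
  then have Tg: "(g \<longlongrightarrow> n) (at_right 0)" using nz by (simp add: n_def)
  have "(e1 \<longlongrightarrow> 1 * (a * S0 / (C0 * C0)) - n * S0) (at_right 0)"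
    unfolding e1_def[abs_def] by (intro tendsto_intros TJ T T\<beta>) (use nz in simp)
  then have Te1: "(e1 \<longlongrightarrow> 0) (at_right 0)" by (simp add: n')
  have "(e2 \<longlongrightarrow> n * C0 - 1 * (b * C0 / (S0 * S0))) (at_right 0)"
    unfolding e2_def[abs_def] by (intro tendsto_intros TJ T T\<beta>) (use nz in simp)
  then have Te2: "(e2 \<longlongrightarrow> 0) (at_right 0)" by (simp add: n')
  \<comment> \<open>With n \<ge> 2 these thresholds make the form nonpositive: the mixed terms cost
    at most w^2 and half of each squared position difference.\<close>
  have "\<forall>\<^sub>F s in at_right 0. g s > 1 \<and> e1 s < 1 \<and> e1 s > -1 \<and> e2 s < 1 \<and> e2 s > -1 \<and> \<beta>1 s > 0 \<and> \<beta>2 s > 0"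
    using n by (intro eventually_conj order_tendstoD[OF Tg] order_tendstoD[OF Te1] order_tendstoD[OF Te2]
        order_tendstoD[OF T\<beta>(1)] order_tendstoD[OF T\<beta>(2)] C0_pos S0_pos) auto
  then obtain \<rho>0 where \<rho>0: "\<rho>0 > 0" "\<And>s. 0 < s \<Longrightarrow> s < \<rho>0 \<Longrightarrow>
      g s > 1 \<and> e1 s < 1 \<and> e1 s > -1 \<and> e2 s < 1 \<and> e2 s > -1 \<and> \<beta>1 s > 0 \<and> \<beta>2 s > 0"
    unfolding eventually_at_right_field by blast
  define \<rho> where "\<rho> = min r \<rho>0"
  have \<rho>: "0 < \<rho>" "\<rho> \<le> r" using \<rho>0 D1(1) by (auto simp: \<rho>_def)
  define Q where "Q s = n * (X1 s - X2 s)\<^sup>2 + n * (Y1 s - Y2 s)\<^sup>2 + (C1 s - C2 s)\<^sup>2 + (S1 s - S2 s)\<^sup>2" for s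
  define \<kappa>1 \<kappa>2 where "\<kappa>1 s = h - a * S1 s / x1 s + b * C1 s / y1 s"
    and "\<kappa>2 s = h - a * S2 s / x2 s + b * C2 s / y2 s" for s
  define Q' where "Q' s = 2 * (n * (X1 s - X2 s) * ((C1 s - X1 s) / s - (C2 s - X2 s) / s)
      + n * (Y1 s - Y2 s) * ((S1 s - Y1 s) / s - (S2 s - Y2 s) / s)
      + (C1 s - C2 s) * (- S1 s * \<kappa>1 s - - S2 s * \<kappa>2 s) + (S1 s - S2 s) * (C1 s * \<kappa>1 s - C2 s * \<kappa>2 s))" for s
  have "Q s \<le> 0" if s: "0 < s" "s < \<rho>" for s
  proof (rule le_limit_at_right_if_deriv_nonpos[of \<rho> Q Q' 0 s])
    have "(Q \<longlongrightarrow> n * (C0 - C0)\<^sup>2 + n * (S0 - S0)\<^sup>2 + (C0 - C0)\<^sup>2 + (S0 - S0)\<^sup>2) (at_right 0)"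
      unfolding Q_def[abs_def] by (intro tendsto_intros T)
    then show "(Q \<longlongrightarrow> 0) (at_right 0)" by simp
    show "DERIV Q t :> Q' t" if t: "0 < t" "t < \<rho>" for t
    proof -
      have tr: "0 < t" "t < r" using t \<rho> by auto
      have dXY: "DERIV X1 t :> (C1 t - X1 t) / t" "DERIV X2 t :> (C2 t - X2 t) / t"
        "DERIV Y1 t :> (S1 t - Y1 t) / t" "DERIV Y2 t :> (S2 t - Y2 t) / t"
        unfolding XY_def[abs_def] using D1(7,8)[OF tr] D2(7,8)[OF tr] tr
        by (auto intro!: derivative_eq_intros simp: power2_eq_square field_simps)
      have sq: "DERIV (\<lambda>s. (f s - g s)\<^sup>2) t :> 2 * ((f t - g t) * (f' - g'))"
        if "DERIV f t :> f'" "DERIV g t :> g'" for f g f' g'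
        using that by (auto intro!: derivative_eq_intros)
      have dist: "n * (2 * (p * p')) + n * (2 * (q * q')) + 2 * (c * c') + 2 * (d * d')
        = 2 * (n * p * p' + n * q * q' + c * c' + d * d')" for p p' q q' c c' d d' :: real
        by (simp add: algebra_simps)
      show ?thesis
        unfolding Q_def[abs_def] Q'_def \<kappa>1_def \<kappa>2_def
        by (rule DERIV_cong[OF DERIV_add[OF DERIV_add[OF DERIV_add[OF
            DERIV_cmult[OF sq[OF dXY(1,2)], of n] DERIV_cmult[OF sq[OF dXY(3,4)], of n]]
            sq[OF D1(9)[OF tr] D2(9)[OF tr]]] sq[OF D1(10)[OF tr] D2(10)[OF tr]]]])
          (rule dist)
    qed
    show "Q' t \<le> 0" if t: "0 < t" "t < \<rho>" for t
    proof -
      have tr: "0 < t" "t < r" using t \<rho> by auto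
      have small: "g t > 1" "\<bar>e1 t\<bar> \<le> 1" "\<bar>e2 t\<bar> \<le> 1" "\<beta>1 t > 0" "\<beta>2 t > 0"
        using \<rho>0(2)[of t] t by (auto simp: \<rho>_def)
      have XYp: "X1 t > 0" "X2 t > 0" "Y1 t > 0" "Y2 t > 0"
        using D1(4,5)[OF tr] D2(4,5)[OF tr] t by (auto simp: XY_def)
      define w where "w = ((S1 t - S2 t) * \<beta>1 t - (C1 t - C2 t) * \<beta>2 t) / ((\<beta>1 t)\<^sup>2 + (\<beta>2 t)\<^sup>2)"
      have bb: "(\<beta>1 t)\<^sup>2 + (\<beta>2 t)\<^sup>2 > 0" using small by (simp add: add_pos_pos)
      have wb: "w * ((\<beta>1 t)\<^sup>2 + (\<beta>2 t)\<^sup>2) = (S1 t - S2 t) * \<beta>1 t - (C1 t - C2 t) * \<beta>2 t"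
        using bb unfolding w_def by simp
      have orth: "\<beta>1 t * (C1 t - C2 t) + \<beta>2 t * (S1 t - S2 t) = 0"
        using D1(6)[OF tr] D2(6)[OF tr]
        by (simp add: \<beta>1_def \<beta>2_def power2_eq_square square_diff_square_factored[symmetric]
            add_divide_distrib[symmetric])
      have "((\<beta>1 t)\<^sup>2 + (\<beta>2 t)\<^sup>2) * (C1 t - C2 t) = ((\<beta>1 t)\<^sup>2 + (\<beta>2 t)\<^sup>2) * (- \<beta>2 t * w)"
        "((\<beta>1 t)\<^sup>2 + (\<beta>2 t)\<^sup>2) * (S1 t - S2 t) = ((\<beta>1 t)\<^sup>2 + (\<beta>2 t)\<^sup>2) * (\<beta>1 t * w)"
        using wb orth by algebra+
      then have cs: "C1 t - C2 t = - \<beta>2 t * w" "S1 t - S2 t = \<beta>1 t * w"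
        using bb by (simp_all only: mult_cancel_left) auto
      define u1 u2 v1 v2 where "u1 = 1 / X1 t" "u2 = 1 / X2 t" "v1 = 1 / Y1 t" "v2 = 1 / Y2 t"
      note uv_def = this
      have uv: "u1 * X1 t = 1" "u2 * X2 t = 1" "v1 * Y1 t = 1" "v2 * Y2 t = 1"
        using XYp by (simp_all add: uv_def)
      have \<kappa>: "t * \<kappa>1 t = h * t - a * S1 t * u1 + b * C1 t * v1" "t * \<kappa>2 t = h * t - a * S2 t * u2 + b * C2 t * v2"
        using t by (simp_all add: \<kappa>1_def \<kappa>2_def uv_def XY_def algebra_simps)
      have ge: "g t = J t * (a * u1 * \<beta>1 t + b * v1 * \<beta>2 t)" "e1 t = J t * (a * S2 t * u1 * u2) - n * \<beta>2 t"
        "e2 t = n * \<beta>1 t - J t * (b * C2 t * v1 * v2)"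
        by (simp_all add: g_def e1_def e2_def uv_def)
      have J: "J t = C2 t * \<beta>1 t + S2 t * \<beta>2 t" by (simp add: J_def)
      define \<Delta>X \<Delta>Y where "\<Delta>X = X1 t - X2 t" "\<Delta>Y = Y1 t - Y2 t"
      note \<Delta> = this
      have "t * Q' t / 2 = n * \<Delta>X * ((C1 t - C2 t) - \<Delta>X) + n * \<Delta>Y * ((S1 t - S2 t) - \<Delta>Y)
        + (C1 t - C2 t) * (- S1 t * (t * \<kappa>1 t) + S2 t * (t * \<kappa>2 t))
        + (S1 t - S2 t) * (C1 t * (t * \<kappa>1 t) - C2 t * (t * \<kappa>2 t))"
      proof -
        have gen: "t * (2 * (n * dx * p + n * dy * q + c * u + d * v)) / 2
          = n * dx * (t * p) + n * dy * (t * q) + c * (t * u) + d * (t * v)" for dx dy p q c u d v :: real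
          by (simp add: algebra_simps)
        have pq: "t * ((C1 t - X1 t) / t - (C2 t - X2 t) / t) = (C1 t - C2 t) - \<Delta>X"
          "t * ((S1 t - Y1 t) / t - (S2 t - Y2 t) / t) = (S1 t - S2 t) - \<Delta>Y"
          using t unfolding \<Delta> right_diff_distrib[of t "_ / _"] by simp_all
        have uv: "t * (- S1 t * \<kappa>1 t - - S2 t * \<kappa>2 t) = - S1 t * (t * \<kappa>1 t) + S2 t * (t * \<kappa>2 t)"
          "t * (C1 t * \<kappa>1 t - C2 t * \<kappa>2 t) = C1 t * (t * \<kappa>1 t) - C2 t * (t * \<kappa>2 t)"
          by (simp_all add: algebra_simps)
        show ?thesis unfolding Q'_def gen pq uv unfolding \<Delta> ..
      qed
      also have "\<dots> = - n * \<Delta>X\<^sup>2 - n * \<Delta>Y\<^sup>2 - g t * w\<^sup>2 + w * (e1 t * \<Delta>X + e2 t * \<Delta>Y)"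
        using uv cs \<kappa> ge J \<Delta> by algebra
      also have "\<dots> \<le> 0"
      proof -
        have "n * \<Delta>X\<^sup>2 \<ge> 2 * \<Delta>X\<^sup>2" "n * \<Delta>Y\<^sup>2 \<ge> 2 * \<Delta>Y\<^sup>2" "g t * w\<^sup>2 \<ge> 1 * w\<^sup>2"
          using n small by (intro mult_right_mono; simp)+
        moreover have "w * (e * z) \<le> w\<^sup>2 / 2 + z\<^sup>2 / 2" if "\<bar>e\<bar> \<le> 1" for e z
        proof -
          have "w * (e * z) \<le> \<bar>e\<bar> * (\<bar>w\<bar> * \<bar>z\<bar>)"
            using abs_ge_self[of "w * (e * z)"] by (simp add: abs_mult mult_ac)
          also have "\<dots> \<le> 1 * (\<bar>w\<bar> * \<bar>z\<bar>)" using that by (intro mult_right_mono) auto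
          also have "\<dots> \<le> w\<^sup>2 / 2 + z\<^sup>2 / 2"
            using zero_le_power2[of "\<bar>w\<bar> - \<bar>z\<bar>"] by (simp add: power2_diff)
          finally show ?thesis .
        qed
        from this[OF small(2), of \<Delta>X] this[OF small(3), of \<Delta>Y]
        have "w * (e1 t * \<Delta>X + e2 t * \<Delta>Y) \<le> w\<^sup>2 + \<Delta>X\<^sup>2 / 2 + \<Delta>Y\<^sup>2 / 2" by (simp add: distrib_left)
        ultimately show ?thesis using zero_le_power2[of \<Delta>X] zero_le_power2[of \<Delta>Y] by linarith
      qed
      finally have "t * Q' t \<le> 0" by simp
      then show ?thesis using t by (simp add: mult_le_0_iff)
    qed
  qed (use s in auto)
  then have "x1 s = x2 s \<and> y1 s = y2 s \<and> C1 s = C2 s \<and> S1 s = S2 s" if s: "0 < s" "s < \<rho>" for s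
  proof -
    have "n * (X1 s - X2 s)\<^sup>2 \<ge> 0" "n * (Y1 s - Y2 s)\<^sup>2 \<ge> 0" using n by auto
    moreover have "Q s \<le> 0" using \<open>\<And>s. 0 < s \<Longrightarrow> s < \<rho> \<Longrightarrow> Q s \<le> 0\<close> s by blast
    ultimately have "n * (X1 s - X2 s)\<^sup>2 = 0" "n * (Y1 s - Y2 s)\<^sup>2 = 0" "(C1 s - C2 s)\<^sup>2 = 0" "(S1 s - S2 s)\<^sup>2 = 0"
      using zero_le_power2[of "C1 s - C2 s"] zero_le_power2[of "S1 s - S2 s"] unfolding Q_def by linarith+
    then show ?thesis using n s by (auto simp: XY_def)
  qed
  then show ?thesis using that \<rho> by blast
qed

end

section \<open>Continuation of the branch\<close>

lemma has_real_derivative_glue: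
  fixes f g :: "real \<Rightarrow> real"
  assumes "s \<le> c \<Longrightarrow> (DERIV f s :> d s)"
    and "s \<ge> c \<Longrightarrow> (g has_real_derivative e s) (at s within {c..})"
    and "f c = g c" "d c = e c"
  shows "DERIV (\<lambda>s. if s \<le> c then f s else g s) s :> (if s \<le> c then d s else e s)"
proof -
  have sets: "{..c} \<union> (closure {..c} \<inter> closure {c<..}) = {..c}"
    "{c<..} \<union> (closure {..c} \<inter> closure {c<..}) = {c..}"
    and cl: "s \<in> closure {..c} \<Longrightarrow> s \<in> closure {c<..} \<Longrightarrow> s = c"
    by auto
  have "((\<lambda>s. if s \<in> {..c} then f s else g s) has_vector_derivative (if s \<in> {..c} then d s else e s)) (at s within UNIV)"
    by (rule has_vector_derivative_If_within_closures[where T = "{c<..}"], unfold sets)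
      (use assms cl in \<open>auto simp: has_real_derivative_iff_has_vector_derivative
         intro: has_vector_derivative_at_within\<close>)
  then show ?thesis by (simp add: has_real_derivative_iff_has_vector_derivative)
qed

lemma abs_cos_diff_le: "\<bar>cos u - cos v\<bar> \<le> \<bar>u - v :: real\<bar>"
  and abs_sin_diff_le: "\<bar>sin u - sin v\<bar> \<le> \<bar>u - v\<bar>"
proof -
  have *: "\<bar>2 * p * sin ((w - z) / 2)\<bar> \<le> \<bar>w - z\<bar>" if "\<bar>p\<bar> \<le> 1" for p w z :: real
  proof -
    have "\<bar>2 * p * sin ((w - z) / 2)\<bar> = 2 * (\<bar>p\<bar> * \<bar>sin ((w - z) / 2)\<bar>)" by (simp add: abs_mult)
    also have "\<dots> \<le> 2 * (1 * \<bar>(w - z) / 2\<bar>)"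
      by (intro mult_left_mono mult_mono that abs_sin_x_le_abs_x) simp_all
    finally show ?thesis by simp
  qed
  show "\<bar>cos u - cos v\<bar> \<le> \<bar>u - v\<bar>"
    using *[of "sin ((u + v) / 2)" v u] by (simp add: cos_diff_cos abs_minus_commute)
  show "\<bar>sin u - sin v\<bar> \<le> \<bar>u - v\<bar>"
    using *[of "cos ((u + v) / 2)" u v] by (simp add: sin_diff_sin mult_ac)
qed

text \<open>Used with active truncation for the modified field of the continuation and, where the
  denominators exceed \<open>\<delta>\<close>, with inactive truncation for comparing two
  branches.\<close>

lemma abs_divide_max_diff_le:
  fixes p q z w \<delta> :: real
  assumes "\<delta> > 0" "\<bar>q\<bar> \<le> 1"
  shows "\<bar>p / max z \<delta> - q / max w \<delta>\<bar> \<le> \<bar>p - q\<bar> / \<delta> + \<bar>z - w\<bar> / \<delta>\<^sup>2"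
proof -
  define Z W where "Z = max z \<delta>" and "W = max w \<delta>"
  have ZW: "Z \<ge> \<delta>" "W \<ge> \<delta>" "Z > 0" "W > 0" "\<bar>W - Z\<bar> \<le> \<bar>z - w\<bar>"
    using assms by (auto simp: Z_def W_def max_def)
  have "p / Z - q / W = (p - q) / Z + q * ((W - Z) / (Z * W))"
    using ZW by (simp add: field_simps)
  then have "\<bar>p / Z - q / W\<bar> \<le> \<bar>p - q\<bar> / Z + \<bar>q\<bar> * (\<bar>W - Z\<bar> / (Z * W))"
    using ZW abs_triangle_ineq[of "(p - q) / Z" "q * ((W - Z) / (Z * W))"]
    by (simp add: abs_mult abs_divide)
  also have "\<dots> \<le> \<bar>p - q\<bar> / \<delta> + 1 * (\<bar>z - w\<bar> / (\<delta> * \<delta>))"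
    using ZW assms by (intro add_mono mult_mono divide_left_mono frac_le mult_pos_pos) auto
  finally show ?thesis by (simp add: Z_def W_def power2_eq_square)
qed

context cone
begin

text \<open>Gronwall on [s, T]: by compactness x and y stay above some \<open>\<delta>\<close>
  there, which bounds the difference of the curvatures by that of the states; hence exp (- L t) Q is
  nonincreasing, and it starts at 0.\<close>

lemma branch_on_unique_forward:
  assumes B1: "branch_on {0<..} x1 y1 C1 S1" and B2: "branch_on {0<..} x2 y2 C2 S2"
    and eq: "x1 s = x2 s" "y1 s = y2 s" "C1 s = C2 s" "S1 s = S2 s" and s: "0 < s" "s \<le> T"
  shows "x1 T = x2 T \<and> y1 T = y2 T \<and> C1 T = C2 T \<and> S1 T = S2 T"
proof -
  note D1 = B1[unfolded branch_on_def, rule_format, unfolded greaterThan_iff]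
  note D2 = B2[unfolded branch_on_def, rule_format, unfolded greaterThan_iff]
  have ic: "isCont x1 t" "isCont x2 t" "isCont y1 t" "isCont y2 t" if "t > 0" for t
    using D1[OF that] D2[OF that] DERIV_isCont by blast+
  have cont: "continuous_on {s..T} x1" "continuous_on {s..T} x2" "continuous_on {s..T} y1" "continuous_on {s..T} y2"
    by (rule continuous_at_imp_continuous_on, rule ballI, rule ic, use s in simp)+
  define mm where "mm t = min (min (x1 t) (x2 t)) (min (y1 t) (y2 t))" for t
  have "continuous_on {s..T} mm" unfolding mm_def[abs_def] by (intro continuous_intros cont)
  then obtain z where z: "z \<in> {s..T}" "\<And>t. t \<in> {s..T} \<Longrightarrow> mm z \<le> mm t"
    using continuous_attains_inf[of "{s..T}" mm] s by auto
  define \<delta> where "\<delta> = mm z"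
  have \<delta>: "\<delta> > 0" using D1[of z] D2[of z] z s by (auto simp: \<delta>_def mm_def)
  have ge: "x1 t \<ge> \<delta>" "x2 t \<ge> \<delta>" "y1 t \<ge> \<delta>" "y2 t \<ge> \<delta>" if "s \<le> t" "t \<le> T" for t
    using z(2)[of t] that by (auto simp: \<delta>_def mm_def)
  define K where "K = (a + b) * (1 / \<delta> + 1 / \<delta>\<^sup>2)"
  have K: "K \<ge> 0" using a b \<delta> by (simp add: K_def)
  define L where "L = 4 + 16 * K"
  define \<kappa>1 \<kappa>2 where "\<kappa>1 t = h - a * S1 t / x1 t + b * C1 t / y1 t"
    and "\<kappa>2 t = h - a * S2 t / x2 t + b * C2 t / y2 t" for t
  define Q where "Q t = (x1 t - x2 t)\<^sup>2 + (y1 t - y2 t)\<^sup>2 + (C1 t - C2 t)\<^sup>2 + (S1 t - S2 t)\<^sup>2" for t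
  define Q' where "Q' t = 2 * ((x1 t - x2 t) * (C1 t - C2 t)) + 2 * ((y1 t - y2 t) * (S1 t - S2 t))
     + 2 * ((C1 t - C2 t) * (- S1 t * \<kappa>1 t - - S2 t * \<kappa>2 t))
     + 2 * ((S1 t - S2 t) * (C1 t * \<kappa>1 t - C2 t * \<kappa>2 t))" for t
  have dQ: "DERIV Q t :> Q' t" if t: "t > 0" for t
  proof -
    have sq: "DERIV (\<lambda>s. (f s - g s)\<^sup>2) t :> 2 * ((f t - g t) * (f' - g'))"
      if "DERIV f t :> f'" "DERIV g t :> g'" for f g f' g'
      using that by (auto intro!: derivative_eq_intros)
    show ?thesis
      unfolding Q_def[abs_def] Q'_def \<kappa>1_def \<kappa>2_def
      using D1[OF t] D2[OF t] by (intro DERIV_add sq) auto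
  qed
  have Q'_le: "Q' t \<le> L * Q t" if t: "s \<le> t" "t \<le> T" for t
  proof -
    have t0: "t > 0" using s t by simp
    define q where "q = sqrt (Q t)"
    have Q0: "Q t \<ge> 0" by (simp add: Q_def)
    have q: "q \<ge> 0" "q * q = Q t" using Q0 by (simp_all add: q_def)
    have le: "\<bar>x1 t - x2 t\<bar> \<le> q" "\<bar>y1 t - y2 t\<bar> \<le> q" "\<bar>C1 t - C2 t\<bar> \<le> q" "\<bar>S1 t - S2 t\<bar> \<le> q"
      unfolding q_def by (rule real_le_rsqrt; simp add: Q_def)+
    have "(C2 t)\<^sup>2 \<le> 1" "(S2 t)\<^sup>2 \<le> 1"
      using D2[OF t0] zero_le_power2[of "C2 t"] zero_le_power2[of "S2 t"] by linarith+
    then have one: "\<bar>C2 t\<bar> \<le> 1" "\<bar>S2 t\<bar> \<le> 1" by (simp_all add: abs_square_le_1)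
    have mx: "max (x1 t) \<delta> = x1 t" "max (x2 t) \<delta> = x2 t" "max (y1 t) \<delta> = y1 t" "max (y2 t) \<delta> = y2 t"
      using ge[OF t] by auto
    have "\<bar>S1 t / x1 t - S2 t / x2 t\<bar> \<le> q / \<delta> + q / \<delta>\<^sup>2"
      using abs_divide_max_diff_le[OF \<delta> one(2), of "S1 t" "x1 t" "x2 t"] le \<delta> unfolding mx
      by (elim order_trans) (intro add_mono divide_right_mono; simp)
    moreover have "\<bar>C1 t / y1 t - C2 t / y2 t\<bar> \<le> q / \<delta> + q / \<delta>\<^sup>2"
      using abs_divide_max_diff_le[OF \<delta> one(1), of "C1 t" "y1 t" "y2 t"] le \<delta> unfolding mx
      by (elim order_trans) (intro add_mono divide_right_mono; simp)
    moreover have "\<bar>\<kappa>1 t - \<kappa>2 t\<bar> \<le> a * \<bar>S1 t / x1 t - S2 t / x2 t\<bar> + b * \<bar>C1 t / y1 t - C2 t / y2 t\<bar>"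
    proof -
      have "\<kappa>1 t - \<kappa>2 t = - (a * (S1 t / x1 t - S2 t / x2 t)) + b * (C1 t / y1 t - C2 t / y2 t)"
        by (simp add: \<kappa>1_def \<kappa>2_def algebra_simps)
      also have "\<bar>\<dots>\<bar> \<le> \<bar>a * (S1 t / x1 t - S2 t / x2 t)\<bar> + \<bar>b * (C1 t / y1 t - C2 t / y2 t)\<bar>"
        by linarith
      finally show ?thesis using a b by (simp add: abs_mult)
    qed
    ultimately have "\<bar>\<kappa>1 t - \<kappa>2 t\<bar> \<le> a * (q / \<delta> + q / \<delta>\<^sup>2) + b * (q / \<delta> + q / \<delta>\<^sup>2)"
      using a b by (elim order_trans) (intro add_mono mult_left_mono; simp)
    also have "\<dots> = K * q" by (simp add: K_def algebra_simps add_divide_distrib)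
    finally have \<kappa>: "\<bar>\<kappa>1 t - \<kappa>2 t\<bar> \<le> K * q" .
    have "\<bar>C2 t * (S1 t - S2 t)\<bar> \<le> 1 * q" "\<bar>S2 t * (C1 t - C2 t)\<bar> \<le> 1 * q"
      unfolding abs_mult using one le by (intro mult_mono; simp)+
    then have cs: "\<bar>C2 t * (S1 t - S2 t) - S2 t * (C1 t - C2 t)\<bar> \<le> 2 * q" by linarith
    have prod: "u * v \<le> A * B" if "\<bar>u\<bar> \<le> A" "\<bar>v\<bar> \<le> B" for u v A B :: real
    proof -
      have "u * v \<le> \<bar>u\<bar> * \<bar>v\<bar>" by (metis abs_ge_self abs_mult)
      also have "\<dots> \<le> A * B" using that by (intro mult_mono) auto
      finally show ?thesis .
    qed
    \<comment> \<open>After regrouping, the curvatures enter only through their difference.\<close>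
    have "Q' t = 2 * ((x1 t - x2 t) * (C1 t - C2 t) + (y1 t - y2 t) * (S1 t - S2 t)
        + (C2 t * (S1 t - S2 t) - S2 t * (C1 t - C2 t)) * (\<kappa>1 t - \<kappa>2 t))"
      by (simp add: Q'_def algebra_simps)
    also have "\<dots> \<le> 2 * (q * q + q * q + (2 * q) * (K * q))"
      using prod le cs \<kappa> by (intro mult_left_mono add_mono) auto
    also have "\<dots> = (4 + 4 * K) * Q t" unfolding q(2)[symmetric] by (simp add: algebra_simps)
    also have "\<dots> \<le> L * Q t" using Q0 K by (intro mult_right_mono) (auto simp: L_def)
    finally show ?thesis .
  qed
  have "exp (- L * T) * Q T \<le> exp (- L * s) * Q s"
  proof (rule DERIV_nonpos_imp_nonincreasing[OF s(2)])
    fix t assume t: "s \<le> t" "t \<le> T"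
    have "DERIV (\<lambda>t. exp (- L * t) * Q t) t :> exp (- L * t) * (Q' t - L * Q t)"
      using dQ[of t] s t by (auto intro!: derivative_eq_intros simp: algebra_simps)
    moreover have "exp (- L * t) * (Q' t - L * Q t) \<le> 0"
      using Q'_le[OF t] by (simp add: mult_le_0_iff)
    ultimately show "\<exists>d. (DERIV (\<lambda>t. exp (- L * t) * Q t) t :> d) \<and> d \<le> 0" by blast
  qed
  moreover have "Q s = 0" by (simp add: Q_def eq)
  ultimately have "Q T \<le> 0" by (simp add: mult_le_0_iff)
  then have "(x1 T - x2 T)\<^sup>2 = 0" "(y1 T - y2 T)\<^sup>2 = 0" "(C1 T - C2 T)\<^sup>2 = 0" "(S1 T - S2 T)\<^sup>2 = 0"
    using zero_le_power2[of "x1 T - x2 T"] zero_le_power2[of "y1 T - y2 T"]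
      zero_le_power2[of "C1 T - C2 T"] zero_le_power2[of "S1 T - S2 T"]
    unfolding Q_def by linarith+
  then show ?thesis by simp
qed

text \<open>The factor Z^\<open>\<alpha>\<close> absorbs the singular term - \<open>\<alpha>\<close>
  \<open>\<sigma>\<close>/Z, and the summand k Z/(\<open>\<alpha>\<close> + 1) absorbs the constant
  k; what remains has the sign of \<open>\<beta>\<close>. It is stated for one coordinate so as to
  serve for x with velocities (C, S) and k = h, and for y with the velocities exchanged and k = -
  h.\<close>

lemma monotone_quantity:
  fixes Z \<sigma> :: "real \<Rightarrow> real"
  assumes "DERIV Z s :> \<gamma>" "DERIV \<sigma> s :> \<gamma> * (k - \<alpha> * \<sigma> s / Z s + \<beta> * \<gamma> / V)"
    and pos: "Z s > 0" "\<alpha> > 0" "V > 0"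
  shows "DERIV (\<lambda>s. Z s powr \<alpha> * (\<sigma> s - k * Z s / (\<alpha> + 1))) s :> \<beta> * (Z s powr \<alpha>) * \<gamma>\<^sup>2 / V"
proof -
  define P where "P = Z s powr (\<alpha> - 1)"
  have PZ: "Z s powr \<alpha> = P * Z s"
    unfolding P_def using pos powr_add[of "Z s" "\<alpha> - 1" 1] by simp
  have dP: "DERIV (\<lambda>s. Z s powr \<alpha>) s :> \<alpha> * P * \<gamma>"
    unfolding P_def using DERIV_chain2[OF has_real_derivative_powr[OF pos(1)] assms(1)] .
  have "((\<lambda>s. Z s powr \<alpha> * (\<sigma> s - k * Z s / (\<alpha> + 1))) has_real_derivative
      \<alpha> * P * \<gamma> * (\<sigma> s - k * Z s / (\<alpha> + 1))
      + (\<gamma> * (k - \<alpha> * \<sigma> s / Z s + \<beta> * \<gamma> / V) - k * \<gamma> / (\<alpha> + 1)) * (P * Z s)) (at s)"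
    by (rule DERIV_cong[OF DERIV_mult[OF dP DERIV_diff[OF assms(2) DERIV_cdivide[OF DERIV_cmult[OF assms(1)]]]]])
      (simp add: PZ)
  moreover have "\<alpha> * P * \<gamma> * (\<sigma> s - k * Z s / (\<alpha> + 1))
      + (\<gamma> * (k - \<alpha> * \<sigma> s / Z s + \<beta> * \<gamma> / V) - k * \<gamma> / (\<alpha> + 1)) * (P * Z s) = \<beta> * (P * Z s) * \<gamma>\<^sup>2 / V"
  proof -
    define j e w where "j = k / (\<alpha> + 1)" and "e = 1 / Z s" and "w = 1 / V"
    have "(\<alpha> + 1) * j = k" "e * Z s = 1" using pos by (simp_all add: j_def e_def)
    moreover have "\<alpha> * P * \<gamma> * (\<sigma> s - j * Z s)
      + (\<gamma> * (k - \<alpha> * \<sigma> s * e + \<beta> * \<gamma> * w) - j * \<gamma>) * (P * Z s) = \<beta> * (P * Z s) * \<gamma>\<^sup>2 * w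
      + \<alpha> * P * \<gamma> * \<sigma> s * (1 - e * Z s) + \<gamma> * P * Z s * (k - (\<alpha> + 1) * j)"
      by (simp add: algebra_simps power2_eq_square)
    ultimately have "\<alpha> * P * \<gamma> * (\<sigma> s - j * Z s)
      + (\<gamma> * (k - \<alpha> * \<sigma> s * e + \<beta> * \<gamma> * w) - j * \<gamma>) * (P * Z s) = \<beta> * (P * Z s) * \<gamma>\<^sup>2 * w"
      by simp
    then show ?thesis by (simp add: j_def e_def w_def)
  qed
  ultimately show ?thesis by (simp add: PZ)
qed

text \<open>For u \<le> 1 the monotone quantity is at most u (1 + |k|), because
  \<open>\<alpha>\<close> \<ge> 1; a small u would therefore contradict the lower bound F.\<close>

lemma ge_of_monotone_quantity:
  fixes u w k \<alpha> F \<delta> :: real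
  assumes F: "F \<le> u powr \<alpha> * (w - k * u / (\<alpha> + 1))" "F > 0"
    and "u > 0" "\<alpha> \<ge> 1" "w \<le> 1" "2 * \<delta> \<le> 1" "2 * \<delta> * (1 + \<bar>k\<bar>) \<le> F"
  shows "u \<ge> 2 * \<delta>"
proof (rule ccontr)
  assume "\<not> u \<ge> 2 * \<delta>"
  then have u: "u < 2 * \<delta>" "u \<le> 1" using assms by auto
  have "\<bar>k * u / (\<alpha> + 1)\<bar> \<le> \<bar>k\<bar>"
  proof -
    have "u / (\<alpha> + 1) \<le> 1" "u / (\<alpha> + 1) \<ge> 0" using assms u by simp_all
    then have "\<bar>k\<bar> * (u / (\<alpha> + 1)) \<le> \<bar>k\<bar> * 1" by (intro mult_left_mono) auto
    then show ?thesis using assms by (simp add: abs_mult abs_divide)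
  qed
  then have "w - k * u / (\<alpha> + 1) \<le> 1 + \<bar>k\<bar>" using assms by linarith
  then have "F \<le> u powr \<alpha> * (1 + \<bar>k\<bar>)" using F(1) by (meson mult_left_mono order_trans powr_ge_zero)
  also have "\<dots> \<le> u powr 1 * (1 + \<bar>k\<bar>)"
    using assms u by (intro mult_right_mono powr_mono') auto
  also have "\<dots> < 2 * \<delta> * (1 + \<bar>k\<bar>)" using u assms by (simp add: mult_strict_right_mono add_pos_nonneg)
  finally show False using assms by linarith
qed

text \<open>
  The quantities of \<open>monotone_quantity\<close> are nondecreasing along a branch and positive near the
  cusp, so \<open>x\<close> and \<open>y\<close> stay above some \<open>2 \<delta> > 0\<close>; hence the branch can be continued with the
  globally Lipschitz field obtained by replacing \<open>x\<close>, \<open>y\<close> by \<open>max x \<delta>\<close>, \<open>max y \<delta>\<close>.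
\<close>

lemma branch_on_continuation:
  assumes "x1 > 0" "y1 > 0" "C1\<^sup>2 + S1\<^sup>2 = 1"
    and F: "x1 powr a * (S1 - h * x1 / (a + 1)) > 0" and G: "y1 powr b * (C1 - - h * y1 / (b + 1)) > 0"
  obtains X Y C S where "X 0 = x1" "Y 0 = y1" "C 0 = C1" "S 0 = S1"
    "\<And>s. s \<ge> 0 \<Longrightarrow> X s > 0 \<and> Y s > 0 \<and> (C s)\<^sup>2 + (S s)\<^sup>2 = 1"
    "\<And>s. s \<ge> 0 \<Longrightarrow> (X has_real_derivative C s) (at s within {0..})"
    "\<And>s. s \<ge> 0 \<Longrightarrow> (Y has_real_derivative S s) (at s within {0..})"
    "\<And>s. s \<ge> 0 \<Longrightarrow> (C has_real_derivative - S s * (h - a * S s / X s + b * C s / Y s)) (at s within {0..})"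
    "\<And>s. s \<ge> 0 \<Longrightarrow> (S has_real_derivative C s * (h - a * S s / X s + b * C s / Y s)) (at s within {0..})"
proof -
  define F1 where "F1 = x1 powr a * (S1 - h * x1 / (a + 1))"
  define G1 where "G1 = y1 powr b * (C1 - - h * y1 / (b + 1))"
  have FG: "F1 > 0" "G1 > 0" using F G by (simp_all add: F1_def G1_def)
  \<comment> \<open>\<open>2 * \<delta>\<close> is the a priori lower bound for x and y. The field
    is truncated at half of it, which leaves a gap for the continuity argument below.\<close>
  define \<delta> where "\<delta> = min 1 (min (F1 / (1 + \<bar>h\<bar>)) (G1 / (1 + \<bar>h\<bar>))) / 2"
  have h1: "1 + \<bar>h\<bar> > 0" by (simp add: add_pos_nonneg)
  have \<delta>: "\<delta> > 0" "2 * \<delta> \<le> 1" "2 * \<delta> * (1 + \<bar>h\<bar>) \<le> F1" "2 * \<delta> * (1 + \<bar>- h\<bar>) \<le> G1"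
    using FG h1 by (auto simp: \<delta>_def simp flip: pos_le_divide_eq)
  \<comment> \<open>Writing the velocity through an angle makes the unit-length condition automatic
    and the truncated field globally Lipschitz.\<close>
  obtain \<theta>1 where \<theta>1: "C1 = cos \<theta>1" "S1 = sin \<theta>1" using sincos_total_2pi[OF assms(3)] by metis
  define f where "f u = (cos (snd (snd u)), sin (snd (snd u)),
    h - a * (sin (snd (snd u)) / max (fst u) \<delta>) + b * (cos (snd (snd u)) / max (fst (snd u)) \<delta>))"
    for u :: "real \<times> real \<times> real"
  define K where "K = 1 / \<delta> + 1 / \<delta>\<^sup>2"
  have K: "K \<ge> 0" using \<delta> by (simp add: K_def)
  define L where "L = 2 + (a + b) * K"
  have L0: "L \<ge> 0" using a b K by (simp add: L_def)
  have "norm (f u - f v) \<le> L * norm (u - v)" for u v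
  proof -
    obtain p q t where u: "u = (p, q, t)" by (cases u)
    obtain p' q' t' where v: "v = (p', q', t')" by (cases v)
    define N where "N = norm (u - v)"
    have "\<bar>p - p'\<bar> \<le> N" "norm (q - q', t - t') \<le> N"
      using norm_fst_le[of "p - p'" "(q - q', t - t')"] norm_snd_le[of "(q - q', t - t')" "p - p'"]
      by (simp_all add: N_def u v)
    then have N: "\<bar>p - p'\<bar> \<le> N" "\<bar>q - q'\<bar> \<le> N" "\<bar>t - t'\<bar> \<le> N"
      using norm_fst_le[of "q - q'" "t - t'"] norm_snd_le[of "t - t'" "q - q'"] by simp_all
    have cs: "\<bar>cos t - cos t'\<bar> \<le> N" "\<bar>sin t - sin t'\<bar> \<le> N"
      using abs_cos_diff_le[of t t'] abs_sin_diff_le[of t t'] N(3) by linarith+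
    have "\<bar>w - w'\<bar> / \<delta> + \<bar>z - z'\<bar> / \<delta>\<^sup>2 \<le> K * N" if "\<bar>w - w'\<bar> \<le> N" "\<bar>z - z'\<bar> \<le> N" for w w' z z'
    proof -
      have "\<bar>w - w'\<bar> / \<delta> + \<bar>z - z'\<bar> / \<delta>\<^sup>2 \<le> N / \<delta> + N / \<delta>\<^sup>2"
        using that \<delta> by (intro add_mono divide_right_mono) auto
      then show ?thesis by (simp add: K_def distrib_right)
    qed
    then have qs: "\<bar>sin t / max p \<delta> - sin t' / max p' \<delta>\<bar> \<le> K * N" "\<bar>cos t / max q \<delta> - cos t' / max q' \<delta>\<bar> \<le> K * N"
      using abs_divide_max_diff_le[OF \<delta>(1)] cs N by (meson abs_sin_le_one abs_cos_le_one order_trans)+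
    have "norm (f u - f v) \<le> \<bar>cos t - cos t'\<bar> + (\<bar>sin t - sin t'\<bar> +
      \<bar>- (a * (sin t / max p \<delta> - sin t' / max p' \<delta>)) + b * (cos t / max q \<delta> - cos t' / max q' \<delta>)\<bar>)"
      unfolding f_def u v fst_conv snd_conv diff_Pair
      by (rule order_trans[OF norm_Pair_le], rule add_mono, simp, rule order_trans[OF norm_Pair_le])
        (simp add: algebra_simps)
    also have "\<dots> \<le> N + (N + (a * (K * N) + b * (K * N)))"
    proof -
      have "\<bar>a * (sin t / max p \<delta> - sin t' / max p' \<delta>)\<bar> \<le> a * (K * N)"
        "\<bar>b * (cos t / max q \<delta> - cos t' / max q' \<delta>)\<bar> \<le> b * (K * N)"
        unfolding abs_mult using a b qs by (simp_all add: mult_left_mono)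
      moreover have "\<bar>- P + R\<bar> \<le> \<bar>P\<bar> + \<bar>R\<bar>" for P R :: real by linarith
      ultimately show ?thesis using cs by (meson add_mono order_trans)
    qed
    also have "\<dots> = L * N" by (simp add: L_def algebra_simps)
    finally show ?thesis by (simp add: N_def)
  qed
  then obtain z where z: "z 0 = (x1, y1, \<theta>1)"
    "\<And>s. s \<ge> 0 \<Longrightarrow> (z has_vector_derivative f (z s)) (at s within {0..})"
    using lipschitz_ode_global[OF L0] by metis
  define X Y \<theta> where "X s = fst (z s)" and "Y s = fst (snd (z s))" and "\<theta> s = snd (snd (z s))" for s
  define C S where "C s = cos (\<theta> s)" and "S s = sin (\<theta> s)" for s
  define \<kappa> where "\<kappa> s = h - a * (S s / max (X s) \<delta>) + b * (C s / max (Y s) \<delta>)" for s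
  have init: "X 0 = x1" "Y 0 = y1" "C 0 = C1" "S 0 = S1" using z(1) \<theta>1 by (simp_all add: X_def Y_def C_def S_def \<theta>_def)
  have d: "(X has_real_derivative C s) (at s within {0..})" "(Y has_real_derivative S s) (at s within {0..})"
    "(\<theta> has_real_derivative \<kappa> s) (at s within {0..})" if s: "s \<ge> 0" for s
  proof -
    have fs: "f (z s) = (C s, S s, \<kappa> s)"
      by (simp add: f_def C_def S_def \<kappa>_def X_def Y_def \<theta>_def)
    note dz = z(2)[OF s, unfolded fs]
    note d1 = bounded_linear.has_vector_derivative[OF bounded_linear_fst dz]
    note d2 = bounded_linear.has_vector_derivative[OF bounded_linear_snd dz]
    note d3 = bounded_linear.has_vector_derivative[OF bounded_linear_fst d2]
      bounded_linear.has_vector_derivative[OF bounded_linear_snd d2]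
    show "(X has_real_derivative C s) (at s within {0..})" "(Y has_real_derivative S s) (at s within {0..})"
      "(\<theta> has_real_derivative \<kappa> s) (at s within {0..})"
      using d1 d3 by (simp_all add: has_real_derivative_iff_has_vector_derivative X_def[abs_def] Y_def[abs_def] \<theta>_def[abs_def])
  qed
  have dCS: "(C has_real_derivative - S s * \<kappa> s) (at s within {0..})" "(S has_real_derivative C s * \<kappa> s) (at s within {0..})"
    if s: "s \<ge> 0" for s
    unfolding C_def[abs_def] S_def[abs_def] using d(3)[OF s] by (auto intro!: derivative_eq_intros)
  have unit: "(C s)\<^sup>2 + (S s)\<^sup>2 = 1" for s by (simp add: C_def S_def)
  have le1: "C s \<le> 1" "S s \<le> 1" for s by (simp_all add: C_def S_def)
  have cont: "continuous_on {0..s} X" "continuous_on {0..s} Y" "continuous_on {0..s} C" "continuous_on {0..s} S" for s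
  proof -
    have "continuous_on {0..} X" "continuous_on {0..} Y" "continuous_on {0..} C" "continuous_on {0..} S"
      using d(1,2) dCS by (auto intro!: DERIV_continuous_on)
    then show "continuous_on {0..s} X" "continuous_on {0..s} Y" "continuous_on {0..s} C" "continuous_on {0..s} S"
      by (auto elim: continuous_on_subset)
  qed
  \<comment> \<open>As long as x and y exceed \<open>\<delta>\<close> the truncation is inactive,
    and the monotone quantities then improve the bound to \<open>2 * \<delta>\<close>.\<close>
  have ge: "X s \<ge> 2 * \<delta> \<and> Y s \<ge> 2 * \<delta>"
    if s: "s \<ge> 0" and above: "\<And>t. 0 \<le> t \<Longrightarrow> t \<le> s \<Longrightarrow> X t > \<delta> \<and> Y t > \<delta>" for s
  proof -
    have dd: "DERIV X t :> C t" "DERIV Y t :> S t"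
      "DERIV S t :> C t * (h - a * S t / X t + b * C t / Y t)"
      "DERIV C t :> S t * (- h - b * C t / Y t + a * S t / X t)"
      if t: "0 < t" "t \<le> s" for t
    proof -
      have i: "at t within {0..} = at t" by (rule at_within_interior) (use t in simp)
      have e: "\<kappa> t = h - a * S t / X t + b * C t / Y t"
      proof -
        have "max (X t) \<delta> = X t" "max (Y t) \<delta> = Y t" using above[of t] t by auto
        then show ?thesis by (simp add: \<kappa>_def)
      qed
      have k: "C t * (h - a * S t / X t + b * C t / Y t) = C t * \<kappa> t"
        "S t * (- h - b * C t / Y t + a * S t / X t) = - S t * \<kappa> t"
        unfolding e by (simp_all add: algebra_simps)
      show "DERIV X t :> C t" "DERIV Y t :> S t"
        "DERIV S t :> C t * (h - a * S t / X t + b * C t / Y t)"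
        "DERIV C t :> S t * (- h - b * C t / Y t + a * S t / X t)"
        unfolding k using d(1,2)[of t] dCS[of t] t unfolding i by auto
    qed
    have pos: "X t > 0" "Y t > 0" "X t \<noteq> 0" "Y t \<noteq> 0" if "0 \<le> t" "t \<le> s" for t
      using above[OF that] \<delta>(1) by auto
    have "X 0 powr a * (S 0 - h * X 0 / (a + 1)) \<le> X s powr a * (S s - h * X s / (a + 1))"
    proof (rule DERIV_nonneg_imp_increasing_open[OF s])
      fix t assume t: "0 < t" "t < s"
      have "DERIV (\<lambda>s. X s powr a * (S s - h * X s / (a + 1))) t :> b * (X t powr a) * (C t)\<^sup>2 / Y t"
        by (rule monotone_quantity) (use dd[of t] t pos[of t] a in auto)
      moreover have "b * (X t powr a) * (C t)\<^sup>2 / Y t \<ge> 0" using b t pos[of t] by simp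
      ultimately show "\<exists>y. (DERIV (\<lambda>s. X s powr a * (S s - h * X s / (a + 1))) t :> y) \<and> 0 \<le> y" by blast
    qed (use pos a in \<open>intro continuous_intros cont; auto\<close>)
    then have F: "F1 \<le> X s powr a * (S s - h * X s / (a + 1))" by (simp add: init F1_def)
    have "Y 0 powr b * (C 0 - - h * Y 0 / (b + 1)) \<le> Y s powr b * (C s - - h * Y s / (b + 1))"
    proof (rule DERIV_nonneg_imp_increasing_open[OF s])
      fix t assume t: "0 < t" "t < s"
      have "DERIV (\<lambda>s. Y s powr b * (C s - - h * Y s / (b + 1))) t :> a * (Y t powr b) * (S t)\<^sup>2 / X t"
        by (rule monotone_quantity) (use dd[of t] t pos[of t] b in auto)
      moreover have "a * (Y t powr b) * (S t)\<^sup>2 / X t \<ge> 0" using a t pos[of t] by simp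
      ultimately show "\<exists>y. (DERIV (\<lambda>s. Y s powr b * (C s - - h * Y s / (b + 1))) t :> y) \<and> 0 \<le> y" by blast
    qed (use pos b in \<open>intro continuous_intros cont; auto\<close>)
    then have G: "G1 \<le> Y s powr b * (C s - - h * Y s / (b + 1))" by (simp add: init G1_def)
    show ?thesis
      using ge_of_monotone_quantity[OF F FG(1) pos(1)[OF s order_refl] a le1(2) \<delta>(2,3)]
        ge_of_monotone_quantity[OF G FG(2) pos(2)[OF s order_refl] b le1(1) \<delta>(2,4)] by simp
  qed
  define mm where "mm s = min (X s) (Y s)" for s
  have cmm: "continuous_on {0..s} mm" for s unfolding mm_def[abs_def] by (intro continuous_intros cont)
  have mm0: "mm 0 \<ge> 2 * \<delta>"
    using ge_of_monotone_quantity[OF _ FG(1) assms(1) a, of S1 h \<delta>] ge_of_monotone_quantity[OF _ FG(2) assms(2) b, of C1 "- h" \<delta>]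
      le1(1)[of 0] le1(2)[of 0] \<delta> by (simp add: mm_def init F1_def G1_def)
  have mm: "mm s \<ge> 2 * \<delta>" if s: "s \<ge> 0" for s
  proof (rule ccontr)
    assume "\<not> mm s \<ge> 2 * \<delta>"
    then have less: "mm s < 2 * \<delta>" by simp
    \<comment> \<open>A level strictly between \<open>\<delta>\<close> and
      \<open>2 * \<delta>\<close>. Up to the first time t with \<open>mm t\<close> \<le>
      \<open>\<mu>\<close> the truncation has been inactive, so \<open>ge\<close> contradicts
      \<open>mm t = \<mu>\<close>.\<close>
    define \<mu> where "\<mu> = max (mm s) (3 / 2 * \<delta>)"
    have \<mu>: "\<mu> < 2 * \<delta>" "\<mu> > \<delta>" "mm s \<le> \<mu>" using less \<delta>(1) by (auto simp: \<mu>_def)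
    define A where "A = {t \<in> {0..s}. mm t \<le> \<mu>}"
    have "closed A" unfolding A_def by (intro continuous_on_closed_Collect_le cmm) auto
    moreover have "A \<subseteq> {0..s}" by (auto simp: A_def)
    ultimately have "compact A" using compact_Int_closed[of "{0..s}" A] by (simp add: inf.absorb2)
    moreover have "s \<in> A" using s \<mu> by (simp add: A_def)
    ultimately obtain t where t: "t \<in> A" "\<And>u. u \<in> A \<Longrightarrow> t \<le> u"
      using compact_attains_inf[of A] by blast
    then have t': "0 \<le> t" "t \<le> s" "mm t \<le> \<mu>" by (auto simp: A_def)
    have "\<exists>u\<ge>0. u \<le> t \<and> mm u = \<mu>"
      using IVT2'[of mm t \<mu> 0] t' mm0 \<mu> cmm by auto
    then obtain u where u: "0 \<le> u" "u \<le> t" "mm u = \<mu>" by blast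
    then have "u \<in> A" using t' by (simp add: A_def)
    with t(2) u have mt: "mm t = \<mu>" by force
    have "mm u > \<delta>" if "0 \<le> u" "u \<le> t" for u
    proof (cases "u = t")
      case False
      then have "u \<notin> A" using t(2) that by force
      then show ?thesis using that t' \<mu> by (simp add: A_def)
    qed (use mt \<mu> in simp)
    then have "mm t \<ge> 2 * \<delta>" using ge[OF t'(1)] by (simp add: mm_def)
    then show False using mt \<mu> by simp
  qed
  have \<kappa>: "\<kappa> s = h - a * S s / X s + b * C s / Y s" if "s \<ge> 0" for s
  proof -
    have "max (X s) \<delta> = X s" "max (Y s) \<delta> = Y s" using mm[OF that] \<delta>(1) by (auto simp: mm_def)
    then show ?thesis by (simp add: \<kappa>_def)
  qed
  have pos: "X s > 0" "Y s > 0" if "s \<ge> 0" for s using mm[OF that] \<delta>(1) by (auto simp: mm_def)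
  show ?thesis
  proof (rule that[of X Y C S, OF init])
    show "(C has_real_derivative - S s * (h - a * S s / X s + b * C s / Y s)) (at s within {0..})"
      "(S has_real_derivative C s * (h - a * S s / X s + b * C s / Y s)) (at s within {0..})" if "s \<ge> 0" for s
      using dCS[OF that] unfolding \<kappa>[OF that] by auto
  qed (use pos unit d in auto)
qed

end

lemma at_within_atLeast_neq_bot:
  assumes "t \<ge> (c::real)"
  shows "at t within {c..} \<noteq> bot"
proof (cases "t = c")
  case True
  then show ?thesis by (simp add: at_within_Ici_at_right)
next
  case False
  then have "at t within {c..} = at t" using assms by (intro at_within_interior) simp
  then show ?thesis by simp
qed

section \<open>Smoothness, uniqueness and existence of branches on the whole half-line\<close>

context cone
begin

text \<open>Bootstrapping. The reciprocals of x and y join the induction, because all right-hand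
  sides are then polynomials in the unknowns.\<close>

lemma branch_on_smooth:
  assumes "branch_on I x y C S" "open I"
  shows "C_k k I x" "C_k k I y"
proof -
  note D = assms(1)[unfolded branch_on_def, rule_format]
  define u v where "u s = inverse (x s)" and "v s = inverse (y s)" for s
  have "C_k k I x \<and> C_k k I y \<and> C_k k I C \<and> C_k k I S \<and> C_k k I u \<and> C_k k I v"
  proof (induction k)
    case 0
    have "continuous_on I x" "continuous_on I y" "continuous_on I C" "continuous_on I S"
      by (rule DERIV_continuous_on, rule has_field_derivative_at_within, use D in blast)+
    moreover have "x s \<noteq> 0" "y s \<noteq> 0" if "s \<in> I" for s using D[OF that] by auto
    ultimately show ?case unfolding u_def[abs_def] v_def[abs_def] by (auto intro!: continuous_intros)
  next
    case (Suc k)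
    have vd: "(f has_vector_derivative d) (at s within I)" if "DERIV f s :> d" for f d s
      using that by (simp add: has_real_derivative_iff_has_vector_derivative has_vector_derivative_at_within)
    define \<kappa> where "\<kappa> s = h - a * (S s * u s) + b * (C s * v s)" for s
    have \<kappa>: "C_k k I \<kappa>"
      unfolding \<kappa>_def[abs_def] using Suc by (intro C_k_add C_k_diff C_k_mult C_k_const) auto
    have "C_k (Suc k) I x" by (rule C_k_SucI_vector[of _ _ C]) (use D Suc vd in blast)+
    moreover have "C_k (Suc k) I y" by (rule C_k_SucI_vector[of _ _ S]) (use D Suc vd in blast)+
    moreover have "C_k (Suc k) I C"
    proof (rule C_k_SucI_vector[of _ _ "\<lambda>s. - S s * \<kappa> s"])
      show "(C has_vector_derivative - S s * \<kappa> s) (at s within I)" if "s \<in> I" for s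
        using D[OF that] by (intro vd) (simp add: \<kappa>_def u_def v_def divide_inverse mult.assoc)
      show "C_k k I (\<lambda>s. - S s * \<kappa> s)" using Suc \<kappa> by (intro C_k_mult C_k_minus) auto
    qed
    moreover have "C_k (Suc k) I S"
    proof (rule C_k_SucI_vector[of _ _ "\<lambda>s. C s * \<kappa> s"])
      show "(S has_vector_derivative C s * \<kappa> s) (at s within I)" if "s \<in> I" for s
        using D[OF that] by (intro vd) (simp add: \<kappa>_def u_def v_def divide_inverse mult.assoc)
      show "C_k k I (\<lambda>s. C s * \<kappa> s)" using Suc \<kappa> by (intro C_k_mult) auto
    qed
    moreover have "C_k (Suc k) I u"
    proof (rule C_k_SucI_vector[of _ _ "\<lambda>s. - (C s * (u s * u s))"])
      show "(u has_vector_derivative - (C s * (u s * u s))) (at s within I)" if "s \<in> I" for s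
        unfolding u_def[abs_def] using D[OF that]
        by (intro vd) (auto intro!: derivative_eq_intros simp: power2_eq_square)
      show "C_k k I (\<lambda>s. - (C s * (u s * u s)))" using Suc by (intro C_k_mult C_k_minus) auto
    qed
    moreover have "C_k (Suc k) I v"
    proof (rule C_k_SucI_vector[of _ _ "\<lambda>s. - (S s * (v s * v s))"])
      show "(v has_vector_derivative - (S s * (v s * v s))) (at s within I)" if "s \<in> I" for s
        unfolding v_def[abs_def] using D[OF that]
        by (intro vd) (auto intro!: derivative_eq_intros simp: power2_eq_square)
      show "C_k k I (\<lambda>s. - (S s * (v s * v s)))" using Suc by (intro C_k_mult C_k_minus) auto
    qed
    ultimately show ?case by blast
  qed
  then show "C_k k I x" "C_k k I y" by auto
qed

text \<open>The values of \<open>x\<close> and \<open>y\<close> at 0 are included so that branches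
  can be compared on the closed half-line; \<open>C 0\<close> and \<open>S 0\<close> are left
  open.\<close>

definition global_branch :: "(real \<Rightarrow> real) \<Rightarrow> (real \<Rightarrow> real) \<Rightarrow> (real \<Rightarrow> real) \<Rightarrow> (real \<Rightarrow> real) \<Rightarrow> bool" where
  "global_branch x y C S \<longleftrightarrow> branch_on {0<..} x y C S \<and> x 0 = 0 \<and> y 0 = 0 \<and>
     (x \<longlongrightarrow> 0) (at_right 0) \<and> (y \<longlongrightarrow> 0) (at_right 0)"

lemma global_branch_imp_cusp_branch:
  "global_branch x y C S \<Longrightarrow> r > 0 \<Longrightarrow> cusp_branch r x y C S"
  by (auto simp: global_branch_def cusp_branch_def branch_on_def)

lemma global_branch_unique:
  assumes G1: "global_branch x1 y1 C1 S1" and G2: "global_branch x2 y2 C2 S2" and "s \<ge> 0"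
  shows "x1 s = x2 s \<and> y1 s = y2 s"
proof (cases "s = 0")
  case True
  then show ?thesis using G1 G2 by (simp add: global_branch_def)
next
  case False
  then have s: "s > 0" using \<open>s \<ge> 0\<close> by simp
  obtain \<rho> where \<rho>: "0 < \<rho>" "\<And>t. 0 < t \<Longrightarrow> t < \<rho> \<Longrightarrow> x1 t = x2 t \<and> y1 t = y2 t \<and> C1 t = C2 t \<and> S1 t = S2 t"
    by (rule cusp_branch_unique_near_zero[OF global_branch_imp_cusp_branch[OF G1 zero_less_one]
          global_branch_imp_cusp_branch[OF G2 zero_less_one]]) blast
  define t where "t = min s (\<rho> / 2)"
  have t: "0 < t" "t < \<rho>" "t \<le> s" using s \<rho>(1) by (auto simp: t_def)
  show ?thesis
    using branch_on_unique_forward[of x1 y1 C1 S1 x2 y2 C2 S2 t s] \<rho>(2)[OF t(1,2)] t G1 G2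
    by (auto simp: global_branch_def)
qed

text \<open>By uniqueness near the cusp, every global branch coincides there with the analytic one
  and inherits its smoothness up to the endpoint, its tangent and its curvature.\<close>

lemma global_branch_regular_at_cusp:
  assumes G: "global_branch x y C S"
  shows "C_k k {0..} x" "C_k k {0..} y"
    and "(x has_real_derivative C0) (at 0 within {0..})" "(y has_real_derivative S0) (at 0 within {0..})"
    and "((\<lambda>s. if s = 0 then C0 else C s) has_real_derivative - S0 * k0) (at 0 within {0..})"
    and "((\<lambda>s. if s = 0 then S0 else S s) has_real_derivative C0 * k0) (at 0 within {0..})"
proof -
  obtain r xa ya Ca Sa where A: "r > 0" "branch_on {0<..<r} xa ya Ca Sa" "xa 0 = 0" "ya 0 = 0" "Ca 0 = C0" "Sa 0 = S0"
    "\<And>s. \<bar>s\<bar> < r \<Longrightarrow> (DERIV xa s :> Ca s)"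
    "\<And>s. \<bar>s\<bar> < r \<Longrightarrow> (DERIV ya s :> Sa s)"
    "DERIV Ca 0 :> - S0 * k0" "DERIV Sa 0 :> C0 * k0"
    "\<And>k. C_k k {-r<..<r} xa" "\<And>k. C_k k {-r<..<r} ya"
  proof (rule analytic_branch, goal_cases)
    case 1
    from 1(2-) show ?case by (rule 1(1))
  qed
  have "isCont xa 0" "isCont ya 0" using A(1) A(7,8)[of 0] DERIV_isCont by auto
  then have "(xa \<longlongrightarrow> 0) (at_right 0)" "(ya \<longlongrightarrow> 0) (at_right 0)"
    using A(3,4) by (auto simp: isCont_def intro: tendsto_within_subset)
  then have cba: "cusp_branch r xa ya Ca Sa" using A(1,2) by (simp add: cusp_branch_def)
  obtain \<rho> where \<rho>: "0 < \<rho>" "\<rho> \<le> r"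
    "\<And>t. 0 < t \<Longrightarrow> t < \<rho> \<Longrightarrow> xa t = x t \<and> ya t = y t \<and> Ca t = C t \<and> Sa t = S t"
    by (rule cusp_branch_unique_near_zero[OF cba global_branch_imp_cusp_branch[OF G A(1)]]) blast
  have eq: "xa t = x t" "ya t = y t" "Ca t = (if t = 0 then C0 else C t)" "Sa t = (if t = 0 then S0 else S t)"
    if "0 \<le> t" "t < \<rho>" for t
    using \<rho>(3)[of t] that A(3-6) G by (cases "t = 0"; auto simp: global_branch_def)+
  have tr: "(g has_real_derivative d) (at 0 within {0..})"
    if "DERIV f 0 :> d" "\<And>t. 0 \<le> t \<Longrightarrow> t < \<rho> \<Longrightarrow> f t = g t" for f g d
    by (rule has_field_derivative_transform_within[OF has_field_derivative_at_within[OF that(1)] \<rho>(1)])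
      (use that(2) in \<open>auto simp: dist_real_def\<close>)
  show "(x has_real_derivative C0) (at 0 within {0..})" "(y has_real_derivative S0) (at 0 within {0..})"
    using tr[OF A(7)[of 0] eq(1)] tr[OF A(8)[of 0] eq(2)] A(1,5,6) by auto
  show "((\<lambda>s. if s = 0 then C0 else C s) has_real_derivative - S0 * k0) (at 0 within {0..})"
    by (rule tr[OF A(9) eq(3)])
  show "((\<lambda>s. if s = 0 then S0 else S s) has_real_derivative C0 * k0) (at 0 within {0..})"
    by (rule tr[OF A(10) eq(4)])
  have B: "branch_on {0<..} x y C S" using G by (simp add: global_branch_def)
  have loc: "C_k k {0..} f"
    if fa: "C_k k {-r<..<r} fa" "\<And>t. 0 \<le> t \<Longrightarrow> t < \<rho> \<Longrightarrow> fa t = f t" and fb: "C_k k {0<..} f" for f fa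
  proof (rule C_k_local)
    show "at t within {0..} \<noteq> bot" if "t \<in> {0..}" for t :: real
      using that by (simp add: at_within_atLeast_neq_bot)
    show "\<exists>U. open U \<and> t \<in> U \<and> C_k k ({0..} \<inter> U) f" if "t \<in> {0..}" for t
    proof (cases "t = 0")
      case True
      have "C_k k {0..<\<rho>} fa" using \<rho> by (intro C_k_subset[OF fa(1)]) auto
      then have "C_k k {0..<\<rho>} f" by (rule C_k_cong[rotated]) (use fa(2) in auto)
      moreover have "{0..} \<inter> {..<\<rho>} = {0..<\<rho>}" by auto
      ultimately show ?thesis using True \<rho>(1) by (intro exI[of _ "{..<\<rho>}"]) auto
    next
      case False
      moreover have "{0..} \<inter> {0<..} = {0::real<..}" by auto
      ultimately show ?thesis using that fb by (intro exI[of _ "{0<..}"]) auto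
    qed
  qed
  show "C_k k {0..} x" using branch_on_smooth(1)[OF B] by (intro loc[OF A(11) eq(1)]) auto
  show "C_k k {0..} y" using branch_on_smooth(2)[OF B] by (intro loc[OF A(12) eq(2)]) auto
qed

text \<open>The analytic branch is followed up to a time c at which both monotone quantities are
  positive, and then continued. Such a c exists because S and C tend to the positive
  \<open>S0\<close> and \<open>C0\<close> while x and y tend to 0.\<close>

theorem global_branch_exists: "\<exists>x y C S. global_branch x y C S"
proof -
  obtain r x y C S where A: "r > 0" "branch_on {0<..<r} x y C S" "x 0 = 0" "y 0 = 0" "C 0 = C0" "S 0 = S0"
    "\<And>s. \<bar>s\<bar> < r \<Longrightarrow> (DERIV x s :> C s)"
    "\<And>s. \<bar>s\<bar> < r \<Longrightarrow> (DERIV y s :> S s)"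
    "DERIV C 0 :> - S0 * k0" "DERIV S 0 :> C0 * k0"
    "\<And>k. C_k k {-r<..<r} x" "\<And>k. C_k k {-r<..<r} y"
  proof (rule analytic_branch, goal_cases)
    case 1
    from 1(2-) show ?case by (rule 1(1))
  qed
  have lim: "(x \<longlongrightarrow> 0) (at_right 0)" "(y \<longlongrightarrow> 0) (at_right 0)" "(C \<longlongrightarrow> C0) (at_right 0)" "(S \<longlongrightarrow> S0) (at_right 0)"
  proof -
    have "isCont x 0" "isCont y 0" "isCont C 0" "isCont S 0" using A(1,9,10) A(7,8)[of 0] DERIV_isCont by auto
    then show "(x \<longlongrightarrow> 0) (at_right 0)" "(y \<longlongrightarrow> 0) (at_right 0)" "(C \<longlongrightarrow> C0) (at_right 0)" "(S \<longlongrightarrow> S0) (at_right 0)"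
      using A(3-6) by (auto simp: isCont_def intro: tendsto_within_subset)
  qed
  have T: "((\<lambda>s. S s - h * x s / (a + 1)) \<longlongrightarrow> S0 - h * 0 / (a + 1)) (at_right 0)"
    "((\<lambda>s. C s - - h * y s / (b + 1)) \<longlongrightarrow> C0 - - h * 0 / (b + 1)) (at_right 0)"
    using a b by (intro tendsto_intros lim; simp)+
  have "\<forall>\<^sub>F s in at_right 0. S s - h * x s / (a + 1) > 0 \<and> C s - - h * y s / (b + 1) > 0"
    using S0_pos C0_pos
    by (intro eventually_conj order_tendstoD(1)[OF T(1)] order_tendstoD(1)[OF T(2)]) simp_all
  then obtain e where e: "e > 0" "\<And>s. 0 < s \<Longrightarrow> s < e \<Longrightarrow> S s - h * x s / (a + 1) > 0 \<and> C s - - h * y s / (b + 1) > 0"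
    unfolding eventually_at_right_field by blast
  define c where "c = min e r / 2"
  have c: "0 < c" "c < e" "c < r" using e A(1) by (auto simp: c_def)
  note B = A(2)[unfolded branch_on_def, rule_format]
  have Bc: "x c > 0" "y c > 0" "(C c)\<^sup>2 + (S c)\<^sup>2 = 1" using B[of c] c by auto
  have "x c powr a * (S c - h * x c / (a + 1)) > 0" "y c powr b * (C c - - h * y c / (b + 1)) > 0"
    using e(2)[OF c(1,2)] Bc by (auto intro: mult_pos_pos)
  note BB = this
  obtain X Y C' S' where
    X: "X 0 = x c" "Y 0 = y c" "C' 0 = C c" "S' 0 = S c"
    "\<And>s. s \<ge> 0 \<Longrightarrow> X s > 0 \<and> Y s > 0 \<and> (C' s)\<^sup>2 + (S' s)\<^sup>2 = 1"
    "\<And>s. s \<ge> 0 \<Longrightarrow> (X has_real_derivative C' s) (at s within {0..})"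
    "\<And>s. s \<ge> 0 \<Longrightarrow> (Y has_real_derivative S' s) (at s within {0..})"
    "\<And>s. s \<ge> 0 \<Longrightarrow> (C' has_real_derivative - S' s * (h - a * S' s / X s + b * C' s / Y s)) (at s within {0..})"
    "\<And>s. s \<ge> 0 \<Longrightarrow> (S' has_real_derivative C' s * (h - a * S' s / X s + b * C' s / Y s)) (at s within {0..})"
  proof (rule branch_on_continuation[OF Bc BB], goal_cases)
    case 1
    from 1(2-) show ?case by (rule 1(1))
  qed
  define glue where "glue f g s = (if s \<le> c then f s else g (s - c))" for f g :: "real \<Rightarrow> real" and s
  \<comment> \<open>At the seam the one-sided derivatives agree, since both pieces satisfy the same
    equation with the same state there.\<close>
  have dglue: "DERIV (glue f g) s :> glue f' g' s"
    if "0 < s" "\<And>s. 0 < s \<Longrightarrow> s \<le> c \<Longrightarrow> (DERIV f s :> f' s)"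
      "\<And>s. s \<ge> 0 \<Longrightarrow> (g has_real_derivative g' s) (at s within {0..})" "f c = g 0" "f' c = g' 0" for f g f' g' s
    unfolding glue_def[abs_def]
  proof (rule has_real_derivative_glue[where d = f' and e = "\<lambda>s. g' (s - c)"])
    show "DERIV f s :> f' s" if "s \<le> c" using that \<open>0 < s\<close> \<open>\<And>s. 0 < s \<Longrightarrow> s \<le> c \<Longrightarrow> (DERIV f s :> f' s)\<close> by blast
    show "((\<lambda>s. g (s - c)) has_real_derivative g' (s - c)) (at s within {c..})" if "c \<le> s"
    proof -
      have im: "(\<lambda>s. s - c) ` {c..} = {0..}" by (auto simp: image_iff intro!: bexI[of _ "_ + c"])
      have "((g \<circ> (\<lambda>s. s - c)) has_real_derivative g' (s - c) * 1) (at s within {c..})"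
      proof (rule DERIV_image_chain)
        show "(g has_real_derivative g' (s - c)) (at (s - c) within (\<lambda>s. s - c) ` {c..})"
          unfolding im using \<open>\<And>s. s \<ge> 0 \<Longrightarrow> (g has_real_derivative g' s) (at s within {0..})\<close> that by simp
        show "((\<lambda>s. s - c) has_real_derivative 1) (at s within {c..})" by (auto intro!: derivative_eq_intros)
      qed
      then show ?thesis by (simp add: o_def)
    qed
  qed (use that in auto)
  have "branch_on {0<..} (glue x X) (glue y Y) (glue C C') (glue S S')"
    unfolding branch_on_def
  proof (intro ballI conjI)
    fix s :: real assume "s \<in> {0<..}"
    then have s: "0 < s" by simp
    show "glue x X s > 0" "glue y Y s > 0" "(glue C C' s)\<^sup>2 + (glue S S' s)\<^sup>2 = 1"
      using B[of s] X(5)[of "s - c"] s c by (auto simp: glue_def)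
    have B': "DERIV x t :> C t" "DERIV y t :> S t"
      "DERIV C t :> - S t * (h - a * S t / x t + b * C t / y t)"
      "DERIV S t :> C t * (h - a * S t / x t + b * C t / y t)" if "0 < t" "t \<le> c" for t
      using B[of t] that c by auto
    show "DERIV (glue x X) s :> glue C C' s" "DERIV (glue y Y) s :> glue S S' s"
      using X B' by (intro dglue s; simp)+
    have "- glue S S' s * (h - a * glue S S' s / glue x X s + b * glue C C' s / glue y Y s) =
        glue (\<lambda>s. - S s * (h - a * S s / x s + b * C s / y s)) (\<lambda>s. - S' s * (h - a * S' s / X s + b * C' s / Y s)) s"
      "glue C C' s * (h - a * glue S S' s / glue x X s + b * glue C C' s / glue y Y s) =
        glue (\<lambda>s. C s * (h - a * S s / x s + b * C s / y s)) (\<lambda>s. C' s * (h - a * S' s / X s + b * C' s / Y s)) s"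
      by (simp_all add: glue_def)
    moreover have "DERIV (glue C C') s :> glue (\<lambda>s. - S s * (h - a * S s / x s + b * C s / y s)) (\<lambda>s. - S' s * (h - a * S' s / X s + b * C' s / Y s)) s"
      "DERIV (glue S S') s :> glue (\<lambda>s. C s * (h - a * S s / x s + b * C s / y s)) (\<lambda>s. C' s * (h - a * S' s / X s + b * C' s / Y s)) s"
      by (rule dglue[OF s]; use X B' in simp)+
    ultimately show "DERIV (glue C C') s :> - glue S S' s * (h - a * glue S S' s / glue x X s + b * glue C C' s / glue y Y s)"
      "DERIV (glue S S') s :> glue C C' s * (h - a * glue S S' s / glue x X s + b * glue C C' s / glue y Y s)"
      by simp_all
  qed
  moreover have "glue x X 0 = 0" "glue y Y 0 = 0" using c A(3,4) by (simp_all add: glue_def)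
  moreover have "(glue f g \<longlongrightarrow> 0) (at_right 0)" if "(f \<longlongrightarrow> 0) (at_right 0)" for f g
  proof (rule Lim_transform_eventually[OF that])
    show "\<forall>\<^sub>F s in at_right 0. f s = glue f g s"
      by (rule eventually_at_rightI[OF _ c(1)]) (auto simp: glue_def)
  qed
  ultimately show ?thesis using lim unfolding global_branch_def by blast
qed

end

section \<open>Profile curves\<close>

lemma smooth_curve_derivatives:
  assumes "open I" "smooth_on I \<gamma>" "t \<in> I"
  shows "(\<gamma> has_vector_derivative velocity UNIV \<gamma> t) (at t)"
    and "(velocity UNIV \<gamma> has_vector_derivative acceleration UNIV \<gamma> t) (at t)"
proof -
  have "C_k (Suc (Suc 0)) I \<gamma>" using assms(2) unfolding smooth_on_def by blast
  then obtain v where v: "\<And>s. s \<in> I \<Longrightarrow> (\<gamma> has_vector_derivative v s) (at s within I)" "C_k (Suc 0) I v"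
    by (rule C_k_SucE_vector) blast
  from v(2) obtain w where w: "\<And>s. s \<in> I \<Longrightarrow> (v has_vector_derivative w s) (at s within I)"
    by (rule C_k_SucE_vector) blast
  have at: "at s within I = at s" if "s \<in> I" for s using that assms(1) by (rule at_within_open)
  have dv: "(\<gamma> has_vector_derivative v s) (at s)" and dw: "(v has_vector_derivative w s) (at s)" if "s \<in> I" for s
    using v(1)[OF that] w[OF that] unfolding at[OF that] by auto
  have eq: "v s = velocity UNIV \<gamma> s" if "s \<in> I" for s
    unfolding velocity_def using vector_derivative_at[OF dv[OF that]] by simp
  show "(\<gamma> has_vector_derivative velocity UNIV \<gamma> t) (at t)"
    using dv[OF assms(3)] eq[OF assms(3)] by simp
  have d: "(velocity UNIV \<gamma> has_vector_derivative w t) (at t)"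
    by (rule has_vector_derivative_transform_within_open[OF dw[OF assms(3)] assms(1,3) eq])
  then show "(velocity UNIV \<gamma> has_vector_derivative acceleration UNIV \<gamma> t) (at t)"
    unfolding acceleration_def using vector_derivative_at[OF d] by simp
qed

lemma has_vector_derivative_fst_snd:
  fixes \<gamma> :: "real \<Rightarrow> real \<times> real"
  assumes "(\<gamma> has_vector_derivative v) F"
  shows "((\<lambda>t. fst (\<gamma> t)) has_real_derivative fst v) F" "((\<lambda>t. snd (\<gamma> t)) has_real_derivative snd v) F"
  using bounded_linear.has_vector_derivative[OF bounded_linear_fst assms]
    bounded_linear.has_vector_derivative[OF bounded_linear_snd assms]
  by (simp_all add: has_real_derivative_iff_has_vector_derivative)

lemma has_vector_derivative_PairI:
  fixes \<gamma> :: "real \<Rightarrow> real \<times> real"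
  assumes "((\<lambda>t. fst (\<gamma> t)) has_real_derivative c) (at t within I)"
    "((\<lambda>t. snd (\<gamma> t)) has_real_derivative s) (at t within I)"
  shows "(\<gamma> has_vector_derivative (c, s)) (at t within I)"
  using has_vector_derivative_Pair[of "\<lambda>t. fst (\<gamma> t)" c t I "\<lambda>t. snd (\<gamma> t)" s] assms
  by (simp add: has_real_derivative_iff_has_vector_derivative)

text \<open>Differentiating the unit-speed relation shows that the acceleration is orthogonal to the
  velocity; the profile equation supplies the remaining component, so the acceleration is
  \<open>\<kappa>\<close> times the velocity turned by a right angle.\<close>

lemma arclength_cmc_solution_imp_ode:
  assumes I: "open I" "t \<in> I" and sol: "arclength_cmc_solution_on p q H \<gamma> I"
  defines "C \<equiv> \<lambda>t. fst (velocity UNIV \<gamma> t)" and "S \<equiv> \<lambda>t. snd (velocity UNIV \<gamma> t)"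
    and "\<kappa> \<equiv> \<lambda>t. (real p + real q - 1) * H - (real q - 1) * snd (velocity UNIV \<gamma> t) / fst (\<gamma> t)
        + (real p - 1) * fst (velocity UNIV \<gamma> t) / snd (\<gamma> t)"
  shows "DERIV (\<lambda>t. fst (\<gamma> t)) t :> C t" "DERIV (\<lambda>t. snd (\<gamma> t)) t :> S t"
    "(C t)\<^sup>2 + (S t)\<^sup>2 = 1" "DERIV C t :> - S t * \<kappa> t" "DERIV S t :> C t * \<kappa> t"
proof -
  have sm: "smooth_on I \<gamma>" using sol by (simp add: arclength_cmc_solution_on_def)
  note d = smooth_curve_derivatives[OF I(1) sm]
  show "DERIV (\<lambda>t. fst (\<gamma> t)) t :> C t" "DERIV (\<lambda>t. snd (\<gamma> t)) t :> S t"
    unfolding C_def S_def by (rule has_vector_derivative_fst_snd[OF d(1)[OF I(2)]])+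
  define C' where "C' t = fst (acceleration UNIV \<gamma> t)" for t
  define S' where "S' t = snd (acceleration UNIV \<gamma> t)" for t
  have dC: "DERIV C t :> C' t" and dS: "DERIV S t :> S' t"
    unfolding C_def S_def C'_def S'_def by (rule has_vector_derivative_fst_snd[OF d(2)[OF I(2)]])+
  have unit: "(C s)\<^sup>2 + (S s)\<^sup>2 = 1" if "s \<in> I" for s
    using sol that by (simp add: arclength_cmc_solution_on_def speed_def C_def S_def)
  then show 1: "(C t)\<^sup>2 + (S t)\<^sup>2 = 1" using I(2) .
  have "DERIV (\<lambda>s. (C s)\<^sup>2 + (S s)\<^sup>2) t :> 2 * (C t * C' t + S t * S' t)"
    using dC dS by (auto intro!: derivative_eq_intros)
  moreover have "DERIV (\<lambda>s. (C s)\<^sup>2 + (S s)\<^sup>2) t :> 0"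
    by (rule has_field_derivative_transform_within_open[of "\<lambda>s. 1", OF _ I]) (use unit in auto)
  ultimately have orth: "C t * C' t + S t * S' t = 0" using DERIV_unique by fastforce
  have "cmc_equation p q H \<gamma> t" using sol I(2) by (simp add: arclength_cmc_solution_on_def)
  then have k: "C t * S' t - C' t * S t = \<kappa> t"
    using 1 unfolding cmc_equation_def Let_def C_def S_def C'_def S'_def \<kappa>_def by (simp add: algebra_simps)
  have "- S t * \<kappa> t = C' t * ((C t)\<^sup>2 + (S t)\<^sup>2) - C t * (C t * C' t + S t * S' t)"
    "C t * \<kappa> t = S' t * ((C t)\<^sup>2 + (S t)\<^sup>2) - S t * (C t * C' t + S t * S' t)"
    unfolding k[symmetric] by (simp_all add: power2_eq_square algebra_simps)
  then have "C' t = - S t * \<kappa> t" "S' t = C t * \<kappa> t" unfolding orth 1 by simp_all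
  then show "DERIV C t :> - S t * \<kappa> t" "DERIV S t :> C t * \<kappa> t"
    using dC dS by simp_all
qed

lemma arclength_cmc_solutionI:
  assumes I: "open I" and sm: "smooth_on I \<gamma>"
    and d: "\<And>t. t \<in> I \<Longrightarrow> (DERIV (\<lambda>t. fst (\<gamma> t)) t :> C t)"
    "\<And>t. t \<in> I \<Longrightarrow> (DERIV (\<lambda>t. snd (\<gamma> t)) t :> S t)"
    "\<And>t. t \<in> I \<Longrightarrow> (DERIV C t :> - S t * \<kappa> t)"
    "\<And>t. t \<in> I \<Longrightarrow> (DERIV S t :> C t * \<kappa> t)"
    and unit: "\<And>t. t \<in> I \<Longrightarrow> (C t)\<^sup>2 + (S t)\<^sup>2 = 1"
    and \<kappa>: "\<And>t. t \<in> I \<Longrightarrow> \<kappa> t = (real p + real q - 1) * H - (real q - 1) * S t / fst (\<gamma> t)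
        + (real p - 1) * C t / snd (\<gamma> t)"
  shows "arclength_cmc_solution_on p q H \<gamma> I"
  unfolding arclength_cmc_solution_on_def
proof (intro conjI ballI sm)
  have v: "velocity UNIV \<gamma> t = (C t, S t)" if "t \<in> I" for t
    unfolding velocity_def
    using vector_derivative_at[OF has_vector_derivative_PairI[OF d(1,2)[OF that]]] by simp
  fix t assume t: "t \<in> I"
  have "((\<lambda>t. (C t, S t)) has_vector_derivative (- S t * \<kappa> t, C t * \<kappa> t)) (at t)"
    by (rule has_vector_derivative_PairI) (use d(3,4)[OF t] in simp_all)
  then have "(velocity UNIV \<gamma> has_vector_derivative (- S t * \<kappa> t, C t * \<kappa> t)) (at t)"
    by (rule has_vector_derivative_transform_within_open[OF _ I t]) (simp add: v)
  then have acc: "acceleration UNIV \<gamma> t = (- S t * \<kappa> t, C t * \<kappa> t)"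
    unfolding acceleration_def using vector_derivative_at by simp
  show "speed UNIV \<gamma> t = 1" by (simp add: speed_def v[OF t] unit[OF t])
  have "C t * (C t * \<kappa> t) - - S t * \<kappa> t * S t = \<kappa> t * ((C t)\<^sup>2 + (S t)\<^sup>2)"
    by (simp add: power2_eq_square algebra_simps)
  then show "cmc_equation p q H \<gamma> t"
    unfolding cmc_equation_def Let_def v[OF t] acc fst_conv snd_conv unit[OF t]
    by (simp add: \<kappa>[OF t])
qed

text \<open>In s = t0 - t the velocity changes sign while the acceleration does not, so all three
  curvature terms change sign; the arriving branch becomes an outgoing one for - h.\<close>

lemma global_solution_imp_branches:
  assumes sol: "global_solution_cusp_at_origin p q H \<gamma> t0" and pq: "p \<ge> 2" "q \<ge> 2"
  defines "a \<equiv> real q - 1" and "b \<equiv> real p - 1" and "h \<equiv> (real p + real q - 1) * H"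
    and "x \<equiv> \<lambda>t. fst (\<gamma> t)" and "y \<equiv> \<lambda>t. snd (\<gamma> t)"
    and "C \<equiv> \<lambda>t. fst (velocity UNIV \<gamma> t)" and "S \<equiv> \<lambda>t. snd (velocity UNIV \<gamma> t)"
  shows "cone.global_branch a b h (\<lambda>s. x (t0 + s)) (\<lambda>s. y (t0 + s))
      (\<lambda>s. C (t0 + s)) (\<lambda>s. S (t0 + s))"
    and "cone.global_branch a b (- h) (\<lambda>s. x (t0 - s)) (\<lambda>s. y (t0 - s))
      (\<lambda>s. - C (t0 - s)) (\<lambda>s. - S (t0 - s))"
proof -
  note xy = x_def y_def and defs = x_def y_def C_def S_def
  have cone: "cone a b" using pq by unfold_locales (auto simp: a_def b_def)
  interpret P: cone a b h by (rule cone)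
  interpret N: cone a b "- h" by (rule cone)
  note sol = sol[unfolded global_solution_cusp_at_origin_def]
  have cont: "continuous_on UNIV \<gamma>" and \<gamma>0: "\<gamma> t0 = (0, 0)" and Q: "\<And>t. t \<noteq> t0 \<Longrightarrow> fst (\<gamma> t) > 0 \<and> snd (\<gamma> t) > 0"
    using sol by (auto simp: Q1_def case_prod_beta)
  note R = arclength_cmc_solution_imp_ode[OF open_greaterThan _ conjunct2[OF conjunct2[OF conjunct2[OF conjunct2[OF sol]]]]]
  note L = arclength_cmc_solution_imp_ode[OF open_lessThan _ conjunct1[OF conjunct2[OF conjunct2[OF conjunct2[OF sol]]]]]
  have lim: "((\<lambda>s. x (t0 + s)) \<longlongrightarrow> 0) (at_right 0)" "((\<lambda>s. y (t0 + s)) \<longlongrightarrow> 0) (at_right 0)"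
    "((\<lambda>s. x (t0 - s)) \<longlongrightarrow> 0) (at_right 0)" "((\<lambda>s. y (t0 - s)) \<longlongrightarrow> 0) (at_right 0)"
  proof -
    have "continuous_on UNIV (\<lambda>s. \<gamma> (t0 + s))" "continuous_on UNIV (\<lambda>s. \<gamma> (t0 - s))"
      by (intro continuous_on_compose2[OF cont] continuous_intros; simp)+
    then have "isCont (\<lambda>s. \<gamma> (t0 + s)) 0" "isCont (\<lambda>s. \<gamma> (t0 - s)) 0"
      by (simp_all add: continuous_on_eq_continuous_at)
    then have "((\<lambda>s. \<gamma> (t0 + s)) \<longlongrightarrow> (0, 0)) (at_right 0)" "((\<lambda>s. \<gamma> (t0 - s)) \<longlongrightarrow> (0, 0)) (at_right 0)"
      using \<gamma>0 by (auto simp: isCont_def intro: tendsto_within_subset)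
    from tendsto_fst[OF this(1)] tendsto_snd[OF this(1)] tendsto_fst[OF this(2)] tendsto_snd[OF this(2)]
    show "((\<lambda>s. x (t0 + s)) \<longlongrightarrow> 0) (at_right 0)" "((\<lambda>s. y (t0 + s)) \<longlongrightarrow> 0) (at_right 0)"
      "((\<lambda>s. x (t0 - s)) \<longlongrightarrow> 0) (at_right 0)" "((\<lambda>s. y (t0 - s)) \<longlongrightarrow> 0) (at_right 0)" unfolding xy by simp_all
  qed
  have shift: "DERIV (\<lambda>s. f (t0 + s)) s :> d" if "DERIV f (t0 + s) :> d" for f d s
    using that by (simp add: DERIV_shift add.commute)
  have refl: "DERIV (\<lambda>s. f (t0 - s)) s :> - d" if "DERIV f (t0 - s) :> d" for f d s
  proof -
    have "DERIV (\<lambda>s. t0 - s) s :> - 1" by (auto intro!: derivative_eq_intros)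
    from DERIV_chain2[where f = f and g = "\<lambda>s. t0 - s" and x = s, OF that this] show ?thesis by simp
  qed
  show "P.global_branch (\<lambda>s. x (t0 + s)) (\<lambda>s. y (t0 + s))
      (\<lambda>s. C (t0 + s)) (\<lambda>s. S (t0 + s))"
    unfolding P.global_branch_def P.branch_on_def
  proof (intro conjI ballI lim)
    fix s :: real assume "s \<in> {0<..}"
    then have s: "t0 + s \<in> {t0<..}" "t0 + s \<noteq> t0" by auto
    note R' = R[OF s(1), folded a_def b_def h_def]
    show "x (t0 + s) > 0" "y (t0 + s) > 0" using Q[OF s(2)] by (auto simp: xy)
    show "DERIV (\<lambda>s. x (t0 + s)) s :> C (t0 + s)"
      by (unfold defs, rule shift, rule R'(1))
    show "DERIV (\<lambda>s. y (t0 + s)) s :> S (t0 + s)"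
      by (unfold defs, rule shift, rule R'(2))
    show "(C (t0 + s))\<^sup>2 + (S (t0 + s))\<^sup>2 = 1" unfolding defs by (rule R'(3))
    show "DERIV (\<lambda>s. C (t0 + s)) s :> - S (t0 + s) *
        (h - a * S (t0 + s) / x (t0 + s) + b * C (t0 + s) / y (t0 + s))"
      by (unfold defs, rule shift, rule R'(4))
    show "DERIV (\<lambda>s. S (t0 + s)) s :> C (t0 + s) *
        (h - a * S (t0 + s) / x (t0 + s) + b * C (t0 + s) / y (t0 + s))"
      by (unfold defs, rule shift, rule R'(5))
  qed (simp_all add: xy \<gamma>0)
  show "N.global_branch (\<lambda>s. x (t0 - s)) (\<lambda>s. y (t0 - s))
      (\<lambda>s. - C (t0 - s)) (\<lambda>s. - S (t0 - s))"
    unfolding N.global_branch_def N.branch_on_def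
  proof (intro conjI ballI lim)
    fix s :: real assume "s \<in> {0<..}"
    then have s: "t0 - s \<in> {..<t0}" "t0 - s \<noteq> t0" by auto
    note L' = L[OF s(1), folded a_def b_def h_def]
    show "x (t0 - s) > 0" "y (t0 - s) > 0" using Q[OF s(2)] by (auto simp: xy)
    show "DERIV (\<lambda>s. x (t0 - s)) s :> - C (t0 - s)"
      by (unfold defs, rule refl, rule L'(1))
    show "DERIV (\<lambda>s. y (t0 - s)) s :> - S (t0 - s)"
      by (unfold defs, rule refl, rule L'(2))
    show "(- C (t0 - s))\<^sup>2 + (- S (t0 - s))\<^sup>2 = 1" using L'(3) by (simp add: defs)
    show "DERIV (\<lambda>s. - C (t0 - s)) s :> - (- S (t0 - s)) *
        (- h - a * (- S (t0 - s)) / x (t0 - s) + b * (- C (t0 - s)) / y (t0 - s))"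
      unfolding defs by (rule DERIV_cong[OF DERIV_minus[OF refl[OF L'(4)]]]) (simp add: algebra_simps)
    show "DERIV (\<lambda>s. - S (t0 - s)) s :> (- C (t0 - s)) *
        (- h - a * (- S (t0 - s)) / x (t0 - s) + b * (- C (t0 - s)) / y (t0 - s))"
      unfolding defs by (rule DERIV_cong[OF DERIV_minus[OF refl[OF L'(5)]]]) (simp add: algebra_simps)
  qed (simp_all add: xy \<gamma>0)
qed

text \<open>Two outgoing branches, for h and for - h with time reversed, are joined at the origin. A
  global solution has to be continuous there, and the equation is imposed on the two open
  half-lines.\<close>

lemma global_solution_exists:
  assumes pq: "p \<ge> 2" "q \<ge> 2"
  shows "\<exists>\<gamma>. global_solution_cusp_at_origin p q H \<gamma> 0"
proof -
  define a b h where "a = real q - 1" and "b = real p - 1" and "h = (real p + real q - 1) * H"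
  have cone: "cone a b" using pq by unfold_locales (auto simp: a_def b_def)
  interpret P: cone a b h by (rule cone)
  interpret N: cone a b "- h" by (rule cone)
  obtain x y C S where u: "P.global_branch x y C S" using P.global_branch_exists by blast
  obtain x' y' C' S' where w: "N.global_branch x' y' C' S'" using N.global_branch_exists by blast
  note u = u[unfolded P.global_branch_def] and w = w[unfolded N.global_branch_def]
  have ub: "P.branch_on {0<..} x y C S" and wb: "N.branch_on {0<..} x' y' C' S'" using u w by auto
  note U = ub[unfolded P.branch_on_def, rule_format] and V = wb[unfolded N.branch_on_def, rule_format]
  define \<gamma> where "\<gamma> t = (if t \<ge> 0 then (x t, y t) else (x' (- t), y' (- t)))" for t
  have refl: "DERIV (\<lambda>s. f (- s)) s :> - d" if "DERIV f (- s) :> d" for f d s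
  proof -
    have "DERIV (\<lambda>s. - s) s :> - 1" by (auto intro!: derivative_eq_intros)
    from DERIV_chain2[where f = f and g = "\<lambda>s. - s" and x = s, OF that this] show ?thesis by simp
  qed
  have tr: "DERIV f t :> d"
    if "DERIV g t :> d" "open I" "t \<in> I" "\<And>s. s \<in> I \<Longrightarrow> g s = f s" for f g d t and I :: "real set"
    using that by (rule has_field_derivative_transform_within_open)
  have sol1: "arclength_cmc_solution_on p q H \<gamma> {0<..}"
  proof (rule arclength_cmc_solutionI[OF open_greaterThan,
        where C = C and S = S and \<kappa> = "\<lambda>t. h - a * S t / x t + b * C t / y t"])
    have "C_k k {0<..} (\<lambda>t. (x t, y t))" for k
      using P.branch_on_smooth[OF ub open_greaterThan] by (intro C_k_Pair)
    then have "C_k k {0<..} \<gamma>" for k by (rule C_k_cong[rotated]) (simp add: \<gamma>_def)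
    then show "smooth_on {0<..} \<gamma>" by (simp add: smooth_on_def)
    fix t :: real assume t: "t \<in> {0<..}"
    have dxy: "DERIV x t :> C t" "DERIV y t :> S t"
      using U[OF t] by blast+
    show "DERIV (\<lambda>t. fst (\<gamma> t)) t :> C t"
      by (rule tr[OF dxy(1) open_greaterThan t]) (simp add: \<gamma>_def)
    show "DERIV (\<lambda>t. snd (\<gamma> t)) t :> S t"
      by (rule tr[OF dxy(2) open_greaterThan t]) (simp add: \<gamma>_def)
    show "DERIV C t :> - S t * (h - a * S t / x t + b * C t / y t)"
      "DERIV S t :> C t * (h - a * S t / x t + b * C t / y t)" "(C t)\<^sup>2 + (S t)\<^sup>2 = 1"
      using U[OF t] by blast+
    show "h - a * S t / x t + b * C t / y t = (real p + real q - 1) * H - (real q - 1) * S t / fst (\<gamma> t)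
        + (real p - 1) * C t / snd (\<gamma> t)"
      using t by (simp add: h_def a_def b_def \<gamma>_def)
  qed
  have sol2: "arclength_cmc_solution_on p q H \<gamma> {..<0}"
  proof (rule arclength_cmc_solutionI[OF open_lessThan,
        where C = "\<lambda>t. - C' (- t)" and S = "\<lambda>t. - S' (- t)"
          and \<kappa> = "\<lambda>t. - (- h - a * S' (- t) / x' (- t) + b * C' (- t) / y' (- t))"])
    have "C_k k {..<0} (\<lambda>t. (x' (- t), y' (- t)))" for k
      using N.branch_on_smooth[OF wb open_greaterThan]
      by (intro C_k_Pair C_k_compose_linear[where L = uminus and S = "{0<..}"]
          bounded_linear_minus[OF bounded_linear_ident]) auto
    then have "C_k k {..<0} \<gamma>" for k by (rule C_k_cong[rotated]) (simp add: \<gamma>_def)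
    then show "smooth_on {..<0} \<gamma>" by (simp add: smooth_on_def)
    fix t :: real assume t: "t \<in> {..<0}"
    then have t': "- t \<in> {0<..}" by simp
    note V' = V[OF t']
    have d: "DERIV x' (- t) :> C' (- t)" "DERIV y' (- t) :> S' (- t)"
      "DERIV C' (- t) :> - S' (- t) * (- h - a * S' (- t) / x' (- t) + b * C' (- t) / y' (- t))"
      "DERIV S' (- t) :> C' (- t) * (- h - a * S' (- t) / x' (- t) + b * C' (- t) / y' (- t))"
      using V' by blast+
    show "DERIV (\<lambda>t. fst (\<gamma> t)) t :> - C' (- t)"
      by (rule tr[OF refl[OF d(1)] open_lessThan t]) (simp add: \<gamma>_def)
    show "DERIV (\<lambda>t. snd (\<gamma> t)) t :> - S' (- t)"
      by (rule tr[OF refl[OF d(2)] open_lessThan t]) (simp add: \<gamma>_def)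
    show "DERIV (\<lambda>t. - C' (- t)) t :> - (- S' (- t)) * - (- h - a * S' (- t) / x' (- t) + b * C' (- t) / y' (- t))"
      by (rule DERIV_cong[OF DERIV_minus[OF refl[OF d(3)]]]) (simp add: algebra_simps)
    show "DERIV (\<lambda>t. - S' (- t)) t :> - C' (- t) * - (- h - a * S' (- t) / x' (- t) + b * C' (- t) / y' (- t))"
      by (rule DERIV_cong[OF DERIV_minus[OF refl[OF d(4)]]]) (simp add: algebra_simps)
    show "(- C' (- t))\<^sup>2 + (- S' (- t))\<^sup>2 = 1" using V' by simp
    show "- (- h - a * S' (- t) / x' (- t) + b * C' (- t) / y' (- t)) = (real p + real q - 1) * H - (real q - 1) * - S' (- t) / fst (\<gamma> t)
        + (real p - 1) * - C' (- t) / snd (\<gamma> t)"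
      using t by (simp add: h_def a_def b_def \<gamma>_def)
  qed
  have "isCont \<gamma> t" for t
  proof (cases "t = 0")
    case True
    have "(\<gamma> \<longlongrightarrow> (0, 0)) (at_right 0)"
    proof (rule Lim_transform_eventually)
      show "((\<lambda>t. (x t, y t)) \<longlongrightarrow> (0, 0)) (at_right 0)" using u by (auto intro: tendsto_Pair)
      show "\<forall>\<^sub>F t in at_right 0. (x t, y t) = \<gamma> t"
        by (rule eventually_at_rightI[of 0 1]) (auto simp: \<gamma>_def)
    qed
    moreover have "(\<gamma> \<longlongrightarrow> (0, 0)) (at_left 0)"
      unfolding filterlim_at_left_to_right
    proof (rule Lim_transform_eventually)
      show "((\<lambda>t. (x' t, y' t)) \<longlongrightarrow> (0, 0)) (at_right (- 0))" using w by (auto intro: tendsto_Pair)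
      show "\<forall>\<^sub>F t in at_right (- 0). (x' t, y' t) = \<gamma> (- t)"
        by (simp, rule eventually_at_rightI[of 0 1]) (auto simp: \<gamma>_def)
    qed
    ultimately have "(\<gamma> \<longlongrightarrow> (0, 0)) (at 0)" by (intro filterlim_split_at) auto
    moreover have "\<gamma> 0 = (0, 0)" using u by (simp add: \<gamma>_def)
    ultimately show ?thesis by (simp add: isCont_def True)
  next
    case False
    then have "t \<in> {0<..} \<or> t \<in> {..<0}" by auto
    then have "(\<gamma> has_vector_derivative velocity UNIV \<gamma> t) (at t)"
      using smooth_curve_derivatives(1)[OF open_greaterThan, of 0 \<gamma> t] smooth_curve_derivatives(1)[OF open_lessThan, of 0 \<gamma> t]
        sol1 sol2 by (auto simp: arclength_cmc_solution_on_def)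
    then show ?thesis by (rule has_vector_derivative_continuous)
  qed
  then have "continuous_on UNIV \<gamma>" by (simp add: continuous_on_eq_continuous_at)
  moreover have "\<gamma> 0 = (0, 0)" using u by (simp add: \<gamma>_def)
  moreover have "\<gamma> t \<in> Q1" if "t \<noteq> 0" for t
    using that U[of t] V[of "- t"] by (auto simp: \<gamma>_def Q1_def)
  ultimately show ?thesis
    using sol1 sol2 unfolding global_solution_cusp_at_origin_def by blast
qed

context cone
begin

lemma branch_curve_at_cusp:
  fixes g :: "real \<Rightarrow> real \<times> real"
  assumes G: "global_branch (\<lambda>s. fst (g s)) (\<lambda>s. snd (g s)) C S"
  shows "smooth_on {0..} g" "velocity {0..} g 0 = (C0, S0)" "signed_curvature {0..} g 0 = k0"
    "(g has_vector_derivative (C0, S0)) (at 0 within {0..})"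
proof -
  note R = global_branch_regular_at_cusp[OF G]
  have B: "branch_on {0<..} (\<lambda>s. fst (g s)) (\<lambda>s. snd (g s)) C S" using G by (simp add: global_branch_def)
  note B = B[unfolded branch_on_def, rule_format]
  have "C_k k {0..} (\<lambda>s. (fst (g s), snd (g s)))" for k by (intro C_k_Pair R(1,2))
  then show "smooth_on {0..} g" by (simp add: smooth_on_def)
  \<comment> \<open>\<open>global_branch\<close> leaves \<open>C 0\<close> and \<open>S 0\<close>
    open, so the velocity is completed at 0 by its limit.\<close>
  define v where "v s = (if s = 0 then C0 else C s, if s = 0 then S0 else S s)" for s
  have d: "(g has_vector_derivative v s) (at s within {0..})" if "s \<ge> 0" for s
  proof (cases "s = 0")
    case True
    then show ?thesis using R(3,4) by (auto simp: v_def intro: has_vector_derivative_PairI)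
  next
    case False
    then have "s \<in> {0<..}" using that by simp
    from B[OF this] show ?thesis using False
      by (auto simp: v_def intro!: has_vector_derivative_PairI has_field_derivative_at_within)
  qed
  show "(g has_vector_derivative (C0, S0)) (at 0 within {0..})" using d[of 0] by (simp add: v_def)
  have vel: "velocity {0..} g s = v s" if "s \<ge> 0" for s
    unfolding velocity_def by (rule vector_derivative_within[OF at_within_atLeast_neq_bot[OF that] d[OF that]])
  then show v0: "velocity {0..} g 0 = (C0, S0)" by (simp add: v_def)
  have "(v has_vector_derivative (- S0 * k0, C0 * k0)) (at 0 within {0..})"
    by (rule has_vector_derivative_PairI) (use R(5,6) in \<open>simp_all add: v_def\<close>)
  then have "(velocity {0..} g has_vector_derivative (- S0 * k0, C0 * k0)) (at 0 within {0..})"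
    by (rule has_vector_derivative_transform[rotated -1]) (simp_all add: vel)
  then have acc: "acceleration {0..} g 0 = (- S0 * k0, C0 * k0)"
    unfolding acceleration_def by (intro vector_derivative_within at_within_atLeast_neq_bot) auto
  have "C0 * (C0 * k0) - - S0 * k0 * S0 = k0 * (C0\<^sup>2 + S0\<^sup>2)" by (simp add: power2_eq_square algebra_simps)
  then show "signed_curvature {0..} g 0 = k0"
    unfolding signed_curvature_def speed_def v0 acc fst_conv snd_conv C0_S0 by simp
qed

end

section \<open>The generated hypersurface\<close>

lemma orthogonal_transformation_image_sphere:
  fixes A :: "real^'n \<Rightarrow> real^'n"
  assumes "orthogonal_transformation A"
  shows "A ` sphere 0 1 = sphere 0 1"
proof
  show "A ` sphere 0 1 \<subseteq> sphere 0 1"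
    using orthogonal_transformation_norm[OF assms] by auto
  show "sphere 0 1 \<subseteq> A ` sphere 0 1"
  proof
    fix w :: "real^'n" assume w: "w \<in> sphere 0 1"
    obtain u where u: "w = A u" using orthogonal_transformation_surj[OF assms] by (metis surjD)
    then show "w \<in> A ` sphere 0 1" using w orthogonal_transformation_norm[OF assms, of u] by auto
  qed
qed

lemma orthogonally_invariant_generated_hypersurface:
  "orthogonally_invariant (generated_hypersurface \<gamma> :: ((real^'q) \<times> (real^'p)) set)"
  unfolding orthogonally_invariant_def
proof (intro allI impI)
  fix A :: "real^'q \<Rightarrow> real^'q" and B :: "real^'p \<Rightarrow> real^'p"
  assume AB: "orthogonal_transformation A" "orthogonal_transformation B"
  have lin: "A (c *\<^sub>R u) = c *\<^sub>R A u" "B (c *\<^sub>R v) = c *\<^sub>R B v" for c u v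
    using AB[THEN orthogonal_transformation_linear] by (simp_all add: linear_scale)
  have "(\<lambda>(u, v). (A u, B v)) ` generated_hypersurface \<gamma>
      = orbit_map \<gamma> ` (\<lambda>(t, u, v). (t, A u, B v)) ` (UNIV \<times> sphere 0 1 \<times> sphere 0 1)"
    unfolding generated_hypersurface_def image_image by (intro image_cong refl) (auto simp: orbit_map_def lin)
  also have "(\<lambda>(t, u, v). (t, A u, B v)) ` (UNIV \<times> sphere 0 1 \<times> sphere 0 1)
      = (UNIV :: real set) \<times> (A ` sphere 0 1) \<times> (B ` sphere 0 1)"
    by (auto simp: image_iff) (metis mem_sphere_0)+
  also have "orbit_map \<gamma> ` \<dots> = generated_hypersurface \<gamma>"
    unfolding orthogonal_transformation_image_sphere[OF AB(1)] orthogonal_transformation_image_sphere[OF AB(2)]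
      generated_hypersurface_def ..
  finally show "(\<lambda>(u, v). (A u, B v)) ` generated_hypersurface \<gamma> = (generated_hypersurface \<gamma> :: ((real^'q) \<times> (real^'p)) set)" .
qed

lemma generated_hypersurface_translation:
  "generated_hypersurface (\<lambda>t. \<gamma> (t + c)) = (generated_hypersurface \<gamma> :: ((real^'q) \<times> (real^'p)) set)"
proof -
  have "generated_hypersurface (\<lambda>t. \<gamma> (t + c)) = orbit_map \<gamma> ` (\<lambda>(t, u, v). (t + c, u, v)) `
      (UNIV \<times> sphere (0 :: real^'q) 1 \<times> sphere (0 :: real^'p) 1)"
    unfolding generated_hypersurface_def image_image by (intro image_cong refl) (auto simp: orbit_map_def)
  also have "(\<lambda>(t, u, v). (t + c, u, v)) ` (UNIV \<times> sphere (0 :: real^'q) 1 \<times> sphere (0 :: real^'p) 1)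
      = UNIV \<times> sphere 0 1 \<times> sphere 0 1"
  proof -
    have "(t, u, v) \<in> (\<lambda>(t, u, v). (t + c, u, v)) ` (UNIV \<times> sphere 0 1 \<times> sphere 0 1)"
      if "u \<in> sphere 0 1" "v \<in> sphere 0 1" for t and u :: "real^'q" and v :: "real^'p"
      using that by (intro image_eqI[of _ _ "(t - c, u, v)"]) auto
    then show ?thesis by auto
  qed
  finally show ?thesis by (simp add: generated_hypersurface_def)
qed

lemma ex_unit_scaleR: "\<exists>u\<in>sphere 0 1. w = norm w *\<^sub>R (u :: real^'n)"
proof (cases "w = 0")
  case True
  then show ?thesis by (intro bexI[of _ "axis undefined 1"]) auto
next
  case False
  then show ?thesis by (intro bexI[of _ "sgn w"]) (auto simp: sgn_div_norm)
qed

text \<open>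
  All the half-lines spanned by \<open>(c u, d v)\<close> with unit vectors \<open>u\<close>, \<open>v\<close> are tangent to the
  hypersurface at the cusp, and they span the whole space.
\<close>

lemma singular_at_cusp:
  fixes \<gamma> :: "real \<Rightarrow> real \<times> real"
  assumes \<gamma>0: "\<gamma> t0 = (0, 0)" and d: "((\<lambda>s. \<gamma> (t0 + s)) has_vector_derivative (c, d)) (at 0 within {0..})"
    and cd: "c \<noteq> 0" "d \<noteq> 0"
  shows "singular_at (generated_hypersurface \<gamma> :: ((real^'q) \<times> (real^'p)) set) 0"
  unfolding singular_at_def
proof
  let ?M = "generated_hypersurface \<gamma> :: ((real^'q) \<times> (real^'p)) set"
  have mem: "(fst (\<gamma> t) *\<^sub>R u, snd (\<gamma> t) *\<^sub>R v) \<in> ?M" if "u \<in> sphere 0 1" "v \<in> sphere 0 1" for t u v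
    unfolding generated_hypersurface_def orbit_map_def using that by (intro image_eqI[of _ _ "(t, u, v)"]) auto
  obtain u0 :: "real^'q" where u0: "u0 \<in> sphere 0 1" using ex_unit_scaleR by blast
  obtain v0 :: "real^'p" where v0: "v0 \<in> sphere 0 1" using ex_unit_scaleR by blast
  show "0 \<in> ?M" using mem[OF u0 v0, of t0] by (simp add: \<gamma>0 zero_prod_def)
  show "\<not> smooth_hypersurface_at ?M 0"
  proof
    assume "smooth_hypersurface_at ?M 0"
    then obtain U and f :: "(real^'q) \<times> (real^'p) \<Rightarrow> real" where U: "open U" "0 \<in> U" "smooth_on U f"
      "frechet_derivative f (at 0) \<noteq> (\<lambda>v. 0)" "?M \<inter> U = {z \<in> U. f z = 0}"
      unfolding smooth_hypersurface_at_def by blast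
    have "C_k (Suc 0) U f" using U(3) unfolding smooth_on_def by blast
    then obtain f' where "\<forall>z\<in>U. (f has_derivative f' z) (at z within U)" by auto
    then have "(f has_derivative f' 0) (at 0)" using U(1,2) by (metis at_within_open)
    then have Df: "(f has_derivative frechet_derivative f (at 0)) (at 0)"
      using frechet_derivative_at by metis
    define D where "D = frechet_derivative f (at 0)"
    have linD: "linear D" using has_derivative_linear[OF Df] by (simp add: D_def)
    have D0: "D (c *\<^sub>R u, d *\<^sub>R v) = 0" if uv: "u \<in> sphere 0 1" "v \<in> sphere 0 1" for u v
    proof -
      define \<phi> where "\<phi> s = (fst (\<gamma> (t0 + s)) *\<^sub>R u, snd (\<gamma> (t0 + s)) *\<^sub>R v)" for s
      have \<phi>0: "\<phi> 0 = 0" by (simp add: \<phi>_def \<gamma>0 zero_prod_def)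
      have d\<phi>: "(\<phi> has_vector_derivative (c *\<^sub>R u, d *\<^sub>R v)) (at 0 within {0..})"
        unfolding \<phi>_def[abs_def]
        using has_vector_derivative_fst_snd[OF d]
        by (intro has_vector_derivative_Pair) (auto intro!: derivative_eq_intros)
      have "((f \<circ> \<phi>) has_vector_derivative D (c *\<^sub>R u, d *\<^sub>R v)) (at 0 within {0..})"
        using vector_derivative_diff_chain_within[OF d\<phi>, of f D] Df
        by (simp add: D_def \<phi>0 has_derivative_at_withinI)
      \<comment> \<open>\<open>\<phi>\<close> stays in the hypersurface, on which f vanishes near 0,
        so the one-sided derivative of the composition is 0 as well.\<close>
      moreover have "((f \<circ> \<phi>) has_vector_derivative 0) (at 0 within {0..})"
      proof -
        have "continuous (at 0 within {0..}) \<phi>" using d\<phi> by (rule has_vector_derivative_continuous)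
        then have "(\<phi> \<longlongrightarrow> 0) (at 0 within {0..})" by (simp add: continuous_within \<phi>0)
        then have "\<forall>\<^sub>F s in at 0 within {0..}. \<phi> s \<in> U" using U(1,2) by (rule topological_tendstoD)
        then have ev: "\<forall>\<^sub>F s in at 0 within {0..}. 0 = (f \<circ> \<phi>) s"
        proof (rule eventually_mono)
          fix s assume "\<phi> s \<in> U"
          moreover have "\<phi> s \<in> ?M" unfolding \<phi>_def by (rule mem[OF uv])
          ultimately show "0 = (f \<circ> \<phi>) s" using U(5) by auto
        qed
        have z: "0 = (f \<circ> \<phi>) 0"
          using U(2,5) mem[OF uv, of t0] by (auto simp: \<phi>0 \<gamma>0 zero_prod_def)
        have "((\<lambda>s. 0 :: real) has_derivative (\<lambda>h. h *\<^sub>R 0)) (at 0 within {0 :: real..})" by simp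
        from has_derivative_transform_eventually[OF this ev z] show ?thesis
          unfolding has_vector_derivative_def by (simp add: comp_def)
      qed
      ultimately show ?thesis
        by (rule vector_derivative_unique_within[OF at_within_atLeast_neq_bot[OF order_refl]])
    qed
    have Dw: "D (w, 0) = 0" for w
    proof -
      obtain u where u: "u \<in> sphere 0 1" "w = norm w *\<^sub>R u" using ex_unit_scaleR by blast
      \<comment> \<open>Adding the tangent vectors for \<open>v0\<close> and \<open>- v0\<close>
        isolates the first factor.\<close>
      have "(2 * c) *\<^sub>R (u, 0) = (c *\<^sub>R u, d *\<^sub>R v0) + (c *\<^sub>R u, d *\<^sub>R (- v0))" by (simp add: scaleR_2[symmetric])
      then have "(2 * c) * D (u, 0) = D (c *\<^sub>R u, d *\<^sub>R v0) + D (c *\<^sub>R u, d *\<^sub>R (- v0))"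
        using linear_scale[OF linD, of "2 * c" "(u, 0)"] linear_add[OF linD] by (metis real_scaleR_def)
      then have "D (u, 0) = 0" using D0[OF u(1) v0] D0[OF u(1), of "- v0"] v0 cd by simp
      moreover have "(w, 0) = norm w *\<^sub>R (u, 0 :: real^'p)" using u(2) by simp
      ultimately show ?thesis using linear_scale[OF linD, of "norm w" "(u, 0)"] by simp
    qed
    have Dz: "D (0, z) = 0" for z
    proof -
      obtain v where v: "v \<in> sphere 0 1" "z = norm z *\<^sub>R v" using ex_unit_scaleR by blast
      have "(2 * d) *\<^sub>R (0, v) = (c *\<^sub>R u0, d *\<^sub>R v) + (c *\<^sub>R (- u0), d *\<^sub>R v)" by (simp add: scaleR_2[symmetric])
      then have "(2 * d) * D (0, v) = D (c *\<^sub>R u0, d *\<^sub>R v) + D (c *\<^sub>R (- u0), d *\<^sub>R v)"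
        using linear_scale[OF linD, of "2 * d" "(0, v)"] linear_add[OF linD] by (metis real_scaleR_def)
      then have "D (0, v) = 0" using D0[OF u0 v(1)] D0[OF _ v(1), of "- u0"] u0 cd by simp
      moreover have "(0, z) = norm z *\<^sub>R (0 :: real^'q, v)" using v(2) by simp
      ultimately show ?thesis using linear_scale[OF linD, of "norm z" "(0, v)"] by simp
    qed
    have "D (w, z) = 0" for w z
      using linear_add[OF linD, of "(w, 0)" "(0, z)"] Dw Dz by simp
    then have "D = (\<lambda>v. 0)" by (auto simp: fun_eq_iff)
    then show False using U(4) by (simp add: D_def)
  qed
qed

lemma immersion_orbit_map:
  fixes \<gamma> :: "real \<Rightarrow> real \<times> real"
  assumes sm: "smooth_on I \<gamma>" and I: "open I"
    and pos: "\<And>t. t \<in> I \<Longrightarrow> fst (\<gamma> t) > 0 \<and> snd (\<gamma> t) > 0" and sp: "\<And>t. t \<in> I \<Longrightarrow> speed UNIV \<gamma> t = 1"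
  shows "immersion_on_spheres I (orbit_map \<gamma> :: real \<times> (real^'q) \<times> (real^'p) \<Rightarrow> (real^'q) \<times> (real^'p))"
  unfolding immersion_on_spheres_def
proof (intro conjI ballI)
  let ?\<Phi> = "orbit_map \<gamma> :: real \<times> (real^'q) \<times> (real^'p) \<Rightarrow> (real^'q) \<times> (real^'p)"
  have \<Phi>: "?\<Phi> = (\<lambda>z. (fst (\<gamma> (fst z)) *\<^sub>R fst (snd z), snd (\<gamma> (fst z)) *\<^sub>R snd (snd z)))"
    by (auto simp: orbit_map_def)
  have "C_k k (I \<times> UNIV \<times> UNIV) ?\<Phi>" for k
  proof -
    have "C_k k I \<gamma>" using sm by (simp add: smooth_on_def)
    then have g: "C_k k (I \<times> UNIV \<times> UNIV) (\<lambda>z :: real \<times> (real^'q) \<times> (real^'p). \<gamma> (fst z))"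
      by (intro C_k_compose_linear[OF bounded_linear_fst]) auto
    show ?thesis unfolding \<Phi>
      by (intro C_k_Pair C_k_bilinear[OF bounded_bilinear_scaleR] C_k_linear_compose[OF bounded_linear_fst]
          C_k_linear_compose[OF bounded_linear_snd] C_k_linear[OF bounded_linear_snd] g)
  qed
  then show "smooth_on (I \<times> UNIV \<times> UNIV) ?\<Phi>" by (simp add: smooth_on_def)
  fix t and \<xi> :: "real^'q" and \<eta> :: "real^'p"
  assume t: "t \<in> I" and \<xi>: "\<xi> \<in> sphere 0 1" and \<eta>: "\<eta> \<in> sphere 0 1"
  define C S where "C = fst (velocity UNIV \<gamma> t)" and "S = snd (velocity UNIV \<gamma> t)"
  have unit: "C\<^sup>2 + S\<^sup>2 = 1" using sp[OF t] by (simp add: speed_def C_def S_def)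
  note d = has_vector_derivative_fst_snd[OF smooth_curve_derivatives(1)[OF I sm t], folded C_def S_def]
  define D where "D z = (fst (\<gamma> t) *\<^sub>R fst (snd z) + (fst z * C) *\<^sub>R \<xi>, snd (\<gamma> t) *\<^sub>R snd (snd z) + (fst z * S) *\<^sub>R \<eta>)"
    for z :: "real \<times> (real^'q) \<times> (real^'p)"
  have dg: "((\<lambda>z :: real \<times> (real^'q) \<times> (real^'p). g (fst z)) has_derivative (\<lambda>z. fst z * g')) (at (t, \<xi>, \<eta>))"
    if "DERIV g t :> g'" for g g'
  proof -
    have "(fst has_derivative fst) (at (t, \<xi>, \<eta>))" by (rule bounded_linear_imp_has_derivative[OF bounded_linear_fst])
    moreover have "(g has_derivative (\<lambda>h. h * g')) (at (fst (t, \<xi>, \<eta>)))"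
      using that by (simp add: has_field_derivative_def mult_commute_abs)
    ultimately show ?thesis by (rule has_derivative_compose)
  qed
  have "(?\<Phi> has_derivative D) (at (t, \<xi>, \<eta>))"
    unfolding \<Phi> D_def[abs_def]
    by (rule has_derivative_eq_rhs[OF has_derivative_Pair[OF
          has_derivative_scaleR[OF dg[OF d(1)] has_derivative_fst[OF has_derivative_snd[OF has_derivative_ident]]]
          has_derivative_scaleR[OF dg[OF d(2)] has_derivative_snd[OF has_derivative_snd[OF has_derivative_ident]]]]])
      auto
  moreover have "inj_on D {(s, w, z). \<xi> \<bullet> w = 0 \<and> \<eta> \<bullet> z = 0}"
  proof (rule inj_onI)
    fix u v assume u: "u \<in> {(s, w, z). \<xi> \<bullet> w = 0 \<and> \<eta> \<bullet> z = 0}" and v: "v \<in> {(s, w, z). \<xi> \<bullet> w = 0 \<and> \<eta> \<bullet> z = 0}"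
      and eq: "D u = D v"
    obtain s w z where u': "u = (s, w, z)" by (cases u)
    obtain s' w' z' where v': "v = (s', w', z')" by (cases v)
    have o: "\<xi> \<bullet> w = 0" "\<eta> \<bullet> z = 0" "\<xi> \<bullet> w' = 0" "\<eta> \<bullet> z' = 0" using u v by (auto simp: u' v')
    have e: "fst (\<gamma> t) *\<^sub>R w + (s * C) *\<^sub>R \<xi> = fst (\<gamma> t) *\<^sub>R w' + (s' * C) *\<^sub>R \<xi>"
      "snd (\<gamma> t) *\<^sub>R z + (s * S) *\<^sub>R \<eta> = snd (\<gamma> t) *\<^sub>R z' + (s' * S) *\<^sub>R \<eta>"
      using eq by (simp_all add: D_def u' v')
    have n: "\<xi> \<bullet> \<xi> = 1" "\<eta> \<bullet> \<eta> = 1" using \<xi> \<eta> by (simp_all add: dot_square_norm)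
    \<comment> \<open>The inner products with \<open>\<xi>\<close> and \<open>\<eta>\<close> remove
      the parts tangent to the spheres; as (C, S) is not 0, one of the two resulting equations
      determines s.\<close>
    have "s * C = s' * C" using arg_cong[OF e(1), of "\<lambda>x. \<xi> \<bullet> x"] by (simp add: inner_add_right o n)
    moreover have "s * S = s' * S" using arg_cong[OF e(2), of "\<lambda>x. \<eta> \<bullet> x"] by (simp add: inner_add_right o n)
    ultimately have "s = s'" using unit by (cases "C = 0") auto
    then show "u = v" using e pos[OF t] by (simp add: u' v')
  qed
  ultimately show "\<exists>D. (?\<Phi> has_derivative D) (at (t, \<xi>, \<eta>)) \<and> inj_on D {(s, w, z). \<xi> \<bullet> w = 0 \<and> \<eta> \<bullet> z = 0}"
    by blast
qed

lemma orbit_map_image_minus_cusp: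
  fixes \<gamma> :: "real \<Rightarrow> real \<times> real"
  assumes "\<gamma> t0 = (0, 0)" "\<And>t. t \<noteq> t0 \<Longrightarrow> fst (\<gamma> t) > 0"
  shows "orbit_map \<gamma> ` ((UNIV - {t0}) \<times> sphere 0 1 \<times> sphere 0 1)
    = (generated_hypersurface \<gamma> :: ((real^'q) \<times> (real^'p)) set) - {0}"
proof -
  have z: "orbit_map \<gamma> (t, u, v) = 0 \<longleftrightarrow> t = t0" if "u \<in> sphere 0 1" for t and u :: "real^'q" and v :: "real^'p"
    using assms(1) assms(2)[of t] that by (cases "t = t0") (auto simp: orbit_map_def zero_prod_def)
  show ?thesis
    unfolding generated_hypersurface_def using z by (auto simp: image_iff)
qed

lemma punctured_line_times_spheres_homeomorphic:
  "((UNIV - {t0 :: real}) \<times> sphere (0 :: real^'q) 1 \<times> sphere (0 :: real^'p) 1) homeomorphic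
    ((UNIV - {0 :: real}) \<times> sphere (0 :: real^'p) 1 \<times> sphere (0 :: real^'q) 1)"
proof -
  have "homeomorphism ((UNIV - {t0}) \<times> sphere (0 :: real^'q) 1 \<times> sphere (0 :: real^'p) 1)
      ((UNIV - {0}) \<times> sphere (0 :: real^'p) 1 \<times> sphere (0 :: real^'q) 1)
      (\<lambda>z. (fst z - t0, snd (snd z), fst (snd z))) (\<lambda>z. (fst z + t0, snd (snd z), fst (snd z)))"
    by (rule homeomorphismI) (auto intro!: continuous_intros)
  then show ?thesis unfolding homeomorphic_def by blast
qed

lemma smooth_on_punctured_line:
  assumes "smooth_on {..<t0} f" "smooth_on {t0 :: real<..} f"
  shows "smooth_on (UNIV - {t0}) f"
  unfolding smooth_on_def
proof
  fix k
  show "C_k k (UNIV - {t0}) f"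
  proof (rule C_k_local)
    fix t assume t: "t \<in> UNIV - {t0}"
    have "at t within (UNIV - {t0}) = at t" by (rule at_within_open[OF t]) (rule open_delete[OF open_UNIV])
    then show "at t within (UNIV - {t0}) \<noteq> bot" by simp
    have "(UNIV - {t0}) \<inter> {..<t0} = {..<t0}" "(UNIV - {t0}) \<inter> {t0<..} = {t0<..}" by auto
    then have "C_k k ((UNIV - {t0}) \<inter> {..<t0}) f" "C_k k ((UNIV - {t0}) \<inter> {t0<..}) f"
      using assms by (auto simp: smooth_on_def)
    moreover have "t \<in> {..<t0} \<or> t \<in> {t0<..}" using t by auto
    ultimately show "\<exists>U. open U \<and> t \<in> U \<and> C_k k ((UNIV - {t0}) \<inter> U) f"
      using open_lessThan open_greaterThan by blast
  qed
qed

section \<open>Assembly of the two branches and of the hypersurface\<close>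

theorem theorem1p1:
  fixes p q :: nat and H \<alpha>\<^sub>0 k\<^sub>u k\<^sub>s :: real
  assumes "p = CARD('p::finite)" and "q = CARD('q::finite)"
    and "p \<ge> 2" and "q \<ge> 2" and "H \<noteq> 0"
    and alpha0: "\<alpha>\<^sub>0 = arctan (sqrt ((real p - 1) / (real q - 1)))"
    and k_u: "k\<^sub>u = 2 * H * (real p + real q - 1) / (3 * real p + 3 * real q - 4)"
    and k_s: "k\<^sub>s = - k\<^sub>u"
  shows
    "(\<exists>!M :: ((real^'q) \<times> (real^'p)) set.
        orthogonally_invariant M \<and>
        (\<exists>\<gamma> t\<^sub>0. global_solution_cusp_at_origin p q H \<gamma> t\<^sub>0 \<and> M = generated_hypersurface \<gamma>)) \<and>
     (\<forall>\<gamma>\<^sub>1 t\<^sub>1 \<gamma>\<^sub>2 t\<^sub>2.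
        global_solution_cusp_at_origin p q H \<gamma>\<^sub>1 t\<^sub>1 \<longrightarrow>
        global_solution_cusp_at_origin p q H \<gamma>\<^sub>2 t\<^sub>2 \<longrightarrow> (\<exists>c. \<forall>t. \<gamma>\<^sub>2 t = \<gamma>\<^sub>1 (t + c))) \<and>
     (\<forall>(M :: ((real^'q) \<times> (real^'p)) set) \<gamma> t\<^sub>0.
        global_solution_cusp_at_origin p q H \<gamma> t\<^sub>0 \<longrightarrow> M = generated_hypersurface \<gamma> \<longrightarrow>
        (singular_at M 0 \<and>
         immersion_on_spheres (UNIV - {t\<^sub>0})
           (orbit_map \<gamma> :: real \<times> (real^'q) \<times> (real^'p) \<Rightarrow> (real^'q) \<times> (real^'p)) \<and>
         orbit_map \<gamma> ` ((UNIV - {t\<^sub>0}) \<times> sphere 0 1 \<times> sphere 0 1) = M - {0} \<and>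
         ((UNIV - {t\<^sub>0}) \<times> sphere (0 :: real^'q) 1 \<times> sphere (0 :: real^'p) 1) homeomorphic
           ((UNIV - {0 :: real}) \<times> sphere (0 :: real^'p) 1 \<times> sphere (0 :: real^'q) 1)) \<and>
        (range \<gamma> = W_s \<gamma> t\<^sub>0 \<union> W_u \<gamma> t\<^sub>0 \<union> {(0, 0)} \<and>
         smooth_on {0..} (outward_u \<gamma> t\<^sub>0) \<and> smooth_on {0..} (outward_s \<gamma> t\<^sub>0) \<and>
         tan \<alpha>\<^sub>0 = sqrt ((real p - 1) / (real q - 1)) \<and>
         tangent_at_endpoint (outward_u \<gamma> t\<^sub>0) {(x, y). y = tan \<alpha>\<^sub>0 * x} \<and>
         tangent_at_endpoint (outward_s \<gamma> t\<^sub>0) {(x, y). y = tan \<alpha>\<^sub>0 * x} \<and>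
         signed_curvature {0..} (outward_u \<gamma> t\<^sub>0) 0 = k\<^sub>u \<and>
         signed_curvature {0..} (outward_s \<gamma> t\<^sub>0) 0 = k\<^sub>s \<and>
         (H > 0 \<longrightarrow> k\<^sub>s < 0)))"
proof -
  define a b h where "a = real q - 1" and "b = real p - 1" and "h = (real p + real q - 1) * H"
  have cone: "cone a b" using \<open>p \<ge> 2\<close> \<open>q \<ge> 2\<close> by unfold_locales (auto simp: a_def b_def)
  interpret P: cone a b h by (rule cone)
  interpret N: cone a b "- h" by (rule cone)
  note branches = global_solution_imp_branches[OF _ \<open>p \<ge> 2\<close> \<open>q \<ge> 2\<close>, where H = H, folded a_def b_def h_def]
  have unique: "\<exists>c. \<forall>t. \<gamma>2 t = \<gamma>1 (t + c)"
    if g1: "global_solution_cusp_at_origin p q H \<gamma>1 t1" and g2: "global_solution_cusp_at_origin p q H \<gamma>2 t2" for \<gamma>1 \<gamma>2 t1 t2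
  proof (intro exI[of _ "t1 - t2"] allI)
    fix t
    \<comment> \<open>Once the cusps are aligned, the two half-lines are compared separately, in the
      interpretations for h and for - h.\<close>
    have "\<gamma>2 (t2 + s) = \<gamma>1 (t1 + s)" "\<gamma>2 (t2 - s) = \<gamma>1 (t1 - s)" if "s \<ge> 0" for s
      using P.global_branch_unique[OF branches(1)[OF g2] branches(1)[OF g1] that]
        N.global_branch_unique[OF branches(2)[OF g2] branches(2)[OF g1] that] by (auto intro: prod_eqI)
    from this(1)[of "t - t2"] this(2)[of "t2 - t"] show "\<gamma>2 t = \<gamma>1 (t + (t1 - t2))"
      by (cases "t \<ge> t2") (auto simp: algebra_simps)
  qed
  obtain \<gamma>0 where \<gamma>0: "global_solution_cusp_at_origin p q H \<gamma>0 0"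
    using global_solution_exists[OF \<open>p \<ge> 2\<close> \<open>q \<ge> 2\<close>] by blast
  have one: "\<exists>!M :: ((real^'q) \<times> (real^'p)) set. orthogonally_invariant M \<and>
      (\<exists>\<gamma> t0. global_solution_cusp_at_origin p q H \<gamma> t0 \<and> M = generated_hypersurface \<gamma>)"
  proof (rule ex1I[of _ "generated_hypersurface \<gamma>0"])
    show "orthogonally_invariant (generated_hypersurface \<gamma>0 :: ((real^'q) \<times> (real^'p)) set) \<and>
      (\<exists>\<gamma> t0. global_solution_cusp_at_origin p q H \<gamma> t0 \<and>
        (generated_hypersurface \<gamma>0 :: ((real^'q) \<times> (real^'p)) set) = generated_hypersurface \<gamma>)"
      using \<gamma>0 orthogonally_invariant_generated_hypersurface by blast
    fix M :: "((real^'q) \<times> (real^'p)) set"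
    assume "orthogonally_invariant M \<and>
      (\<exists>\<gamma> t0. global_solution_cusp_at_origin p q H \<gamma> t0 \<and> M = generated_hypersurface \<gamma>)"
    then obtain \<gamma> t0 where \<gamma>: "global_solution_cusp_at_origin p q H \<gamma> t0" "M = generated_hypersurface \<gamma>" by blast
    obtain c where "\<forall>t. \<gamma> t = \<gamma>0 (t + c)" using unique[OF \<gamma>0 \<gamma>(1)] by blast
    then have "\<gamma> = (\<lambda>t. \<gamma>0 (t + c))" by auto
    then show "M = generated_hypersurface \<gamma>0"
      unfolding \<gamma>(2) by (simp only: generated_hypersurface_translation)
  qed
  have tan: "tan \<alpha>\<^sub>0 = sqrt ((real p - 1) / (real q - 1))" by (simp add: alpha0 tan_arctan)
  have slope: "P.S0 = tan \<alpha>\<^sub>0 * P.C0"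
    using P.S0_eq unfolding P.m_def tan unfolding a_def b_def .
  have "P.k0 = k\<^sub>u"
    unfolding P.k0_def unfolding k_u a_def b_def h_def by (simp add: algebra_simps)
  \<comment> \<open>The outward form of the arriving branch belongs to - h, and \<open>k0\<close> is
    linear in h; this is the source of \<open>k\<^sub>s = - k\<^sub>u\<close>.\<close>
  moreover have "N.k0 = - P.k0" unfolding P.k0_def N.k0_def by simp
  ultimately have ku: "P.k0 = k\<^sub>u" "N.k0 = k\<^sub>s" by (simp_all add: k_s)
  show ?thesis
    apply (rule conjI[OF one], rule conjI)
    subgoal by (intro allI impI) (rule unique)
    apply (intro allI impI)
    subgoal premises prems for M \<gamma> t0
    proof -
      note sol = prems(1) and M = prems(2)
      have outward: "outward_u \<gamma> t0 = (\<lambda>s. \<gamma> (t0 + s))" "outward_s \<gamma> t0 = (\<lambda>s. \<gamma> (t0 - s))"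
        by (simp_all add: fun_eq_iff outward_u_def outward_s_def)
      note u = P.branch_curve_at_cusp[OF branches(1)[OF sol], folded outward]
        and s = N.branch_curve_at_cusp[OF branches(2)[OF sol], folded outward]
      note g = sol[unfolded global_solution_cusp_at_origin_def arclength_cmc_solution_on_def]
      have \<gamma>t0: "\<gamma> t0 = (0, 0)" using g by blast
      have pos: "fst (\<gamma> t) > 0" "snd (\<gamma> t) > 0" if "t \<noteq> t0" for t
        using g that by (auto simp: Q1_def case_prod_beta)
      have sp: "speed UNIV \<gamma> t = 1" if "t \<in> UNIV - {t0}" for t
      proof (cases "t < t0")
        case True
        then show ?thesis using g by auto
      next
        case False
        then have "t \<in> {t0<..}" using that by auto
        then show ?thesis using g by blast
      qed
      have "singular_at M 0"
        unfolding M using u(4) P.C0_pos P.S0_pos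
        by (intro singular_at_cusp[of \<gamma> t0, OF \<gamma>t0]) (auto simp: outward)
      moreover have "immersion_on_spheres (UNIV - {t0})
          (orbit_map \<gamma> :: real \<times> (real^'q) \<times> (real^'p) \<Rightarrow> (real^'q) \<times> (real^'p))"
        by (rule immersion_orbit_map[OF smooth_on_punctured_line open_delete[OF open_UNIV]]) (use g pos sp in auto)
      moreover have "orbit_map \<gamma> ` ((UNIV - {t0}) \<times> sphere 0 1 \<times> sphere 0 1) = M - {0}"
        unfolding M by (rule orbit_map_image_minus_cusp[of \<gamma> t0, OF \<gamma>t0 pos(1)])
      moreover have "range \<gamma> = W_s \<gamma> t0 \<union> W_u \<gamma> t0 \<union> {(0, 0)}"
      proof -
        have "UNIV = {..<t0} \<union> {t0<..} \<union> {t0}" by auto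
        then have "range \<gamma> = \<gamma> ` ({..<t0} \<union> {t0<..} \<union> {t0})" by simp
        then show ?thesis using \<gamma>t0 by (simp add: W_s_def W_u_def image_Un)
      qed
      moreover have "tangent_at_endpoint (outward_u \<gamma> t0) {(x, y). y = tan \<alpha>\<^sub>0 * x}"
        "tangent_at_endpoint (outward_s \<gamma> t0) {(x, y). y = tan \<alpha>\<^sub>0 * x}"
        using P.C0_pos unfolding tangent_at_endpoint_def u(2) s(2)
        by (auto simp: outward \<gamma>t0 slope zero_prod_def)
      moreover have "H > 0 \<longrightarrow> k\<^sub>s < 0"
        using \<open>p \<ge> 2\<close> \<open>q \<ge> 2\<close> by (auto simp: k_s k_u intro!: divide_pos_pos mult_pos_pos)
      ultimately show ?thesis
        using tan u(1,3) s(1,3) ku punctured_line_times_spheres_homeomorphic by simp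
    qed
    done
qed

end
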